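(* Let $g$ be a round metric of unit area on $\mathbb{S}^2$. There exist $\varepsilon_0,c>0$ such that, for any balanced admissible measure $\mu$ on $\mathbb{S}^2$, if $$\int_{\mathbb{S}^2}\varphi^2\,d(\mu-v_g)\leqslant\varepsilon_0\|\varphi\|^2_{W^{1,2}}\qquad\text{for all }\varphi\in W^{1,2},$$ then $$\lambda_1(\mu)\geqslant\frac{8\pi}{1+c\left(\|\mu-dv_g\|_{W^{-1,2}}+\|\mu-dv_g\|^2_{W^{-1,2}}\right)}.$$ Moreover, if in addition $\int_{\mathbb{S}^2}w^2\,d(\mu-v_g)=0$ for every $w\in E_1$, then $$\lambda_1(\mu)\geqslant\frac{8\pi}{1+c\|\mu-dv_g\|^2_{W^{-1,2}}}.$$ In particular, the exponent $2$ in the following stability estimate is sharp, i.e. cannot be replaced by any smaller power: for every admissible $\mu$ with $\lambda_1(\mathbb{S}^2,\mu)=2$ there is a conformal automorphism $\Phi$ of $\mathbb{S}^2$ with $8\pi-\bar\lambda_1(\mathbb{S}^2,\mu)\geqslant2\|\Phi_*\mu-dv_{g_0}\|^2_{W^{-1,2}(\mathbb{S}^2,g_0)}$, where $g_0$ is the round metric of curvature one. That is, for no $p\in(0,2)$ and $c'>0$ is it true that for every such $\mu$ there is a conformal automorphism $\Phi$ with $8\pi-\bar\lambda_1(\mathbb{S}^2,\mu)\geqslant c'\|\Phi_*\mu-dv_{g_0}\|^p_{W^{-1,2}(\mathbb{S}^2,g_0)}$.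
   Context: $dv_g$ (also written $v_g$) is the area measure of $g$; $W^{1,2}=W^{1,2}(\mathbb{S}^2,g)$, and $\|\sigma\|_{W^{-1,2}(\mathbb{S}^2,h)}=\sup\{\int f\,d\sigma: f\in C^\infty(\mathbb{S}^2),\ \|f\|_{W^{1,2}(\mathbb{S}^2,h)}=1\}$, with $W^{-1,2}=W^{-1,2}(\mathbb{S}^2,g)$. $E_1$ is the eigenspace of the Laplacian of $(\mathbb{S}^2,g)$ for $\lambda_1(\mathbb{S}^2,g)=8\pi$, spanned by the three coordinate functions of $\mathbb{S}^2\subset\mathbb{R}^3$. A nonzero (nonnegative) Radon measure $\mu$ on $\mathbb{S}^2$ is admissible if the identity map on $C^\infty(\mathbb{S}^2)$ extends to a compact operator $W^{1,2}\to L^2(\mathbb{S}^2,\mu)$ (for $\varphi\in W^{1,2}$, integrals against $\mu$ are understood via this extension); then $$\lambda_1(\mu)=\lambda_1(\mathbb{S}^2,\mu)=\inf_{E_2}\sup_{0\neq f\in E_2}\frac{\int|\nabla f|_g^2\,dv_g}{\int f^2\,d\mu},$$ the infimum over $2$-dimensional subspaces $E_2\subset C^\infty(\mathbb{S}^2)$ that are also $2$-dimensional in $L^2(\mathbb{S}^2,\mu)$ (by conformal invariance this does not depend on which round metric is used), and $\bar\lambda_1(\mathbb{S}^2,\mu)=\lambda_1(\mathbb{S}^2,\mu)\mu(\mathbb{S}^2)$. A measure $\mu$ is balanced if $\int_{\mathbb{S}^2}F\,d\mu=0\in\mathbb{R}^3$, where $F\colon\mathbb{S}^2\to\mathbb{S}^2\subset\mathbb{R}^3$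 is the identity map viewed as an $\mathbb{R}^3$-valued function. *)

theory Defs
  imports "HOL-Analysis.Analysis"
begin

text \<open>
  Functions on the sphere are represented by functions on \<open>real^3\<close>, whose values off the sphere
  are irrelevant. The round metric \<open>r g\<^sub>0\<close>, with \<open>g\<^sub>0\<close> the metric of curvature one
  induced from \<open>real^3\<close>, is represented by the factor \<open>r > 0\<close>.
\<close>

abbreviation S2 :: "(real^3) set"
  where "S2 \<equiv> sphere 0 1"

abbreviation borel_S2 :: "(real^3) measure"
  where "borel_S2 \<equiv> restrict_space borel S2"

section \<open>Smooth functions, gradient and Laplacian\<close>

primrec Ck_on :: "nat \<Rightarrow> (real^3) set \<Rightarrow> (real^3 \<Rightarrow> real) \<Rightarrow> bool"
  where
    "Ck_on 0 U f \<longleftrightarrow> continuous_on U f"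
  | "Ck_on (Suc k) U f \<longleftrightarrow>
       (\<exists>D. (\<forall>x\<in>U. (f has_derivative D x) (at x)) \<and> (\<forall>v. Ck_on k U (\<lambda>x. D x v)))"

definition smooth_S2 :: "(real^3 \<Rightarrow> real) \<Rightarrow> bool"
  where "smooth_S2 f \<longleftrightarrow>
    (\<forall>p\<in>S2. \<exists>U h. open U \<and> p \<in> U \<and> (\<forall>k. Ck_on k U h) \<and> (\<forall>x\<in>U \<inter> S2. f x = h x))"

text \<open>
  The gradient for \<open>g\<^sub>0\<close>. Derivatives within the sphere are determined on tangent vectors only;
  tangency of \<open>w\<close> makes it unique.
\<close>
definition grad_S2 :: "(real^3 \<Rightarrow> real) \<Rightarrow> real^3 \<Rightarrow> real^3"
  where "grad_S2 f x =
    (THE w. w \<bullet> x = 0 \<and> (f has_derivative (\<lambda>v. w \<bullet> v)) (at x within S2))"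

text \<open>
  \<open>\<Delta> = div \<circ> grad\<close> for the metric \<open>r g\<^sub>0\<close>. The divergence on the sphere of a tangent
  field \<open>X\<close> is the sum over \<open>i\<close> of the \<open>i\<close>-th component of the gradient of \<open>X $ i\<close>.
\<close>
definition laplacian_S2 :: "real \<Rightarrow> (real^3 \<Rightarrow> real) \<Rightarrow> real^3 \<Rightarrow> real"
  where "laplacian_S2 r f x = (\<Sum>i\<in>UNIV. grad_S2 (\<lambda>y. grad_S2 f y $ i) x $ i) / r"

definition eigenspace :: "real \<Rightarrow> real \<Rightarrow> (real^3 \<Rightarrow> real) set"
  where "eigenspace r l = {w. smooth_S2 w \<and> (\<forall>x\<in>S2. - laplacian_S2 r w x = l * w x)}"

section \<open>Area measure and Sobolev space\<close>

text \<open>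
  In spherical coordinates, which miss only a null set, the Riemannian area element of
  \<open>g\<^sub>0\<close> is \<open>sin \<theta> d\<theta> d\<phi>\<close>.
\<close>
definition area_measure :: "real \<Rightarrow> (real^3) measure"
  where "area_measure r = scale_measure (ennreal r)
    (distr
      (density (lborel :: (real \<times> real) measure)
        (\<lambda>(\<theta>, \<phi>). ennreal (indicator ({0<..<pi} \<times> {0<..<2 * pi}) (\<theta>, \<phi>) * sin \<theta>)))
      borel_S2
      (\<lambda>(\<theta>, \<phi>). vector [sin \<theta> * cos \<phi>, sin \<theta> * sin \<phi>, cos \<theta>]))"

definition L2 :: "'a measure \<Rightarrow> ('a \<Rightarrow> 'b::euclidean_space) set"
  where "L2 M = {f \<in> borel_measurable M. integrable M (\<lambda>x. (norm (f x))\<^sup>2)}"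

text \<open>
  \<open>W\<^sup>1\<^sup>,\<^sup>2\<close> is the completion of the smooth functions, realised inside \<open>L\<^sup>2\<close>. The metrics
  \<open>r g\<^sub>0\<close> all give the same space, so membership is expressed through \<open>g\<^sub>0\<close>; the norm depends
  on \<open>r\<close>. The limit gradient is taken with respect to \<open>g\<^sub>0\<close> and is unique almost everywhere.
\<close>
definition is_sobolev_grad :: "(real^3 \<Rightarrow> real) \<Rightarrow> (real^3 \<Rightarrow> real^3) \<Rightarrow> bool"
  where "is_sobolev_grad u G \<longleftrightarrow>
    u \<in> L2 (area_measure 1) \<and> G \<in> L2 (area_measure 1) \<and>
    (\<exists>f. (\<forall>n. smooth_S2 (f n)) \<and>
         (\<lambda>n. \<integral>x. (f n x - u x)\<^sup>2 \<partial>area_measure 1) \<longlonglongrightarrow> 0 \<and>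
         (\<lambda>n. \<integral>x. (norm (grad_S2 (f n) x - G x))\<^sup>2 \<partial>area_measure 1) \<longlonglongrightarrow> 0)"

definition W12 :: "(real^3 \<Rightarrow> real) set"
  where "W12 = {u. \<exists>G. is_sobolev_grad u G}"

definition sobolev_grad :: "(real^3 \<Rightarrow> real) \<Rightarrow> real^3 \<Rightarrow> real^3"
  where "sobolev_grad u = (SOME G. is_sobolev_grad u G)"

text \<open>
  If \<open>G\<close> is the gradient for \<open>g\<^sub>0\<close>, the squared length of the gradient for \<open>r g\<^sub>0\<close>,
  measured in \<open>r g\<^sub>0\<close>, is \<open>|G|\<^sup>2 / r\<close>.
\<close>
definition W12_norm :: "real \<Rightarrow> (real^3 \<Rightarrow> real) \<Rightarrow> real"
  where "W12_norm r u =
    sqrt ((\<integral>x. (norm (sobolev_grad u x))\<^sup>2 / r \<partial>area_measure r) + (\<integral>x. (u x)\<^sup>2 \<partial>area_measure r))"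

text \<open>The dual norm, for \<open>r g\<^sub>0\<close>, of the signed measure \<open>\<mu> - \<nu>\<close>.\<close>
definition Wm12_norm_diff :: "real \<Rightarrow> (real^3) measure \<Rightarrow> (real^3) measure \<Rightarrow> real"
  where "Wm12_norm_diff r \<mu> \<nu> =
    Sup {(\<integral>x. f x \<partial>\<mu>) - (\<integral>x. f x \<partial>\<nu>) | f. smooth_S2 f \<and> W12_norm r f = 1}"

section \<open>Admissible measures and the first eigenvalue\<close>

text \<open>
  The operator \<open>T\<close> acts on representatives. That it respects equality almost everywhere, and
  that it is bounded, follow from linearity and compactness; by density of the smooth functions
  it is unique up to \<open>\<mu>\<close>-null sets.
\<close>
definition compact_extension ::
    "real \<Rightarrow> (real^3) measure \<Rightarrow> ((real^3 \<Rightarrow> real) \<Rightarrow> (real^3 \<Rightarrow> real)) \<Rightarrow> bool"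
  where "compact_extension r \<mu> T \<longleftrightarrow>
    (\<forall>u\<in>W12. T u \<in> L2 \<mu>) \<and>
    (\<forall>u\<in>W12. \<forall>v\<in>W12. \<forall>a b.
       AE x in \<mu>. T (\<lambda>y. a * u y + b * v y) x = a * T u x + b * T v x) \<and>
    (\<forall>f. smooth_S2 f \<longrightarrow> (AE x in \<mu>. T f x = f x)) \<and>
    (\<forall>u C. (\<forall>n. u n \<in> W12 \<and> W12_norm r (u n) \<le> C) \<longrightarrow>
       (\<exists>s v. strict_mono (s :: nat \<Rightarrow> nat) \<and> v \<in> L2 \<mu> \<and>
          (\<lambda>n. \<integral>x. (T (u (s n)) x - v x)\<^sup>2 \<partial>\<mu>) \<longlonglongrightarrow> 0))"

text \<open>On a compact metric space every finite Borel measure is Radon.\<close>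
definition admissible :: "real \<Rightarrow> (real^3) measure \<Rightarrow> bool"
  where "admissible r \<mu> \<longleftrightarrow>
    sets \<mu> = sets borel_S2 \<and> finite_measure \<mu> \<and> emeasure \<mu> S2 \<noteq> 0 \<and>
    (\<exists>T. compact_extension r \<mu> T)"

definition ext_op :: "real \<Rightarrow> (real^3) measure \<Rightarrow> (real^3 \<Rightarrow> real) \<Rightarrow> real^3 \<Rightarrow> real"
  where "ext_op r \<mu> = (SOME T. compact_extension r \<mu> T)"

text \<open>Linear independence in \<open>L\<^sup>2(\<mu>)\<close> implies linear independence as functions.\<close>
definition two_dim_subspace :: "(real^3) measure \<Rightarrow> (real^3 \<Rightarrow> real) set \<Rightarrow> bool"
  where "two_dim_subspace \<mu> E \<longleftrightarrow>
    (\<exists>f h. smooth_S2 f \<and> smooth_S2 h \<and>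
       E = {\<lambda>x. a * f x + b * h x | a b. True} \<and>
       (\<forall>a b. (AE x in \<mu>. a * f x + b * h x = 0) \<longrightarrow> a = 0 \<and> b = 0))"

definition rayleigh :: "real \<Rightarrow> (real^3) measure \<Rightarrow> (real^3 \<Rightarrow> real) \<Rightarrow> real"
  where "rayleigh r \<mu> f =
    (\<integral>x. (norm (grad_S2 f x))\<^sup>2 / r \<partial>area_measure r) / (\<integral>x. (f x)\<^sup>2 \<partial>\<mu>)"

definition lambda1 :: "real \<Rightarrow> (real^3) measure \<Rightarrow> real"
  where "lambda1 r \<mu> =
    (INF E\<in>Collect (two_dim_subspace \<mu>). SUP f\<in>E - {\<lambda>x. 0}. rayleigh r \<mu> f)"

definition lambda1_bar :: "real \<Rightarrow> (real^3) measure \<Rightarrow> real"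
  where "lambda1_bar r \<mu> = lambda1 r \<mu> * measure \<mu> S2"

definition balanced :: "(real^3) measure \<Rightarrow> bool"
  where "balanced \<mu> \<longleftrightarrow> (\<integral>x. x \<partial>\<mu>) = 0"

section \<open>Conformal automorphisms\<close>

definition conformal_automorphism :: "(real^3 \<Rightarrow> real^3) \<Rightarrow> bool"
  where "conformal_automorphism \<Phi> \<longleftrightarrow>
    bij_betw \<Phi> S2 S2 \<and>
    (\<forall>i. smooth_S2 (\<lambda>x. \<Phi> x $ i)) \<and> (\<forall>i. smooth_S2 (\<lambda>x. inv_into S2 \<Phi> x $ i)) \<and>
    (\<forall>x\<in>S2. \<exists>D c. (\<Phi> has_derivative D) (at x within S2) \<and> c > 0 \<and>
       (\<forall>v w. v \<bullet> x = 0 \<and> w \<bullet> x = 0 \<longrightarrow> D v \<bullet> D w = c * (v \<bullet> w)))"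

end

theory Submission
  imports Defs "HOL-Library.Diagonal_Subsequence"
begin

text \<open>
  Lower bound. Split a function of mean zero as \<open>f = w + h\<close> with \<open>w\<close> linear and \<open>h\<close> orthogonal to the
  constants and the linear functions. On \<open>h\<close> the Laplacian has its second eigenvalue, which is three
  times the first, so the hypothesis with a small \<open>\<epsilon>\<^sub>0\<close> controls the \<open>h\<close> part of \<open>\<integral> f\<^sup>2 d\<mu>\<close> with room to spare;
  the cross term is at most the dual norm times \<open>\<parallel>w\<parallel> \<parallel>h\<parallel>\<close>, and Young's inequality makes it quadratic
  in the dual norm. The \<open>w\<close> part is what produces the linear term.

  Sharpness. Perturb the area by a weight \<open>1 + t \<psi>\<close> with \<open>\<psi>\<close> a harmonic of degree four. It does not see
  squares of linear functions, so the deficit is of order \<open>t\<^sup>2\<close>. If the image under a conformal map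
  \<open>\<Phi>\<close> were at distance \<open>\<eta>\<close> from the area, the nine harmonics of degree at most two, composed with
  \<open>\<Phi>\<close>, would have Rayleigh quotients at most \<open>6 (1 + C \<eta>)\<close> for the perturbed measure, by conformal
  invariance of the energy. Some combination of them is orthogonal to eight of these harmonics, hence is
  a multiple of the ninth plus higher harmonics, and \<open>\<psi>\<close> is chosen such that this forces a quotient of
  at least \<open>6 (1 + \<beta> t)\<close>. So \<open>\<eta>\<close> is of order \<open>t\<close> whatever \<open>\<Phi>\<close> is.

  The spectral gaps and the compactness come from the averages against the kernels
  \<open>((1 + x \<bullet> y) / 2)\<^sup>n\<close>, which the Laplacian maps to combinations of two consecutive ones.
\<close>

section \<open>Derivatives along rotations\<close>

text \<open>The proof compares one number instead: the ninth min-max value, the top of the cluster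
  into which the round eigenvalue 6 splits. Test functions of degrees 0, 1 and 2 number 1 + 3 + 5 =
  9 and bound it from above, eight orthogonality conditions bound it from below. Degree four is the
  lowest that is orthogonal to products of two linear functions and still correlates with squares of
  harmonics of degree two, because odd degrees do not see even functions. The condition
  \<open>lambda1 = 2\<close> fixes a scale and is met by rescaling the perturbed measure.

  Real-valued \<open>Sup\<close>, \<open>SUP\<close> and \<open>INF\<close> mean nothing on
  unbounded or empty sets. Hence the dual norm is used only after some bound of the measure by the
  Sobolev norm, and \<open>lambda1\<close> only once a two-dimensional space is at hand. The
  Laplacian is handled without charts, as a sum of squares of derivatives along rotations;
  coordinates show that such derivatives have integral zero and give the total area.\<close>

lemma Ck_on_Suc_imp: "Ck_on (Suc k) U f \<Longrightarrow> Ck_on k U f"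
proof (induction k arbitrary: f)
  case 0
  then show ?case
    by (fastforce intro!: continuous_at_imp_continuous_on dest: has_derivative_continuous)
next
  case (Suc k)
  then show ?case by (metis Ck_on.simps(2))
qed

lemma Ck_on_subset: "Ck_on k U f \<Longrightarrow> V \<subseteq> U \<Longrightarrow> Ck_on k V f"
  by (induction k arbitrary: f) (auto intro: continuous_on_subset, blast)

lemma Ck_on_cong:
  assumes "open U" "\<And>x. x \<in> U \<Longrightarrow> f x = g x" "Ck_on k U f"
  shows "Ck_on k U g"
  using assms
proof (cases k)
  case 0
  then show ?thesis using assms by (auto cong: continuous_on_cong)
next
  case (Suc k')
  then obtain D where D: "\<forall>x\<in>U. (f has_derivative D x) (at x)" "\<forall>v. Ck_on k' U (\<lambda>x. D x v)"
    using assms by auto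
  have "\<forall>x\<in>U. (g has_derivative D x) (at x)"
    using D assms has_derivative_transform_within_open by blast
  then show ?thesis using D Suc by auto
qed

lemma Ck_on_const: "Ck_on k U (\<lambda>x. c)"
proof (induction k arbitrary: c)
  case (Suc k)
  then show ?case by (auto intro!: exI[of _ "\<lambda>_ _. 0"])
qed simp

lemma Ck_on_add: "Ck_on k U f \<Longrightarrow> Ck_on k U g \<Longrightarrow> Ck_on k U (\<lambda>x. f x + g x)"
proof (induction k arbitrary: f g)
  case 0 then show ?case by (auto intro: continuous_on_add)
next
  case (Suc k)
  obtain D E where "\<forall>x\<in>U. (f has_derivative D x) (at x)" "\<forall>v. Ck_on k U (\<lambda>x. D x v)"
    "\<forall>x\<in>U. (g has_derivative E x) (at x)" "\<forall>v. Ck_on k U (\<lambda>x. E x v)"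
    using Suc.prems by auto
  then show ?case
    using Suc.IH by (auto intro!: exI[of _ "\<lambda>x v. D x v + E x v"] has_derivative_add)
qed

lemma Ck_on_mult: "Ck_on k U f \<Longrightarrow> Ck_on k U g \<Longrightarrow> Ck_on k U (\<lambda>x. f x * g x)"
proof (induction k arbitrary: f g)
  case 0 then show ?case by (auto intro: continuous_on_mult)
next
  case (Suc k)
  obtain D E where DE: "\<forall>x\<in>U. (f has_derivative D x) (at x)" "\<forall>v. Ck_on k U (\<lambda>x. D x v)"
    "\<forall>x\<in>U. (g has_derivative E x) (at x)" "\<forall>v. Ck_on k U (\<lambda>x. E x v)"
    using Suc.prems by auto
  have "Ck_on k U f" "Ck_on k U g"
    using Suc.prems Ck_on_Suc_imp by blast+
  then show ?case
    using Suc.IH DE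
    by (auto intro!: exI[of _ "\<lambda>x v. f x * E x v + D x v * g x"] has_derivative_mult Ck_on_add)
qed

lemma Ck_on_component: "Ck_on k U (\<lambda>x. x $ i)"
proof (cases k)
  case 0
  then show ?thesis by (auto intro: continuous_intros)
next
  case (Suc k')
  then show ?thesis
    by (auto intro!: exI[of _ "\<lambda>x v. v $ i"] Ck_on_const bounded_linear_imp_has_derivative
        bounded_linear_vec_nth)
qed

section \<open>Smooth functions on the sphere\<close>

lemma smooth_S2_cong: "(\<And>x. x \<in> S2 \<Longrightarrow> f x = g x) \<Longrightarrow> smooth_S2 f = smooth_S2 g"
  unfolding smooth_S2_def by (metis IntD2)

lemma smooth_S2_const [simp, intro]: "smooth_S2 (\<lambda>x. c)"
  unfolding smooth_S2_def
  by (auto intro!: exI[of _ UNIV] exI[of _ "\<lambda>_. c"] Ck_on_const)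

lemma smooth_S2_component [simp, intro]: "smooth_S2 (\<lambda>x. x $ i)"
  unfolding smooth_S2_def
  by (auto intro!: exI[of _ UNIV] exI[of _ "\<lambda>x. x $ i"] Ck_on_component)

text \<open>Two local extensions live on different neighbourhoods; restricting both to the
  intersection treats sums and products at once.\<close>

lemma smooth_S2_binop:
  assumes "\<And>k U (f :: real^3 \<Rightarrow> real) g. Ck_on k U f \<Longrightarrow> Ck_on k U g \<Longrightarrow> Ck_on k U (\<lambda>x. p (f x) (g x))"
    and "smooth_S2 f" "smooth_S2 g"
  shows "smooth_S2 (\<lambda>x. p (f x) (g x))"
  unfolding smooth_S2_def
proof
  fix x :: "real^3" assume "x \<in> S2"
  then obtain U h V j where "open U" "x \<in> U" "\<forall>k. Ck_on k U h" "\<forall>x\<in>U \<inter> S2. f x = h x"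
     "open V" "x \<in> V" "\<forall>k. Ck_on k V j" "\<forall>x\<in>V \<inter> S2. g x = j x"
    using assms(2,3) unfolding smooth_S2_def by meson
  then show "\<exists>U h. open U \<and> x \<in> U \<and> (\<forall>k. Ck_on k U h) \<and> (\<forall>x\<in>U \<inter> S2. p (f x) (g x) = h x)"
    by (intro exI[of _ "U \<inter> V"] exI[of _ "\<lambda>x. p (h x) (j x)"])
      (auto intro!: assms(1) intro: Ck_on_subset)
qed

lemma smooth_S2_add [intro]: "smooth_S2 f \<Longrightarrow> smooth_S2 g \<Longrightarrow> smooth_S2 (\<lambda>x. f x + g x)"
  by (rule smooth_S2_binop[of "(+)"]) (auto intro: Ck_on_add)

lemma smooth_S2_mult [intro]: "smooth_S2 f \<Longrightarrow> smooth_S2 g \<Longrightarrow> smooth_S2 (\<lambda>x. f x * g x)"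
  by (rule smooth_S2_binop[of "(*)"]) (auto intro: Ck_on_mult)

lemma smooth_S2_cmult [intro]: "smooth_S2 f \<Longrightarrow> smooth_S2 (\<lambda>x. c * f x)"
  by (intro smooth_S2_mult smooth_S2_const)

lemma smooth_S2_divide [intro]: "smooth_S2 f \<Longrightarrow> smooth_S2 (\<lambda>x. f x / c)"
  using smooth_S2_cmult[of f "inverse c"] by (simp add: field_simps)

lemma smooth_S2_uminus [intro]: "smooth_S2 f \<Longrightarrow> smooth_S2 (\<lambda>x. - f x)"
  using smooth_S2_cmult[of f "-1"] by simp

lemma smooth_S2_diff [intro]: "smooth_S2 f \<Longrightarrow> smooth_S2 g \<Longrightarrow> smooth_S2 (\<lambda>x. f x - g x)"
  using smooth_S2_add[of f "\<lambda>x. - g x"] by auto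

lemma smooth_S2_power [intro]: "smooth_S2 f \<Longrightarrow> smooth_S2 (\<lambda>x. f x ^ n)"
  by (induction n) auto

lemma smooth_S2_sum [intro]: "(\<And>i. i \<in> I \<Longrightarrow> smooth_S2 (f i)) \<Longrightarrow> smooth_S2 (\<lambda>x. \<Sum>i\<in>I. f i x)"
  by (induction I rule: infinite_finite_induct) auto

lemma smooth_S2_inner [simp, intro]: "smooth_S2 (\<lambda>x. a \<bullet> x)"
  unfolding inner_vec_def inner_real_def
  by (intro smooth_S2_sum smooth_S2_mult smooth_S2_const smooth_S2_component)

text \<open>On the sphere \<open>y \<bullet> y\<close> is constant, so adding a multiple of its derivative changes nothing.\<close>
lemma has_derivative_within_S2_proj:
  fixes f :: "real^3 \<Rightarrow> real"
  assumes "(f has_derivative (\<lambda>v. d \<bullet> v)) (at x within S2)" "x \<in> S2"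
  shows "(f has_derivative (\<lambda>v. (d - c *\<^sub>R x) \<bullet> v)) (at x within S2)"
proof -
  have "((\<lambda>y. f y - c / 2 * (y \<bullet> y) + c / 2) has_derivative (\<lambda>v. (d - c *\<^sub>R x) \<bullet> v)) (at x within S2)"
    by (rule derivative_eq_intros assms(1) refl)+
      (auto simp: algebra_simps inner_commute)
  then show ?thesis
    by (rule has_derivative_transform[rotated 2]) (use assms in \<open>auto simp: dot_square_norm\<close>)
qed

text \<open>The great circle through \<open>x\<close> in the direction of \<open>w - w'\<close>
  reduces the question to one real variable. This is what gives the \<open>THE\<close> in
  \<open>grad_S2\<close> a meaning.\<close>

lemma has_derivative_within_S2_unique:
  fixes f :: "real^3 \<Rightarrow> real"
  assumes w: "(f has_derivative (\<lambda>v. w \<bullet> v)) (at x within S2)" "w \<bullet> x = 0"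
    and w': "(f has_derivative (\<lambda>v. w' \<bullet> v)) (at x within S2)" "w' \<bullet> x = 0" and x: "x \<in> S2"
  shows "w = w'"
proof (rule ccontr)
  assume "w \<noteq> w'"
  define u where "u = w - w'"
  define e where "e = u /\<^sub>R norm u"
  have u: "u \<noteq> 0" "u \<bullet> x = 0" and e: "norm e = 1" "x \<bullet> e = 0"
    using \<open>w \<noteq> w'\<close> w(2) w'(2) by (auto simp: u_def e_def inner_diff_left inner_diff_right inner_commute)
  define c where "c s = cos s *\<^sub>R x + sin s *\<^sub>R e" for s :: real
  have "norm (c s) ^ 2 = 1" for s
  proof -
    have "x \<bullet> x = 1" "e \<bullet> e = 1" using x e by (simp_all add: dot_square_norm)
    then have "norm (c s) ^ 2 = cos s * cos s + sin s * sin s"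
      using e by (simp add: c_def power2_norm_eq_inner inner_add inner_commute)
    then show ?thesis by (simp flip: power2_eq_square)
  qed
  then have c: "c s \<in> S2" for s
    by (simp add: power2_eq_1_iff) (smt (verit) norm_ge_zero)
  have c0: "c 0 = x" by (simp add: c_def)
  have d: "(c has_derivative (\<lambda>s. s *\<^sub>R e)) (at 0)"
    unfolding c_def by (auto intro!: derivative_eq_intros)
  \<comment> \<open>The zero function, with its derivative written through both candidates.\<close>
  have "((\<lambda>y. f y - f y) has_derivative (\<lambda>v. w \<bullet> v - w' \<bullet> v)) (at (c 0) within S2)"
    using has_derivative_diff[OF w(1) w'(1)] c0 by simp
  then have "((\<lambda>s. f (c s) - f (c s)) has_derivative (\<lambda>s. w \<bullet> (s *\<^sub>R e) - w' \<bullet> (s *\<^sub>R e))) (at 0)"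
    using c by (intro has_derivative_in_compose[OF d, of "\<lambda>y. f y - f y"]) (auto intro: has_derivative_subset)
  then have "((\<lambda>s::real. 0::real) has_derivative (\<lambda>s. s * (u \<bullet> e))) (at 0)"
    by (simp add: u_def inner_diff_left algebra_simps)
  then have "(\<lambda>s. s * (u \<bullet> e)) = (\<lambda>_. 0)"
    by (rule has_derivative_unique) simp
  then have "u \<bullet> e = 0" by (metis mult_1)
  then show False using u by (simp add: e_def)
qed

section \<open>The gradient of a smooth function\<close>

lemma grad_S2_eqI:
  assumes "(f has_derivative (\<lambda>v. w \<bullet> v)) (at x within S2)" "w \<bullet> x = 0" "x \<in> S2"
  shows "grad_S2 f x = w"
  unfolding grad_S2_def using assms has_derivative_within_S2_unique by blast

lemma has_derivative_within_S2_local: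
  assumes "(h has_derivative D) (at x within S2)" "x \<in> S2" "open U" "x \<in> U"
    and "\<forall>x\<in>U \<inter> S2. f x = h x"
  shows "(f has_derivative D) (at x within S2)"
proof (rule has_derivative_transform_eventually[OF assms(1)])
  show "\<forall>\<^sub>F y in at x within S2. h y = f y"
    using assms by (auto simp: eventually_at_topological)
qed (use assms in auto)

lemma smooth_S2_has_derivative:
  assumes "smooth_S2 f" "x \<in> S2"
  obtains d where "(f has_derivative (\<lambda>v. d \<bullet> v)) (at x within S2)"
proof -
  obtain U h where U: "open U" "x \<in> U" "\<forall>k. Ck_on k U h" "\<forall>x\<in>U \<inter> S2. f x = h x"
    using assms unfolding smooth_S2_def by meson
  then have "Ck_on (Suc 0) U h" by blast
  then obtain D where D: "(h has_derivative D) (at x)" using U by (meson Ck_on.simps(2))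
  have "(h has_derivative D) (at x within S2)" using D has_derivative_at_withinI by blast
  then have "(f has_derivative D) (at x within S2)"
    using has_derivative_within_S2_local U assms(2) by metis
  \<comment> \<open>\<open>adjoint D 1\<close> is the vector that represents the functional
    \<open>D\<close>.\<close>
  moreover have "D = (\<lambda>v. adjoint D 1 \<bullet> v)"
    using adjoint_works[OF has_derivative_linear[OF D], of _ 1] by (auto simp: inner_commute)
  ultimately show ?thesis using that[of "adjoint D 1"] by simp
qed

lemma smooth_S2_grad:
  assumes "smooth_S2 f" "x \<in> S2"
  shows "(f has_derivative (\<lambda>v. grad_S2 f x \<bullet> v)) (at x within S2)" "grad_S2 f x \<bullet> x = 0"
proof -
  obtain d where d: "(f has_derivative (\<lambda>v. d \<bullet> v)) (at x within S2)"
    using smooth_S2_has_derivative assms by blast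
  define w where "w = d - (d \<bullet> x) *\<^sub>R x"
  have *: "w \<bullet> x = 0" using assms by (simp add: w_def inner_diff_left dot_square_norm)
  have "(f has_derivative (\<lambda>v. w \<bullet> v)) (at x within S2)"
    unfolding w_def by (rule has_derivative_within_S2_proj[OF d assms(2)])
  moreover have "grad_S2 f x = w" by (rule grad_S2_eqI) fact+
  ultimately show "(f has_derivative (\<lambda>v. grad_S2 f x \<bullet> v)) (at x within S2)" "grad_S2 f x \<bullet> x = 0"
    using * by auto
qed

lemma smooth_S2_continuous: "smooth_S2 f \<Longrightarrow> continuous_on S2 f"
  unfolding continuous_on_eq_continuous_within
  by (rule ballI, rule has_derivative_continuous[OF smooth_S2_grad(1)])

lemma grad_S2_cong:
  assumes "\<And>x. x \<in> S2 \<Longrightarrow> f x = g x" "x \<in> S2"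
  shows "grad_S2 f x = grad_S2 g x"
proof -
  have "(f has_derivative D) (at x within S2) \<longleftrightarrow> (g has_derivative D) (at x within S2)" for D
    using has_derivative_transform[of x S2 f g D] has_derivative_transform[of x S2 g f D] assms by auto
  then show ?thesis unfolding grad_S2_def by simp
qed

lemma grad_S2_const: "x \<in> S2 \<Longrightarrow> grad_S2 (\<lambda>x. c) x = 0"
  by (rule grad_S2_eqI) (auto intro!: derivative_eq_intros)

lemma grad_S2_inner: "x \<in> S2 \<Longrightarrow> grad_S2 (\<lambda>x. a \<bullet> x) x = a - (a \<bullet> x) *\<^sub>R x"
  by (rule grad_S2_eqI[OF has_derivative_within_S2_proj])
     (auto intro!: derivative_eq_intros simp: algebra_simps dot_square_norm)

lemma grad_S2_add:
  assumes "smooth_S2 f" "smooth_S2 g" "x \<in> S2"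
  shows "grad_S2 (\<lambda>x. f x + g x) x = grad_S2 f x + grad_S2 g x"
  by (rule grad_S2_eqI)
     (use assms in \<open>auto intro!: derivative_eq_intros smooth_S2_grad simp: algebra_simps smooth_S2_grad(2)\<close>)

lemma grad_S2_mult:
  assumes "smooth_S2 f" "smooth_S2 g" "x \<in> S2"
  shows "grad_S2 (\<lambda>x. f x * g x) x = f x *\<^sub>R grad_S2 g x + g x *\<^sub>R grad_S2 f x"
  by (rule grad_S2_eqI)
     (use assms in \<open>auto intro!: derivative_eq_intros smooth_S2_grad simp: algebra_simps smooth_S2_grad(2)\<close>)

text \<open>The field \<open>cross3 v x\<close> generates the rotations about \<open>v\<close>.
  Unlike a tangent frame, these fields exist globally, and they preserve area, so that derivatives
  along them integrate to zero.\<close>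

definition rot_deriv :: "real^3 \<Rightarrow> (real^3 \<Rightarrow> real) \<Rightarrow> real^3 \<Rightarrow> real"
  where "rot_deriv v f x = grad_S2 f x \<bullet> cross3 v x"

lemma rot_deriv_cong:
  "(\<And>x. x \<in> S2 \<Longrightarrow> f x = g x) \<Longrightarrow> x \<in> S2 \<Longrightarrow> rot_deriv v f x = rot_deriv v g x"
  unfolding rot_deriv_def using grad_S2_cong by metis

lemma rot_deriv_const: "x \<in> S2 \<Longrightarrow> rot_deriv v (\<lambda>x. c) x = 0"
  by (simp add: rot_deriv_def grad_S2_const)

lemma rot_deriv_inner: "x \<in> S2 \<Longrightarrow> rot_deriv v (\<lambda>x. a \<bullet> x) x = a \<bullet> cross3 v x"
  by (simp add: rot_deriv_def grad_S2_inner inner_diff_left dot_cross_self)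

lemma rot_deriv_add:
  "smooth_S2 f \<Longrightarrow> smooth_S2 g \<Longrightarrow> x \<in> S2 \<Longrightarrow>
     rot_deriv v (\<lambda>x. f x + g x) x = rot_deriv v f x + rot_deriv v g x"
  by (simp add: rot_deriv_def grad_S2_add inner_add_left)

lemma rot_deriv_mult:
  "smooth_S2 f \<Longrightarrow> smooth_S2 g \<Longrightarrow> x \<in> S2 \<Longrightarrow>
     rot_deriv v (\<lambda>x. f x * g x) x = f x * rot_deriv v g x + g x * rot_deriv v f x"
  by (simp add: rot_deriv_def grad_S2_mult inner_add_left)

text \<open>The rotation field is tangent, so the ambient derivative of a local extension can be
  used without projecting it; \<open>H\<close> is that derivative in coordinates.\<close>

lemma smooth_S2_rot_deriv [intro]:
  assumes f: "smooth_S2 f"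
  shows "smooth_S2 (rot_deriv v f)"
  unfolding smooth_S2_def
proof
  fix p :: "real^3" assume "p \<in> S2"
  then obtain U h where U: "open U" "p \<in> U" "\<forall>k. Ck_on k U h" "\<forall>x\<in>U \<inter> S2. f x = h x"
    using f unfolding smooth_S2_def by meson
  then have "Ck_on (Suc 0) U h" by blast
  then obtain D where D: "\<forall>x\<in>U. (h has_derivative D x) (at x)" by auto
  \<comment> \<open>\<open>Ck_on\<close> chooses a derivative anew for each \<open>k\<close>;
    uniqueness of derivatives on an open set identifies all these choices with
    \<open>D\<close>.\<close>
  have Ck: "Ck_on k U (\<lambda>x. D x v)" for k v
  proof -
    obtain D' where D': "\<forall>x\<in>U. (h has_derivative D' x) (at x)" "Ck_on k U (\<lambda>x. D' x v)"
      using U(3) by (metis Ck_on.simps(2))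
    have "D' x = D x" if "x \<in> U" for x
      using D D' that has_derivative_unique by blast
    then show ?thesis using Ck_on_cong[OF U(1) _ D'(2)] by simp
  qed
  define H where "H x = (v$2 * x$3 + - (v$3 * x$2)) * D x (axis 1 1)
    + ((v$3 * x$1 + - (v$1 * x$3)) * D x (axis 2 1) + (v$1 * x$2 + - (v$2 * x$1)) * D x (axis 3 1))" for x
  have neg: "Ck_on k U (\<lambda>x. - g x)" if "Ck_on k U g" for k g
    using Ck_on_mult[OF Ck_on_const[of k U "-1"] that] by simp
  have "Ck_on k U H" for k
    unfolding H_def by (intro Ck_on_add Ck_on_mult neg Ck_on_const Ck_on_component Ck)
  moreover have "rot_deriv v f x = H x" if "x \<in> U \<inter> S2" for x
  proof -
    have lin: "linear (D x)" using D that has_derivative_linear by blast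
    define d where "d = adjoint (D x) 1"
    have d: "D x u = d \<bullet> u" for u
      using adjoint_works[OF lin, of u 1] by (simp add: d_def inner_commute)
    have "(h has_derivative (\<lambda>u. d \<bullet> u)) (at x within S2)"
      using D that d has_derivative_at_withinI by (metis (no_types, lifting) IntD1 ext)
    then have "(f has_derivative (\<lambda>u. d \<bullet> u)) (at x within S2)"
      by (rule has_derivative_within_S2_local) (use U that in auto)
    then have "(f has_derivative (\<lambda>u. (d - (d \<bullet> x) *\<^sub>R x) \<bullet> u)) (at x within S2)"
      using that by (intro has_derivative_within_S2_proj) auto
    then have "grad_S2 f x = d - (d \<bullet> x) *\<^sub>R x"
      by (rule grad_S2_eqI) (use that in \<open>auto simp: inner_diff_left dot_square_norm\<close>)
    then have "rot_deriv v f x = d \<bullet> cross3 v x"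
      by (simp add: rot_deriv_def inner_diff_left dot_cross_self)
    also have "\<dots> = H x"
    proof -
      have "D x (axis i 1) = d $ i" for i by (simp add: d inner_axis)
      then show ?thesis
        by (simp add: H_def inner_vec_def sum_3 cross_components algebra_simps)
    qed
    finally show ?thesis .
  qed
  ultimately show "\<exists>U h. open U \<and> p \<in> U \<and> (\<forall>k. Ck_on k U h) \<and> (\<forall>x\<in>U \<inter> S2. rot_deriv v f x = h x)"
    using U by blast
qed

text \<open>The cross product with \<open>x\<close> is a quarter turn of the tangent plane. Undoing
  it recovers a gradient from its three rotation derivatives, which are already known to be
  smooth.\<close>

lemma cross3_tangent: "x \<in> S2 \<Longrightarrow> w \<bullet> x = 0 \<Longrightarrow> cross3 (cross3 x w) x = w"
  by (subst cross_skew) (simp add: Lagrange dot_square_norm inner_commute)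

lemma rot_deriv_axis: "rot_deriv (axis i 1) f x = cross3 x (grad_S2 f x) $ i"
  unfolding rot_deriv_def
  by (metis cart_eq_inner_axis cross_triple inner_commute)

lemma grad_S2_eq_cross:
  "smooth_S2 f \<Longrightarrow> x \<in> S2 \<Longrightarrow> grad_S2 f x = cross3 (\<chi> i. rot_deriv (axis i 1) f x) x"
  by (simp add: rot_deriv_axis cross3_tangent smooth_S2_grad)

lemma grad_S2_inner_grad_S2:
  assumes "smooth_S2 f" "smooth_S2 g" "x \<in> S2"
  shows "grad_S2 f x \<bullet> grad_S2 g x = (\<Sum>i\<in>UNIV. rot_deriv (axis i 1) f x * rot_deriv (axis i 1) g x)"
proof -
  have "grad_S2 f x \<bullet> grad_S2 g x = cross3 x (grad_S2 f x) \<bullet> cross3 x (grad_S2 g x)"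
    using assms smooth_S2_grad(2) by (simp add: dot_cross dot_square_norm inner_commute)
  then show ?thesis by (simp add: rot_deriv_axis inner_vec_def)
qed

lemma smooth_S2_grad_component [intro]:
  assumes "smooth_S2 f" shows "smooth_S2 (\<lambda>x. grad_S2 f x $ i)"
proof -
  have "smooth_S2 (\<lambda>x. cross3 (\<chi> i. rot_deriv (axis i 1) f x) x $ i)"
    using exhaust_3[of i] assms
    by (auto simp: cross_components intro!: smooth_S2_diff smooth_S2_mult smooth_S2_rot_deriv)
  then show ?thesis
    by (subst smooth_S2_cong) (use assms grad_S2_eq_cross in auto)
qed

lemma smooth_S2_grad_inner [intro]:
  "smooth_S2 f \<Longrightarrow> smooth_S2 g \<Longrightarrow> smooth_S2 (\<lambda>x. grad_S2 f x \<bullet> grad_S2 g x)"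
  unfolding inner_vec_def inner_real_def
  by (intro smooth_S2_sum smooth_S2_mult smooth_S2_grad_component)

lemma continuous_on_grad_S2: "smooth_S2 f \<Longrightarrow> continuous_on S2 (grad_S2 f)"
  by (rule continuous_on_vec_lambda[where f="\<lambda>i x. grad_S2 f x $ i", simplified vec_nth_inverse vec_lambda_eta])
     (auto intro: smooth_S2_continuous)

text \<open>The Casimir operator of the rotation group, which on the sphere is the Laplacian. In
  this form smoothness, product rule and symmetry follow from those of \<open>rot_deriv\<close>. The
  operator \<open>laplacian_S2\<close> itself is evaluated on linear functions in
  \<open>laplacian_S2_inner\<close>.\<close>

definition Lap :: "(real^3 \<Rightarrow> real) \<Rightarrow> real^3 \<Rightarrow> real"
  where "Lap f x = (\<Sum>i\<in>UNIV. rot_deriv (axis i 1) (rot_deriv (axis i 1) f) x)"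

lemma smooth_S2_Lap [intro]: "smooth_S2 f \<Longrightarrow> smooth_S2 (Lap f)"
  unfolding Lap_def by (intro smooth_S2_sum smooth_S2_rot_deriv)

lemma Lap_const: "x \<in> S2 \<Longrightarrow> Lap (\<lambda>x. c) x = 0"
proof -
  assume x: "x \<in> S2"
  have "rot_deriv v (rot_deriv v (\<lambda>x. c)) x = rot_deriv v (\<lambda>x. 0) x" for v
    by (rule rot_deriv_cong) (use x rot_deriv_const in auto)
  then show ?thesis using x by (simp add: Lap_def rot_deriv_const)
qed

lemma Lap_add:
  assumes "smooth_S2 f" "smooth_S2 g" "x \<in> S2"
  shows "Lap (\<lambda>x. f x + g x) x = Lap f x + Lap g x"
proof -
  have "rot_deriv v (rot_deriv v (\<lambda>x. f x + g x)) x = rot_deriv v (\<lambda>x. rot_deriv v f x + rot_deriv v g x) x" for v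
    by (rule rot_deriv_cong) (use assms rot_deriv_add in auto)
  then show ?thesis using assms by (simp add: Lap_def rot_deriv_add smooth_S2_rot_deriv sum.distrib)
qed

lemma Lap_mult:
  assumes "smooth_S2 f" "smooth_S2 g" "x \<in> S2"
  shows "Lap (\<lambda>x. f x * g x) x = f x * Lap g x + g x * Lap f x + 2 * (grad_S2 f x \<bullet> grad_S2 g x)"
proof -
  have "rot_deriv v (rot_deriv v (\<lambda>x. f x * g x)) x
      = rot_deriv v (\<lambda>x. f x * rot_deriv v g x + g x * rot_deriv v f x) x" for v
    by (rule rot_deriv_cong) (use assms rot_deriv_mult in auto)
  then show ?thesis using assms
    by (simp add: Lap_def rot_deriv_add rot_deriv_mult smooth_S2_rot_deriv smooth_S2_mult sum.distrib
        grad_S2_inner_grad_S2 sum_distrib_left algebra_simps)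
qed

lemma Lap_cmult: "smooth_S2 f \<Longrightarrow> x \<in> S2 \<Longrightarrow> Lap (\<lambda>x. c * f x) x = c * Lap f x"
  by (simp add: Lap_mult Lap_const grad_S2_const)

lemma Lap_inner:
  assumes "x \<in> S2" shows "Lap (\<lambda>x. a \<bullet> x) x = - 2 * (a \<bullet> x)"
proof -
  have *: "a \<bullet> cross3 v y = cross3 a v \<bullet> y" for v y
    by (simp add: cross3_simps)
  have "rot_deriv v (rot_deriv v (\<lambda>x. a \<bullet> x)) x = rot_deriv v (\<lambda>x. cross3 a v \<bullet> x) x" for v
    by (rule rot_deriv_cong) (use assms in \<open>simp_all only: rot_deriv_inner *\<close>)
  then have "Lap (\<lambda>x. a \<bullet> x) x = (\<Sum>i\<in>UNIV. cross3 a (axis i 1) \<bullet> cross3 (axis i 1) x)"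
    using assms by (simp add: Lap_def rot_deriv_inner)
  also have "\<dots> = - 2 * (a \<bullet> x)"
    by (simp add: sum_3 inner_vec_def cross_components axis_def algebra_simps)
  finally show ?thesis .
qed

section \<open>The area measure in spherical coordinates\<close>

definition sph :: "real \<Rightarrow> real \<Rightarrow> real^3"
  where "sph \<theta> \<phi> = vector [sin \<theta> * cos \<phi>, sin \<theta> * sin \<phi>, cos \<theta>]"

lemma sph_component: "sph \<theta> \<phi> $ 1 = sin \<theta> * cos \<phi>" "sph \<theta> \<phi> $ 2 = sin \<theta> * sin \<phi>" "sph \<theta> \<phi> $ 3 = cos \<theta>"
  by (simp_all add: sph_def)

lemma sph_in_S2: "sph \<theta> \<phi> \<in> S2"
proof -
  have "sph \<theta> \<phi> \<bullet> sph \<theta> \<phi> = sin \<theta> * sin \<theta> * (cos \<phi> * cos \<phi> + sin \<phi> * sin \<phi>) + cos \<theta> * cos \<theta>"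
    by (simp only: inner_vec_def inner_real_def sum_3 sph_component) algebra
  also have "\<dots> = (sin \<theta>)\<^sup>2 * ((cos \<phi>)\<^sup>2 + (sin \<phi>)\<^sup>2) + (cos \<theta>)\<^sup>2"
    by (simp only: power2_eq_square)
  also have "\<dots> = 1" by (simp only: sin_cos_squared_add sin_cos_squared_add2 mult_1_right)
  finally have "sph \<theta> \<phi> \<bullet> sph \<theta> \<phi> = 1" .
  then show ?thesis by (simp add: norm_eq_1)
qed

lemma vector_3_eq: "(vector [a, b, c] :: real^3) = a *\<^sub>R axis 1 1 + b *\<^sub>R axis 2 1 + c *\<^sub>R axis 3 1"
  by (simp add: vec_eq_iff forall_3 axis_def)

lemma continuous_on_sph: "continuous_on A (\<lambda>p. sph (fst p) (snd p))"
  unfolding sph_def vector_3_eq by (intro continuous_intros)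

lemma scale_measure_eq_density: "scale_measure (ennreal r) M = density M (\<lambda>_. ennreal r)"
  by (rule measure_eqI) (auto simp: emeasure_density_const)

lemma integral_scale_measure:
  fixes f :: "'a \<Rightarrow> 'b::{banach, second_countable_topology}"
  assumes "r \<ge> 0" "f \<in> borel_measurable M"
  shows "integral\<^sup>L (scale_measure (ennreal r) M) f = r *\<^sub>R integral\<^sup>L M f"
  using assms by (simp add: scale_measure_eq_density integral_density)

lemma sets_area_measure [simp, measurable_cong]: "sets (area_measure r) = sets borel_S2"
  by (simp add: area_measure_def)

lemma space_area_measure [simp]: "space (area_measure r) = S2"
  by (simp add: area_measure_def space_scale_measure space_restrict_space)

lemma area_measure_scale: "area_measure r = scale_measure (ennreal r) (area_measure 1)"
  by (simp add: area_measure_def)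

lemma integral_area_measure:
  assumes "r \<ge> 0" "f \<in> borel_measurable borel_S2"
  shows "(\<integral>x. f x \<partial>area_measure r) = r * (\<integral>x. (f x :: real) \<partial>area_measure 1)"
  using integral_scale_measure[of r f "area_measure 1"] assms
  by (simp flip: area_measure_scale cong: measurable_cong_sets)

definition sph_dens :: "real \<times> real \<Rightarrow> real"
  where "sph_dens p = indicator ({0<..<pi} \<times> {0<..<2 * pi}) p * sin (fst p)"

lemma sph_dens_nonneg: "sph_dens p \<ge> 0"
  by (auto simp: sph_dens_def indicator_def intro!: sin_ge_zero)

lemma sph_dens_measurable [measurable]: "sph_dens \<in> borel_measurable borel"
proof -
  have [measurable]: "{0<..<pi} \<times> {0<..<2 * pi} \<in> sets borel"
    by (intro borel_open open_Times) auto
  have [measurable]: "(\<lambda>p::real \<times> real. sin (fst p)) \<in> borel_measurable borel"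
    by (intro borel_measurable_continuous_onI continuous_intros)
  show ?thesis unfolding sph_dens_def by measurable
qed

lemma sph_measurable [measurable]: "(\<lambda>p. sph (fst p) (snd p)) \<in> borel \<rightarrow>\<^sub>M borel_S2"
  by (intro measurable_restrict_space2 borel_measurable_continuous_onI continuous_on_sph)
     (auto intro: sph_in_S2[simplified])

lemma area_measure_1:
  "area_measure 1 = distr (density lborel (\<lambda>p. ennreal (sph_dens p))) borel_S2 (\<lambda>p. sph (fst p) (snd p))"
  by (simp add: area_measure_def sph_dens_def sph_def case_prod_beta')

text \<open>The integral is moved to a closed rectangle, where Fubini for continuous functions and
  the fundamental theorem of calculus apply.\<close>

lemma integral_area_measure_1:
  assumes "continuous_on S2 f"
  shows "(\<integral>x. f x \<partial>area_measure 1)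
    = integral (cbox (0, 0) (pi, 2 * pi)) (\<lambda>p. sin (fst p) * (f (sph (fst p) (snd p)) :: real))"
    (is "_ = integral ?C ?g")
proof -
  have f: "f \<in> borel_measurable borel_S2"
    using assms by (rule borel_measurable_continuous_on_restrict)
  have cont: "continuous_on A ?g" for A
    by (intro continuous_intros continuous_on_compose2[OF assms] continuous_on_sph) (auto intro: sph_in_S2[simplified])
  have box: "{0<..<pi} \<times> {0<..<2 * pi} = box (0, 0) (pi, 2 * pi)"
    by (auto simp: box_def Basis_prod_def ball_Un)
  have "(\<integral>x. f x \<partial>area_measure 1) = (\<integral>p. sph_dens p * f (sph (fst p) (snd p)) \<partial>lborel)"
    unfolding area_measure_1
    using f sph_measurable by (subst integral_distr) (auto simp: integral_density sph_dens_nonneg)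
  also have "\<dots> = (LINT p:box (0, 0) (pi, 2 * pi)|lborel. ?g p)"
    by (simp add: set_lebesgue_integral_def sph_dens_def box mult.assoc)
  also have "\<dots> = integral (box (0, 0) (pi, 2 * pi)) ?g"
  proof (rule set_borel_integral_eq_integral)
    have "set_integrable lborel ?C ?g"
      unfolding set_integrable_def by (intro borel_integrable_compact cont compact_cbox)
    then show "set_integrable lborel (box (0, 0) (pi, 2 * pi)) ?g"
      by (rule set_integrable_subset) (use box_subset_cbox in auto)
  qed
  also have "\<dots> = integral ?C ?g"
    by (rule integral_open_interval)
  finally show ?thesis .
qed

lemma integral_area_measure_const: "(\<integral>x. c \<partial>area_measure 1) = 4 * pi * (c :: real)"
proof -
  have "(\<integral>x. c \<partial>area_measure 1) = integral (cbox (0, 0) (pi, 2 * pi)) (\<lambda>p. sin (fst p) * c)"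
    by (rule integral_area_measure_1) auto
  also have "\<dots> = integral (cbox 0 pi) (\<lambda>\<theta>. integral (cbox 0 (2 * pi)) (\<lambda>\<phi>. sin \<theta> * c))"
    by (subst integral_prod_continuous) (auto intro!: continuous_intros)
  also have "\<dots> = integral {0..pi} (\<lambda>\<theta>. 2 * pi * c * sin \<theta>)"
    by (simp add: mult_ac)
  also have "\<dots> = 2 * pi * c * 2"
  proof (rule integral_unique)
    have "((\<lambda>\<theta>. 2 * pi * c * sin \<theta>) has_integral (- 2 * pi * c * cos pi - (- 2 * pi * c * cos 0))) {0..pi}"
      by (rule fundamental_theorem_of_calculus)
         (auto intro!: derivative_eq_intros simp flip: has_real_derivative_iff_has_vector_derivative)
    then show "((\<lambda>\<theta>. 2 * pi * c * sin \<theta>) has_integral 2 * pi * c * 2) {0..pi}" by simp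
  qed
  finally show ?thesis by simp
qed

lemma sets_borel_S2: "S2 \<in> sets borel_S2"
  using sets.top[of borel_S2] by (simp add: space_restrict_space)

lemma finite_measure_area_measure: "finite_measure (area_measure r)"
proof (rule finite_measureI)
  have [simp]: "(\<lambda>p. sph (fst p) (snd p)) -` S2 = UNIV" using sph_in_S2 by auto
  have "emeasure (area_measure 1) S2 = (\<integral>\<^sup>+p. ennreal (sph_dens p) \<partial>lborel)"
    unfolding area_measure_1 using sets_borel_S2
    by (subst emeasure_distr) (auto simp: emeasure_density cong: measurable_cong_sets)
  also have "\<dots> \<le> (\<integral>\<^sup>+p. indicator (cbox (0, 0) (pi, 2 * pi)) p \<partial>(lborel :: (real \<times> real) measure))"
    by (intro nn_integral_mono) (auto simp: sph_dens_def indicator_def)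
  also have "\<dots> < \<infinity>" using emeasure_lborel_cbox_finite by simp
  finally show "emeasure (area_measure r) (space (area_measure r)) \<noteq> \<infinity>"
    by (subst area_measure_scale) (auto simp: ennreal_mult_eq_top_iff)
qed

definition sph_\<theta> :: "real \<Rightarrow> real \<Rightarrow> real^3"
  where "sph_\<theta> \<theta> \<phi> = vector [cos \<theta> * cos \<phi>, cos \<theta> * sin \<phi>, - sin \<theta>]"

definition sph_\<phi> :: "real \<Rightarrow> real \<Rightarrow> real^3"
  where "sph_\<phi> \<theta> \<phi> = vector [- sin \<theta> * sin \<phi>, sin \<theta> * cos \<phi>, 0]"

lemma sph_has_derivative:
  "((\<lambda>\<theta>. sph \<theta> \<phi>) has_derivative (\<lambda>s. s *\<^sub>R sph_\<theta> \<theta> \<phi>)) (at \<theta>)"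
  "((\<lambda>\<phi>. sph \<theta> \<phi>) has_derivative (\<lambda>s. s *\<^sub>R sph_\<phi> \<theta> \<phi>)) (at \<phi>)"
  unfolding sph_def vector_3_eq sph_\<theta>_def sph_\<phi>_def
  by (auto intro!: derivative_eq_intros simp: algebra_simps)

lemma smooth_S2_chain:
  assumes "smooth_S2 f" "(c has_derivative (\<lambda>s. s *\<^sub>R u)) (at t)" "\<And>s. c s \<in> S2"
  shows "((\<lambda>t. f (c t)) has_real_derivative grad_S2 f (c t) \<bullet> u) (at (t::real))"
proof -
  have "((\<lambda>t. f (c t)) has_derivative (\<lambda>s. grad_S2 f (c t) \<bullet> (s *\<^sub>R u))) (at t)"
    by (rule has_derivative_in_compose[OF assms(2)])
       (use assms smooth_S2_grad(1)[of f "c t"] in \<open>auto intro: has_derivative_subset\<close>)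
  then show ?thesis by (simp add: has_field_derivative_def mult_commute_abs)
qed

text \<open>The factor \<open>sin \<theta>\<close> of the area element removes the singularity that
  the coordinate expression of a rotation field has at the poles.\<close>

lemma cross3_sph:
  "sin \<theta> *\<^sub>R cross3 v (sph \<theta> \<phi>) = ((v$2 * cos \<phi> - v$1 * sin \<phi>) * sin \<theta>) *\<^sub>R sph_\<theta> \<theta> \<phi>
    + (v$3 * sin \<theta> - v$1 * cos \<theta> * cos \<phi> - v$2 * cos \<theta> * sin \<phi>) *\<^sub>R sph_\<phi> \<theta> \<phi>"
proof -
  have a: "sin \<phi> * sin \<phi> = 1 - cos \<phi> * cos \<phi>" "sin \<theta> * sin \<theta> = 1 - cos \<theta> * cos \<theta>"
    using sin_cos_squared_add[of \<phi>] sin_cos_squared_add[of \<theta>] by (simp_all add: power2_eq_square)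
  have "(sin \<theta> * (v$2 * cos \<theta> - sin \<theta> * sin \<phi> * v$3)) = ((v$2 * cos \<phi> - v$1 * sin \<phi>) * sin \<theta>) * (cos \<theta> * cos \<phi>)
    + (v$3 * sin \<theta> - v$1 * cos \<theta> * cos \<phi> - v$2 * cos \<theta> * sin \<phi>) * (- sin \<theta> * sin \<phi>)"
    using a by algebra
  moreover have "(sin \<theta> * (v$3 * (sin \<theta> * cos \<phi>) - cos \<theta> * v$1)) = ((v$2 * cos \<phi> - v$1 * sin \<phi>) * sin \<theta>) * (cos \<theta> * sin \<phi>)
    + (v$3 * sin \<theta> - v$1 * cos \<theta> * cos \<phi> - v$2 * cos \<theta> * sin \<phi>) * (sin \<theta> * cos \<phi>)"
    using a by algebra
  moreover have "sin \<theta> * (v$1 * (sin \<theta> * sin \<phi>) - sin \<theta> * cos \<phi> * v$2) = ((v$2 * cos \<phi> - v$1 * sin \<phi>) * sin \<theta>) * (- sin \<theta>)"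
    by algebra
  ultimately show ?thesis
    by (simp add: vec_eq_iff forall_3 cross_components sph_component sph_\<theta>_def sph_\<phi>_def)
qed

text \<open>In spherical coordinates \<open>sin \<theta>\<close> times the derivative along a rotation field is a divergence.\<close>
lemma integral_rot_deriv:
  assumes f: "smooth_S2 f"
  shows "(\<integral>x. rot_deriv v f x \<partial>area_measure 1) = 0"
proof -
  define \<alpha> where "\<alpha> \<phi> = v$2 * cos \<phi> - v$1 * sin \<phi>" for \<phi>
  define b where "b \<theta> \<phi> = v$3 * sin \<theta> - v$1 * cos \<theta> * cos \<phi> - v$2 * cos \<theta> * sin \<phi>" for \<theta> \<phi>
  define F where "F \<theta> \<phi> = f (sph \<theta> \<phi>)" for \<theta> \<phi>
  define F1 where "F1 \<theta> \<phi> = grad_S2 f (sph \<theta> \<phi>) \<bullet> sph_\<theta> \<theta> \<phi>" for \<theta> \<phi>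
  define F2 where "F2 \<theta> \<phi> = grad_S2 f (sph \<theta> \<phi>) \<bullet> sph_\<phi> \<theta> \<phi>" for \<theta> \<phi>
  \<comment> \<open>The term \<open>\<alpha> \<phi> * cos \<theta> * F \<theta> \<phi>\<close> is
    added here and subtracted in \<open>B\<close>, which makes \<open>A\<close> an exact derivative
    in \<open>\<theta>\<close> and \<open>B\<close> one in \<open>\<phi>\<close>.\<close>
  define A where "A \<theta> \<phi> = \<alpha> \<phi> * cos \<theta> * F \<theta> \<phi> + \<alpha> \<phi> * sin \<theta> * F1 \<theta> \<phi>" for \<theta> \<phi>
  define B where "B \<theta> \<phi> = - (\<alpha> \<phi> * cos \<theta>) * F \<theta> \<phi> + b \<theta> \<phi> * F2 \<theta> \<phi>" for \<theta> \<phi>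
  have dA: "((\<lambda>\<theta>. \<alpha> \<phi> * sin \<theta> * F \<theta> \<phi>) has_real_derivative A \<theta> \<phi>) (at \<theta>)" for \<theta> \<phi>
    unfolding A_def F_def F1_def
    by (auto intro!: derivative_eq_intros smooth_S2_chain[OF f] sph_has_derivative sph_in_S2[simplified])
  have dB: "((\<lambda>\<phi>. b \<theta> \<phi> * F \<theta> \<phi>) has_real_derivative B \<theta> \<phi>) (at \<phi>)" for \<theta> \<phi>
    unfolding B_def F_def F2_def b_def \<alpha>_def
    by (auto intro!: derivative_eq_intros smooth_S2_chain[OF f] sph_has_derivative sph_in_S2[simplified]
        simp: algebra_simps)
  have cF: "continuous_on S (\<lambda>p. F (fst p) (snd p))" for S
    unfolding F_def
    by (intro continuous_on_compose2[OF smooth_S2_continuous[OF f]] continuous_on_sph) (auto intro: sph_in_S2[simplified])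
  have cG: "continuous_on S (\<lambda>p. grad_S2 f (sph (fst p) (snd p)))" for S
    by (intro continuous_on_compose2[OF continuous_on_grad_S2[OF f]] continuous_on_sph) (auto intro: sph_in_S2[simplified])
  have c12: "continuous_on S (\<lambda>p. F1 (fst p) (snd p))" "continuous_on S (\<lambda>p. F2 (fst p) (snd p))" for S
    unfolding F1_def F2_def sph_\<theta>_def sph_\<phi>_def vector_3_eq
    by (intro continuous_intros cG)+
  have cA: "continuous_on S (\<lambda>p. A (fst p) (snd p))" and cB: "continuous_on S (\<lambda>p. B (fst p) (snd p))" for S
    unfolding A_def B_def \<alpha>_def b_def by (intro continuous_intros cF c12)+
  have AB: "sin \<theta> * rot_deriv v f (sph \<theta> \<phi>) = A \<theta> \<phi> + B \<theta> \<phi>" for \<theta> \<phi>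
  proof -
    have "sin \<theta> * rot_deriv v f (sph \<theta> \<phi>) = grad_S2 f (sph \<theta> \<phi>) \<bullet> (sin \<theta> *\<^sub>R cross3 v (sph \<theta> \<phi>))"
      by (simp add: rot_deriv_def)
    also have "\<dots> = \<alpha> \<phi> * sin \<theta> * F1 \<theta> \<phi> + b \<theta> \<phi> * F2 \<theta> \<phi>"
      by (simp add: cross3_sph inner_add_right F1_def F2_def \<alpha>_def b_def)
    finally show ?thesis by (simp add: A_def B_def)
  qed
  let ?C = "cbox (0, 0) (pi, 2 * pi) :: (real \<times> real) set"
  have "(\<integral>x. rot_deriv v f x \<partial>area_measure 1) = integral ?C (\<lambda>p. sin (fst p) * rot_deriv v f (sph (fst p) (snd p)))"
    by (intro integral_area_measure_1 smooth_S2_continuous smooth_S2_rot_deriv f)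
  also have "\<dots> = integral ?C (\<lambda>p. A (fst p) (snd p)) + integral ?C (\<lambda>p. B (fst p) (snd p))"
    unfolding AB by (intro integral_add integrable_continuous cA cB)
  \<comment> \<open>\<open>B\<close> is integrated first in \<open>\<phi>\<close>, where periodicity
    cancels the boundary terms; \<open>A\<close> first in \<open>\<theta>\<close>, where
    \<open>sin\<close> vanishes at both ends.\<close>
  also have "integral ?C (\<lambda>p. B (fst p) (snd p)) = integral (cbox 0 pi) (\<lambda>\<theta>. integral (cbox 0 (2 * pi)) (\<lambda>\<phi>. B \<theta> \<phi>))"
    by (subst integral_prod_continuous[OF cB]) auto
  also have "\<dots> = integral (cbox 0 pi) (\<lambda>\<theta>. 0)"
  proof (intro integral_cong integral_unique)
    fix \<theta>
    have "(B \<theta> has_integral (b \<theta> (2 * pi) * F \<theta> (2 * pi) - b \<theta> 0 * F \<theta> 0)) {0..2 * pi}"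
      by (rule fundamental_theorem_of_calculus)
         (auto intro: dB has_field_derivative_at_within simp flip: has_real_derivative_iff_has_vector_derivative)
    then show "(B \<theta> has_integral 0) (cbox 0 (2 * pi))"
      by (simp add: F_def sph_def b_def)
  qed
  also have "integral ?C (\<lambda>p. A (fst p) (snd p)) = integral (cbox 0 pi) (\<lambda>\<theta>. integral (cbox 0 (2 * pi)) (\<lambda>\<phi>. A \<theta> \<phi>))"
    by (subst integral_prod_continuous[OF cA]) auto
  also have "\<dots> = integral (cbox 0 (2 * pi)) (\<lambda>\<phi>. integral (cbox 0 pi) (\<lambda>\<theta>. A \<theta> \<phi>))"
    by (rule integral_swap_continuous) (use cA in \<open>simp add: case_prod_beta'\<close>)
  also have "\<dots> = integral (cbox 0 (2 * pi)) (\<lambda>\<phi>. 0)"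
  proof (intro integral_cong integral_unique)
    fix \<phi>
    have "((\<lambda>\<theta>. A \<theta> \<phi>) has_integral (\<alpha> \<phi> * sin pi * F pi \<phi> - \<alpha> \<phi> * sin 0 * F 0 \<phi>)) {0..pi}"
      by (rule fundamental_theorem_of_calculus)
         (auto intro: dA has_field_derivative_at_within simp flip: has_real_derivative_iff_has_vector_derivative)
    then show "((\<lambda>\<theta>. A \<theta> \<phi>) has_integral 0) (cbox 0 pi)" by simp
  qed
  finally show ?thesis by simp
qed

section \<open>Green's formula, spectral gap and compactness\<close>

definition sint :: "(real^3 \<Rightarrow> real) \<Rightarrow> real"
  where "sint f = (\<integral>x. f x \<partial>area_measure 1)"

definition dirichlet :: "(real^3 \<Rightarrow> real) \<Rightarrow> real"
  where "dirichlet f = sint (\<lambda>x. grad_S2 f x \<bullet> grad_S2 f x)"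

lemma continuous_S2_bounded:
  fixes f :: "real^3 \<Rightarrow> real"
  assumes "continuous_on S2 f"
  obtains M where "M > 0" "\<And>x. x \<in> S2 \<Longrightarrow> \<bar>f x\<bar> \<le> M"
proof -
  have "bounded (f ` S2)"
    by (intro compact_imp_bounded compact_continuous_image assms compact_sphere)
  then show ?thesis using that unfolding bounded_pos by (metis image_eqI real_norm_def)
qed

lemma continuous_S2_measurable:
  fixes f :: "real^3 \<Rightarrow> real"
  assumes "sets M = sets borel_S2" "continuous_on S2 f"
  shows "f \<in> borel_measurable M"
  using borel_measurable_continuous_on_restrict[OF assms(2)] assms(1) by (simp cong: measurable_cong_sets)

lemma space_eq_S2: "sets M = sets borel_S2 \<Longrightarrow> space M = S2"
  using sets_eq_imp_space_eq[of M borel_S2] by (simp add: space_restrict_space)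

lemma integrable_continuous_S2:
  fixes f :: "real^3 \<Rightarrow> real"
  assumes "finite_measure M" "sets M = sets borel_S2" "continuous_on S2 f"
  shows "integrable M f"
proof -
  obtain B where "\<And>x. x \<in> S2 \<Longrightarrow> \<bar>f x\<bar> \<le> B" using continuous_S2_bounded[OF assms(3)] by metis
  then show ?thesis
    using assms space_eq_S2[OF assms(2)]
    by (intro finite_measure.integrable_const_bound[where B=B] continuous_S2_measurable AE_I2) auto
qed

lemma integrable_area_measure:
  "continuous_on S2 f \<Longrightarrow> integrable (area_measure r) (f :: _ \<Rightarrow> real)"
  by (rule integrable_continuous_S2) (auto intro: finite_measure_area_measure)

lemma sint_cong: "(\<And>x. x \<in> S2 \<Longrightarrow> f x = g x) \<Longrightarrow> sint f = sint g"
  unfolding sint_def by (rule Bochner_Integration.integral_cong) auto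

lemma sint_add: "continuous_on S2 f \<Longrightarrow> continuous_on S2 g \<Longrightarrow> sint (\<lambda>x. f x + g x) = sint f + sint g"
  unfolding sint_def by (intro Bochner_Integration.integral_add integrable_area_measure)

lemma sint_diff: "continuous_on S2 f \<Longrightarrow> continuous_on S2 g \<Longrightarrow> sint (\<lambda>x. f x - g x) = sint f - sint g"
  unfolding sint_def by (intro Bochner_Integration.integral_diff integrable_area_measure)

lemma sint_cmult: "sint (\<lambda>x. c * f x) = c * sint f"
  unfolding sint_def by simp

lemma sint_minus: "sint (\<lambda>x. - f x) = - sint f"
  unfolding sint_def by simp

lemma sint_sum:
  "(\<And>i. i \<in> I \<Longrightarrow> continuous_on S2 (f i)) \<Longrightarrow> sint (\<lambda>x. \<Sum>i\<in>I. f i x) = (\<Sum>i\<in>I. sint (f i))"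
  unfolding sint_def by (intro Bochner_Integration.integral_sum integrable_area_measure)

lemma sint_mono:
  "continuous_on S2 f \<Longrightarrow> continuous_on S2 g \<Longrightarrow> (\<And>x. x \<in> S2 \<Longrightarrow> f x \<le> g x) \<Longrightarrow> sint f \<le> sint g"
  unfolding sint_def by (intro integral_mono integrable_area_measure) auto

lemma sint_nonneg: "(\<And>x. x \<in> S2 \<Longrightarrow> 0 \<le> f x) \<Longrightarrow> 0 \<le> sint f"
  unfolding sint_def by (rule integral_nonneg_AE) auto

lemma sint_const: "sint (\<lambda>x. c) = 4 * pi * c"
  unfolding sint_def by (rule integral_area_measure_const)

lemma sint_abs_le:
  assumes "continuous_on S2 f" "\<And>x. x \<in> S2 \<Longrightarrow> \<bar>f x\<bar> \<le> g x" "continuous_on S2 g"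
  shows "\<bar>sint f\<bar> \<le> sint g"
proof -
  have "sint f \<le> sint g" "sint (\<lambda>x. - f x) \<le> sint g"
    using assms by (auto intro!: sint_mono continuous_intros simp: abs_le_iff)
  then show ?thesis by (simp add: sint_minus)
qed

lemma sint_Cauchy_Schwarz:
  assumes "continuous_on S2 f" "continuous_on S2 g"
  shows "(sint (\<lambda>x. f x * g x))\<^sup>2 \<le> sint (\<lambda>x. (f x)\<^sup>2) * sint (\<lambda>x. (g x)\<^sup>2)"
proof -
  let ?a = "sint (\<lambda>x. (f x)\<^sup>2)" and ?b = "sint (\<lambda>x. f x * g x)" and ?c = "sint (\<lambda>x. (g x)\<^sup>2)"
  have q: "0 \<le> s\<^sup>2 * ?a + 2 * s * t * ?b + t\<^sup>2 * ?c" for s t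
  proof -
    have "0 \<le> sint (\<lambda>x. (s * f x + t * g x)\<^sup>2)" by (rule sint_nonneg) simp
    also have "\<dots> = sint (\<lambda>x. (s\<^sup>2 * (f x)\<^sup>2 + 2 * s * t * (f x * g x)) + t\<^sup>2 * (g x)\<^sup>2)"
      by (rule sint_cong) (simp add: power2_eq_square algebra_simps)
    also have "\<dots> = s\<^sup>2 * ?a + 2 * s * t * ?b + t\<^sup>2 * ?c"
      by (simp add: assms sint_add sint_cmult continuous_intros)
    finally show ?thesis .
  qed
  have a: "0 \<le> ?a" by (rule sint_nonneg) simp
  show ?thesis
  proof (cases "?a = 0")
    case True
    have "?b = 0"
    proof (rule ccontr)
      assume b: "?b \<noteq> 0"
      \<comment> \<open>With \<open>?a = 0\<close> this choice makes the quadratic form equal to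
        \<open>- 1\<close>.\<close>
      show False using q[of "- (?c + 1) / (2 * ?b)" 1] True b by (simp add: field_simps)
    qed
    then show ?thesis using True by simp
  next
    case False
    have "0 \<le> ?a * (?a * ?c - ?b\<^sup>2)"
      using q[of "- ?b" ?a] by (simp add: power2_eq_square algebra_simps)
    then show ?thesis using a False by (simp add: zero_le_mult_iff)
  qed
qed

lemma sint_rot_deriv: "smooth_S2 f \<Longrightarrow> sint (rot_deriv v f) = 0"
  unfolding sint_def by (rule integral_rot_deriv)

text \<open>Derivatives along rotations are antisymmetric for the area, by the product rule and
  \<open>sint_rot_deriv\<close>; summing over the three axes gives the formula.\<close>

lemma sint_Green:
  assumes f: "smooth_S2 f" and g: "smooth_S2 g"
  shows "sint (\<lambda>x. grad_S2 f x \<bullet> grad_S2 g x) = - sint (\<lambda>x. f x * Lap g x)"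
proof -
  let ?L = "\<lambda>i. rot_deriv (axis i 1)"
  have c: "continuous_on S2 (\<lambda>x. ?L i f x * ?L i g x)" "continuous_on S2 (\<lambda>x. f x * ?L i (?L i g) x)" for i
    using f g by (auto intro!: smooth_S2_continuous)
  have "0 = sint (?L i (\<lambda>x. f x * ?L i g x))" for i
    by (rule sint_rot_deriv[symmetric]) (use f g in auto)
  also have "sint (?L i (\<lambda>x. f x * ?L i g x)) = sint (\<lambda>x. f x * ?L i (?L i g) x + ?L i f x * ?L i g x)" for i
    by (rule sint_cong) (simp add: f g rot_deriv_mult smooth_S2_rot_deriv)
  finally have *: "sint (\<lambda>x. ?L i f x * ?L i g x) = - sint (\<lambda>x. f x * ?L i (?L i g) x)" for i
    by (simp add: sint_add c eq_neg_iff_add_eq_0 add.commute)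
  have "sint (\<lambda>x. grad_S2 f x \<bullet> grad_S2 g x) = sint (\<lambda>x. \<Sum>i\<in>UNIV. ?L i f x * ?L i g x)"
    by (rule sint_cong) (use f g grad_S2_inner_grad_S2 in auto)
  also have "\<dots> = - sint (\<lambda>x. \<Sum>i\<in>UNIV. f x * ?L i (?L i g) x)"
    by (simp add: sint_sum c * sum_negf)
  finally show ?thesis by (simp add: Lap_def sum_distrib_left)
qed

lemma sint_Lap_sym:
  assumes "smooth_S2 f" "smooth_S2 g"
  shows "sint (\<lambda>x. Lap f x * g x) = sint (\<lambda>x. f x * Lap g x)"
  using sint_Green[OF assms] sint_Green[OF assms(2,1)] by (simp add: inner_commute mult.commute)

lemma sint_Lap: "smooth_S2 f \<Longrightarrow> sint (Lap f) = 0"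
  using sint_Lap_sym[of f "\<lambda>_. 1"] sint_cong[of "\<lambda>x. f x * Lap (\<lambda>_. 1) x" "\<lambda>_. 0"]
  by (simp add: Lap_const sint_const)

lemma dirichlet_Green: "smooth_S2 f \<Longrightarrow> dirichlet f = - sint (\<lambda>x. f x * Lap f x)"
  unfolding dirichlet_def by (rule sint_Green)

lemma dirichlet_nonneg: "0 \<le> dirichlet f"
  unfolding dirichlet_def by (rule sint_nonneg) simp

section \<open>Zonal kernels and their averages\<close>

lemma grad_S2_power_Suc:
  assumes "smooth_S2 f" "x \<in> S2"
  shows "grad_S2 (\<lambda>x. f x ^ Suc n) x = (real (Suc n) * f x ^ n) *\<^sub>R grad_S2 f x"
proof (induction n)
  case (Suc n)
  have "grad_S2 (\<lambda>x. f x ^ Suc (Suc n)) x = grad_S2 (\<lambda>x. f x * f x ^ Suc n) x" by simp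
  also have "\<dots> = f x *\<^sub>R ((real (Suc n) * f x ^ n) *\<^sub>R grad_S2 f x) + f x ^ Suc n *\<^sub>R grad_S2 f x"
    using assms by (subst grad_S2_mult) (auto simp only: Suc smooth_S2_power)
  also have "\<dots> = (real (Suc (Suc n)) * f x ^ Suc n) *\<^sub>R grad_S2 f x"
    by (simp add: algebra_simps flip: scaleR_add_left)
  finally show ?case .
qed simp

lemma Lap_power_Suc:
  assumes "smooth_S2 f" "x \<in> S2"
  shows "Lap (\<lambda>x. f x ^ Suc n) x = real (Suc n) * f x ^ n * Lap f x
    + real (Suc n) * real n * f x ^ (n - 1) * (grad_S2 f x \<bullet> grad_S2 f x)"
proof (induction n)
  case (Suc n)
  have "Lap (\<lambda>x. f x ^ Suc (Suc n)) x = Lap (\<lambda>x. f x * f x ^ Suc n) x" by simp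
  also have "\<dots> = f x * (real (Suc n) * f x ^ n * Lap f x
    + real (Suc n) * real n * f x ^ (n - 1) * (grad_S2 f x \<bullet> grad_S2 f x))
    + f x ^ Suc n * Lap f x + 2 * (grad_S2 f x \<bullet> ((real (Suc n) * f x ^ n) *\<^sub>R grad_S2 f x))"
    using assms by (subst Lap_mult) (auto simp only: Suc smooth_S2_power grad_S2_power_Suc)
  also have "f x * (real (Suc n) * f x ^ n * Lap f x + real (Suc n) * real n * f x ^ (n - 1) * (grad_S2 f x \<bullet> grad_S2 f x))
    = real (Suc n) * f x ^ Suc n * Lap f x + real (Suc n) * real n * f x ^ n * (grad_S2 f x \<bullet> grad_S2 f x)"
    by (cases n) (simp_all add: algebra_simps)
  finally show ?case by (simp add: algebra_simps)
qed simp

text \<open>The power concentrates at \<open>y = x\<close> as \<open>n\<close> grows, yet is a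
  polynomial of degree \<open>n\<close> in \<open>y\<close>: after normalisation it approximates the
  identity, and it annihilates whatever is orthogonal to polynomials of degree at most
  \<open>n\<close>.\<close>

definition kern :: "nat \<Rightarrow> real^3 \<Rightarrow> real^3 \<Rightarrow> real"
  where "kern n x y = ((1 + x \<bullet> y) / 2) ^ n"

lemma smooth_kern [intro, simp]: "smooth_S2 (kern n x)"
  unfolding kern_def by (intro smooth_S2_power smooth_S2_divide smooth_S2_add smooth_S2_const smooth_S2_inner)

lemma kern_bounds: "x \<in> S2 \<Longrightarrow> y \<in> S2 \<Longrightarrow> 0 \<le> kern n x y \<and> kern n x y \<le> 1"
proof -
  assume "x \<in> S2" "y \<in> S2"
  then have "\<bar>x \<bullet> y\<bar> \<le> 1" using Cauchy_Schwarz_ineq2[of x y] by simp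
  then show ?thesis by (auto simp: kern_def intro!: power_le_one)
qed

text \<open>For \<open>u = (1 + x \<bullet> y) / 2\<close> the Laplacian is \<open>1 - 2 u\<close>
  and the squared gradient \<open>u (1 - u)\<close>. Both are polynomials in \<open>u\<close>, so
  the powers of \<open>u\<close> are mapped to one another.\<close>

lemma Lap_kern:
  assumes "x \<in> S2" "y \<in> S2"
  shows "Lap (kern (Suc n) x) y = (real n + 1)\<^sup>2 * kern n x y - (real n + 1) * (real n + 2) * kern (Suc n) x y"
proof -
  define u where "u y = 1 / 2 + (1 / 2) * (x \<bullet> y)" for y
  have su: "smooth_S2 u" unfolding u_def by (intro smooth_S2_add smooth_S2_cmult smooth_S2_const smooth_S2_inner)
  have ku: "kern n x = (\<lambda>y. u y ^ n)" for n by (auto simp: kern_def u_def add_divide_distrib)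
  have Lu: "Lap u y = 1 - 2 * u y"
  proof -
    have "Lap u y = Lap (\<lambda>y. 1 / 2) y + Lap (\<lambda>y. (1 / 2) * (x \<bullet> y)) y"
      unfolding u_def by (rule Lap_add) (use assms in \<open>auto intro: smooth_S2_cmult\<close>)
    also have "Lap (\<lambda>y. (1 / 2) * (x \<bullet> y)) y = (1 / 2) * Lap (\<lambda>y. x \<bullet> y) y"
      by (rule Lap_cmult) (use assms in auto)
    finally have "Lap u y = 0 + (1 / 2) * (- 2 * (x \<bullet> y))"
      using assms by (simp only: Lap_const Lap_inner)
    then show ?thesis by (simp add: u_def[of y])
  qed
  have gu: "grad_S2 u y = (1 / 2) *\<^sub>R (x - (x \<bullet> y) *\<^sub>R y)"
  proof -
    have "grad_S2 u y = grad_S2 (\<lambda>y. 1 / 2) y + grad_S2 (\<lambda>y. (1 / 2) * (x \<bullet> y)) y"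
      unfolding u_def by (rule grad_S2_add) (use assms in \<open>auto intro: smooth_S2_cmult\<close>)
    also have "grad_S2 (\<lambda>y. (1 / 2) * (x \<bullet> y)) y = (1 / 2) *\<^sub>R grad_S2 (\<lambda>y. x \<bullet> y) y + (x \<bullet> y) *\<^sub>R grad_S2 (\<lambda>y. 1 / 2) y"
      by (rule grad_S2_mult) (use assms in auto)
    finally show ?thesis using assms by (simp only: grad_S2_const grad_S2_inner) simp
  qed
  have "grad_S2 u y \<bullet> grad_S2 u y = (1 - (x \<bullet> y)\<^sup>2) / 4"
  proof -
    have "x \<bullet> x = 1" "y \<bullet> y = 1" using assms by (simp_all add: norm_eq_1)
    then have "(x - (x \<bullet> y) *\<^sub>R y) \<bullet> (x - (x \<bullet> y) *\<^sub>R y) = 1 - (x \<bullet> y)\<^sup>2"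
      by (simp add: inner_diff_left inner_diff_right inner_commute power2_eq_square)
    then show ?thesis
      unfolding gu by (simp add: inner_scaleR_left inner_scaleR_right)
  qed
  also have "\<dots> = u y * (1 - u y)" by (simp add: u_def power2_eq_square field_simps)
  finally have gg: "grad_S2 u y \<bullet> grad_S2 u y = u y * (1 - u y)" .
  have "Lap (kern (Suc n) x) y = real (Suc n) * u y ^ n * (1 - 2 * u y)
     + real (Suc n) * (real n * u y ^ (n - 1) * u y) * (1 - u y)"
    unfolding ku by (subst Lap_power_Suc) (use su assms gg Lu in auto)
  also have "real n * u y ^ (n - 1) * u y = real n * u y ^ n" by (cases n) auto
  finally show ?thesis by (simp add: ku power2_eq_square algebra_simps)
qed

text \<open>A Laplacian has integral zero, so \<open>Lap_kern\<close> becomes a recursion for the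
  integrals.\<close>

lemma sint_kern: "x \<in> S2 \<Longrightarrow> sint (kern n x) = 4 * pi / (real n + 1)"
proof (induction n)
  case 0
  then show ?case by (simp add: kern_def sint_const)
next
  case (Suc n)
  have "0 = sint (Lap (kern (Suc n) x))" by (rule sint_Lap[symmetric]) simp
  also have "\<dots> = sint (\<lambda>y. (real n + 1)\<^sup>2 * kern n x y - (real n + 1) * (real n + 2) * kern (Suc n) x y)"
    by (rule sint_cong) (use Suc.prems Lap_kern in auto)
  also have "\<dots> = (real n + 1)\<^sup>2 * sint (kern n x) - (real n + 1) * (real n + 2) * sint (kern (Suc n) x)"
    by (subst sint_diff) (auto simp: sint_cmult intro!: continuous_intros smooth_S2_continuous)
  finally have "(real n + 1) * ((real n + 2) * sint (kern (Suc n) x)) = (real n + 1) * (4 * pi)"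
    using Suc by (simp add: power2_eq_square)
  then have "(real n + 2) * sint (kern (Suc n) x) = 4 * pi"
    by (subst (asm) mult_cancel_left) auto
  then show ?case by (simp add: field_simps)
qed

text \<open>The factor makes the total weight of the kernel one, by
  \<open>sint_kern\<close>.\<close>

definition avg :: "nat \<Rightarrow> (real^3 \<Rightarrow> real) \<Rightarrow> real^3 \<Rightarrow> real"
  where "avg n f x = (real n + 1) / (4 * pi) * sint (\<lambda>y. kern n x y * f y)"

lemma continuous_kern: "continuous_on A (kern n x)"
  unfolding kern_def by (intro continuous_intros) auto

lemma avg_step:
  assumes "smooth_S2 f" "x \<in> S2"
  shows "avg n f x = avg (Suc n) f x + avg (Suc n) (Lap f) x / ((real n + 1) * (real n + 2))"
proof -
  have c: "continuous_on S2 f" using assms smooth_S2_continuous by blast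
  have "sint (\<lambda>y. kern (Suc n) x y * Lap f y) = sint (\<lambda>y. Lap (kern (Suc n) x) y * f y)"
    by (rule sint_Lap_sym[symmetric]) (use assms in auto)
  also have "\<dots> = sint (\<lambda>y. (real n + 1)\<^sup>2 * (kern n x y * f y) - (real n + 1) * (real n + 2) * (kern (Suc n) x y * f y))"
    by (rule sint_cong) (simp only: Lap_kern[OF assms(2)] left_diff_distrib mult.assoc)
  also have "\<dots> = (real n + 1)\<^sup>2 * sint (\<lambda>y. kern n x y * f y) - (real n + 1) * (real n + 2) * sint (\<lambda>y. kern (Suc n) x y * f y)"
    by (subst sint_diff) (auto simp: sint_cmult intro!: continuous_intros continuous_kern c)
  finally have S: "sint (\<lambda>y. kern (Suc n) x y * Lap f y)
    = (real n + 1)\<^sup>2 * sint (\<lambda>y. kern n x y * f y) - (real n + 1) * (real n + 2) * sint (\<lambda>y. kern (Suc n) x y * f y)" .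
  have "avg (Suc n) (Lap f) x = (real n + 1) * (real n + 2) * (avg n f x - avg (Suc n) f x)"
  proof -
    define q where "q = inverse (4 * pi)"
    have q: "avg n g x = (real n + 1) * q * sint (\<lambda>y. kern n x y * g y)" for n g
      by (simp only: avg_def q_def divide_inverse)
    show ?thesis
      unfolding q S
      by (simp add: power2_eq_square algebra_simps)
  qed
  moreover have "(real n + 1) * (real n + 2) > 0" by (intro mult_pos_pos) auto
  ultimately show ?thesis by simp
qed

text \<open>Korovkin's argument: near \<open>x\<close> uniform continuity is enough, and far from
  \<open>x\<close> the error is dominated by a multiple of \<open>1 - kern 1 x y\<close>, a quarter
  of the squared distance. Its average is explicit, since
  \<open>kern n * (1 - kern 1) = kern n - kern (Suc n)\<close>.\<close>

lemma avg_tendsto: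
  assumes f: "continuous_on S2 f" and e: "e > 0"
  shows "\<forall>\<^sub>F n in sequentially. \<forall>x\<in>S2. \<bar>avg n f x - f x\<bar> < e"
proof -
  obtain M where M: "M > 0" "\<And>x. x \<in> S2 \<Longrightarrow> \<bar>f x\<bar> \<le> M" using continuous_S2_bounded[OF f] by metis
  have "uniformly_continuous_on S2 f" by (intro compact_uniformly_continuous f compact_sphere)
  then obtain d where d: "d > 0" "\<And>x y. x \<in> S2 \<Longrightarrow> y \<in> S2 \<Longrightarrow> dist y x < d \<Longrightarrow> dist (f y) (f x) < e / 2"
    unfolding uniformly_continuous_on_def using e by (meson half_gt_zero)
  \<comment> \<open>At distance \<open>d\<close> the term \<open>K * (1 - kern 1 x y)\<close> equals
    \<open>2 * M\<close>, a bound for the difference of any two values of \<open>f\<close>.\<close>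
  define K where "K = 8 * M / d\<^sup>2"
  have K: "K > 0" using M d by (simp add: K_def)
  have bound: "\<bar>f y - f x\<bar> \<le> e / 2 + K * (1 - kern 1 x y)" if "x \<in> S2" "y \<in> S2" for x y
  proof (cases "dist y x < d")
    case True
    then have "\<bar>f y - f x\<bar> < e / 2" using d(2)[OF that] by (simp add: dist_real_def)
    moreover have "0 \<le> K * (1 - kern 1 x y)" using K kern_bounds[OF that, of 1] by simp
    ultimately show ?thesis by linarith
  next
    case False
    then have "d\<^sup>2 \<le> (dist y x)\<^sup>2" using d by (intro power_mono) auto
    also have "\<dots> = 4 * (1 - kern 1 x y)"
    proof -
      have "x \<bullet> x = 1" "y \<bullet> y = 1" using that by (simp_all add: norm_eq_1)
      then have "(dist y x)\<^sup>2 = 2 - 2 * (x \<bullet> y)"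
        unfolding dist_norm power2_norm_eq_inner by (simp add: inner_diff_left inner_diff_right inner_commute)
      then show ?thesis by (simp add: kern_def field_simps)
    qed
    finally have "K * d\<^sup>2 \<le> K * (4 * (1 - kern 1 x y))" using K by (intro mult_left_mono) auto
    moreover have "K * d\<^sup>2 = 8 * M" using d by (simp add: K_def)
    moreover have "K * (4 * (1 - kern 1 x y)) = 4 * (K * (1 - kern 1 x y))" by simp
    ultimately have "2 * M \<le> K * (1 - kern 1 x y)" by linarith
    then show ?thesis using M(2)[OF that(1)] M(2)[OF that(2)] e by (simp add: abs_if split: if_splits)
  qed
  have main: "\<bar>avg n f x - f x\<bar> \<le> e / 2 + K / (real n + 2)" if x: "x \<in> S2" for n x
  proof -
    have "avg n f x - f x = (real n + 1) / (4 * pi) * (sint (\<lambda>y. kern n x y * f y) - sint (kern n x) * f x)"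
      using sint_kern[OF x, of n] by (simp add: avg_def right_diff_distrib)
    also have "sint (\<lambda>y. kern n x y * f y) - sint (kern n x) * f x = sint (\<lambda>y. kern n x y * f y - f x * kern n x y)"
      by (subst sint_diff) (auto simp: sint_cmult intro!: continuous_intros continuous_kern f)
    also have "\<bar>(real n + 1) / (4 * pi) * \<dots>\<bar> \<le> (real n + 1) / (4 * pi) * sint (\<lambda>y. (e / 2 + K) * kern n x y - K * kern (Suc n) x y)"
    proof -
      have "\<bar>sint (\<lambda>y. kern n x y * f y - f x * kern n x y)\<bar> \<le> sint (\<lambda>y. (e / 2 + K) * kern n x y - K * kern (Suc n) x y)"
      proof (rule sint_abs_le)
        fix y assume y: "y \<in> S2"
        have "\<bar>kern n x y * f y - f x * kern n x y\<bar> = kern n x y * \<bar>f y - f x\<bar>"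
        proof -
          have "kern n x y * f y - f x * kern n x y = kern n x y * (f y - f x)" by algebra
          then show ?thesis using kern_bounds[OF x y, of n] by (simp add: abs_mult)
        qed
        also have "\<dots> \<le> kern n x y * (e / 2 + K * (1 - kern 1 x y))"
          using kern_bounds[OF x y, of n] bound[OF x y] by (intro mult_left_mono) auto
        also have "\<dots> = (e / 2 + K) * kern n x y - K * kern (Suc n) x y"
          by (simp add: kern_def algebra_simps)
        finally show "\<bar>kern n x y * f y - f x * kern n x y\<bar> \<le> (e / 2 + K) * kern n x y - K * kern (Suc n) x y" .
      qed (auto intro!: continuous_intros continuous_kern f)
      then show ?thesis by (simp add: abs_mult mult_left_mono divide_right_mono)
    qed
    also have "sint (\<lambda>y. (e / 2 + K) * kern n x y - K * kern (Suc n) x y) = (e / 2 + K) * (4 * pi / (real n + 1)) - K * (4 * pi / (real n + 2))"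
      by (subst sint_diff) (auto simp: sint_cmult sint_kern[OF x] intro!: continuous_intros continuous_kern)
    also have "(real n + 1) / (4 * pi) * \<dots> = e / 2 + K / (real n + 2)"
    proof -
      have "(m + 1) / p * (A * (p / (m + 1)) - K * (p / (m + 2))) = A - K + K / (m + 2)"
        if "m \<ge> 0" "p > 0" for m p A :: real
      proof -
        have "(m + 1) / p * (A * (p / (m + 1)) - K * (p / (m + 2))) = A - K * ((m + 1) / (m + 2))"
          using that by (simp add: right_diff_distrib)
        also have "(m + 1) / (m + 2) = 1 - 1 / (m + 2)" using that by (simp add: field_simps)
        finally show ?thesis by (simp add: right_diff_distrib)
      qed
      from this[of "real n" "4 * pi" "e / 2 + K"] show ?thesis by simp
    qed
    finally show ?thesis .
  qed
  have "(\<lambda>n. K / (real n + 2)) \<longlonglongrightarrow> 0" by real_asymp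
  then have "\<forall>\<^sub>F n in sequentially. K / (real n + 2) < e / 2"
    using e by (intro order_tendstoD) auto
  then show ?thesis 
  proof eventually_elim
    case (elim n)
    show ?case
    proof
      fix x assume "x \<in> S2"
      then show "\<bar>avg n f x - f x\<bar> < e" using main[of x n] elim by linarith
    qed
  qed
qed

text \<open>The same factor \<open>p\<close> occurs at \<open>x\<close> and at \<open>y\<close>.
  This displays the kernel as positive semidefinite of finite rank: the symmetry and positivity of
  \<open>corr\<close> and the reduction to countably many moments in Rellich's theorem rest on
  it.\<close>

lemma kern_features:
  "\<exists>ps. (\<forall>p\<in>set ps. smooth_S2 p) \<and> (\<forall>x y. kern n x y = (\<Sum>p\<leftarrow>ps. p x * p y))"
proof (induction n)
  case 0
  show ?case by (rule exI[of _ "[\<lambda>_. 1]"]) (auto simp: kern_def)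
next
  case (Suc n)
  then obtain ps where ps: "\<forall>p\<in>set ps. smooth_S2 p" "\<And>x y. kern n x y = (\<Sum>p\<leftarrow>ps. p x * p y)"
    by blast
  \<comment> \<open>The factor \<open>1 / 2\<close> of \<open>kern\<close> is split evenly between
    the two arguments.\<close>
  define c where "c = 1 / sqrt 2"
  have cc: "(a * c) * (b * c) = (a * b) / 2" for a b :: real by (simp add: c_def)
  define qs where "qs = map (\<lambda>p x. p x * c) ps @ map (\<lambda>p x. (p x * x$1) * c) ps
    @ map (\<lambda>p x. (p x * x$2) * c) ps @ map (\<lambda>p x. (p x * x$3) * c) ps"
  have *: "(\<Sum>p\<leftarrow>ps. (p x * a * c) * (p y * b * c)) = kern n x y * (a * b / 2)" for x y a b
  proof -
    have "(p x * a * c) * (p y * b * c) = (p x * p y) * (a * b / 2)" for p :: "real^3 \<Rightarrow> real"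
      using cc[of "p x * a" "p y * b"] by simp
    then show ?thesis unfolding ps(2) by (simp only: sum_list_mult_const)
  qed
  have "kern (Suc n) x y = (\<Sum>p\<leftarrow>qs. p x * p y)" for x y
    using *[of x 1 y 1] *[of x "x$1" y "y$1"] *[of x "x$2" y "y$2"] *[of x "x$3" y "y$3"]
    unfolding qs_def by (simp add: comp_def kern_def inner_vec_def sum_3 field_simps)
  moreover have "\<forall>p\<in>set qs. smooth_S2 p"
    using ps(1) unfolding qs_def by (auto intro!: smooth_S2_mult)
  ultimately show ?case by blast
qed

definition feat :: "nat \<Rightarrow> (real^3 \<Rightarrow> real) list"
  where "feat n = (SOME ps. (\<forall>p\<in>set ps. smooth_S2 p) \<and> (\<forall>x y. kern n x y = (\<Sum>p\<leftarrow>ps. p x * p y)))"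

lemma feat: "(\<forall>p\<in>set (feat n). smooth_S2 p) \<and> (\<forall>x y. kern n x y = (\<Sum>p\<leftarrow>feat n. p x * p y))"
  unfolding feat_def by (rule someI_ex[OF kern_features])

lemma feat_smooth: "k < length (feat n) \<Longrightarrow> smooth_S2 (feat n ! k)"
  using feat[of n] nth_mem by blast

lemma kern_feat: "kern n x y = (\<Sum>k<length (feat n). (feat n ! k) x * (feat n ! k) y)"
proof -
  have "kern n x y = (\<Sum>p\<leftarrow>feat n. p x * p y)" using feat[of n] by blast
  then show ?thesis by (simp add: sum_list_sum_nth atLeast0LessThan)
qed

text \<open>Passing to this bilinear form replaces operator inequalities for the averages by
  inequalities between numbers.\<close>

definition corr :: "nat \<Rightarrow> (real^3 \<Rightarrow> real) \<Rightarrow> (real^3 \<Rightarrow> real) \<Rightarrow> real"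
  where "corr n f g = sint (\<lambda>x. f x * avg n g x)"

lemma feat_cont: "k < length (feat n) \<Longrightarrow> continuous_on S2 (feat n ! k)"
  using feat_smooth smooth_S2_continuous by blast

lemma avg_eq_feat:
  assumes "continuous_on S2 g"
  shows "avg n g x = (real n + 1) / (4 * pi) * (\<Sum>k<length (feat n). (feat n ! k) x * sint (\<lambda>y. (feat n ! k) y * g y))"
proof -
  have "sint (\<lambda>y. kern n x y * g y) = sint (\<lambda>y. \<Sum>k<length (feat n). (feat n ! k) x * ((feat n ! k) y * g y))"
    by (rule sint_cong) (simp add: kern_feat sum_distrib_left sum_distrib_right mult_ac)
  also have "\<dots> = (\<Sum>k<length (feat n). (feat n ! k) x * sint (\<lambda>y. (feat n ! k) y * g y))"
    by (subst sint_sum) (auto simp: sint_cmult intro!: continuous_intros feat_cont assms)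
  finally show ?thesis by (simp add: avg_def)
qed

lemma continuous_avg: "continuous_on S2 g \<Longrightarrow> continuous_on S2 (avg n g)"
  by (subst continuous_on_cong[OF refl avg_eq_feat]) (auto intro!: continuous_intros feat_cont)

lemma corr_eq_feat:
  assumes f: "continuous_on S2 f" and g: "continuous_on S2 g"
  shows "corr n f g = (real n + 1) / (4 * pi) *
    (\<Sum>k<length (feat n). sint (\<lambda>y. (feat n ! k) y * f y) * sint (\<lambda>y. (feat n ! k) y * g y))"
proof -
  have "corr n f g = sint (\<lambda>x. \<Sum>k<length (feat n).
     ((real n + 1) / (4 * pi) * sint (\<lambda>y. (feat n ! k) y * g y)) * ((feat n ! k) x * f x))"
    unfolding corr_def
    by (rule sint_cong) (simp add: avg_eq_feat[OF g] sum_distrib_left sum_divide_distrib mult_ac)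
  also have "\<dots> = (\<Sum>k<length (feat n).
     ((real n + 1) / (4 * pi) * sint (\<lambda>y. (feat n ! k) y * g y)) * sint (\<lambda>y. (feat n ! k) y * f y))"
    by (subst sint_sum) (auto simp: sint_cmult simp del: times_divide_eq_left intro!: continuous_intros feat_cont f)
  finally show ?thesis by (simp add: sum_distrib_left mult_ac)
qed

lemma corr_sym: "continuous_on S2 f \<Longrightarrow> continuous_on S2 g \<Longrightarrow> corr n f g = corr n g f"
  by (simp add: corr_eq_feat mult.commute)

lemma corr_nonneg: "continuous_on S2 f \<Longrightarrow> 0 \<le> corr n f f"
  by (simp add: corr_eq_feat sum_nonneg)

lemma corr_combination:
  assumes f: "continuous_on S2 f" and g: "continuous_on S2 g"
  shows "corr n (\<lambda>x. f x + c * g x) (\<lambda>x. f x + c * g x) = corr n f f + 2 * c * corr n f g + c\<^sup>2 * corr n g g"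
proof -
  have "sint (\<lambda>y. (feat n ! k) y * (f y + c * g y)) = sint (\<lambda>y. (feat n ! k) y * f y) + c * sint (\<lambda>y. (feat n ! k) y * g y)"
    if "k < length (feat n)" for k
  proof -
    have "sint (\<lambda>y. (feat n ! k) y * (f y + c * g y)) = sint (\<lambda>y. (feat n ! k) y * f y + c * ((feat n ! k) y * g y))"
      by (rule sint_cong) (simp add: algebra_simps)
    then show ?thesis
      using that by (simp add: sint_add sint_cmult continuous_intros feat_cont f g)
  qed
  note * = this
  have cont: "continuous_on S2 (\<lambda>x. f x + c * g x)" by (intro continuous_intros f g)
  have "(\<Sum>k<length (feat n). sint (\<lambda>y. (feat n ! k) y * (f y + c * g y)) * sint (\<lambda>y. (feat n ! k) y * (f y + c * g y)))
    = (\<Sum>k<length (feat n). sint (\<lambda>y. (feat n ! k) y * f y) * sint (\<lambda>y. (feat n ! k) y * f y)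
        + 2 * c * (sint (\<lambda>y. (feat n ! k) y * f y) * sint (\<lambda>y. (feat n ! k) y * g y))
        + c\<^sup>2 * (sint (\<lambda>y. (feat n ! k) y * g y) * sint (\<lambda>y. (feat n ! k) y * g y)))"
  proof (rule sum.cong[OF refl])
    fix k assume "k \<in> {..<length (feat n)}"
    then have k: "k < length (feat n)" by simp
    show "sint (\<lambda>y. (feat n ! k) y * (f y + c * g y)) * sint (\<lambda>y. (feat n ! k) y * (f y + c * g y))
      = sint (\<lambda>y. (feat n ! k) y * f y) * sint (\<lambda>y. (feat n ! k) y * f y)
        + 2 * c * (sint (\<lambda>y. (feat n ! k) y * f y) * sint (\<lambda>y. (feat n ! k) y * g y))
        + c\<^sup>2 * (sint (\<lambda>y. (feat n ! k) y * g y) * sint (\<lambda>y. (feat n ! k) y * g y))"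
      unfolding *[OF k] by (simp add: power2_eq_square algebra_simps)
  qed
  then show ?thesis
    unfolding corr_eq_feat[OF f f] corr_eq_feat[OF f g] corr_eq_feat[OF g g] corr_eq_feat[OF cont cont]
    by (simp add: sum.distrib sum_distrib_left[symmetric] algebra_simps)
qed

lemma corr_step:
  assumes f: "continuous_on S2 f" and g: "smooth_S2 g"
  shows "corr n f g = corr (Suc n) f g + corr (Suc n) f (Lap g) / ((real n + 1) * (real n + 2))"
proof -
  let ?N = "(real n + 1) * (real n + 2)"
  have cg: "continuous_on S2 g" "continuous_on S2 (Lap g)" using g smooth_S2_continuous by blast+
  have "corr n f g = sint (\<lambda>x. f x * avg (Suc n) g x + (1 / ?N) * (f x * avg (Suc n) (Lap g) x))"
    unfolding corr_def by (rule sint_cong) (simp only: avg_step[OF g, of _ n], simp add: algebra_simps)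
  also have "\<dots> = corr (Suc n) f g + (1 / ?N) * corr (Suc n) f (Lap g)"
    unfolding corr_def by (subst sint_add) (auto simp only: sint_cmult intro!: continuous_intros continuous_avg f cg)
  finally show ?thesis by simp
qed

lemma corr_tendsto:
  assumes f: "continuous_on S2 f" and g: "continuous_on S2 g"
  shows "(\<lambda>n. corr n f g) \<longlonglongrightarrow> sint (\<lambda>x. f x * g x)"
proof (rule LIMSEQ_I)
  fix r :: real assume r: "r > 0"
  obtain M where M: "M > 0" "\<And>x. x \<in> S2 \<Longrightarrow> \<bar>f x\<bar> \<le> M" using continuous_S2_bounded[OF f] by metis
  define e where "e = r / (8 * pi * M)"
  have e: "e > 0" using r M by (simp add: e_def)
  obtain N where N: "\<And>n x. n \<ge> N \<Longrightarrow> x \<in> S2 \<Longrightarrow> \<bar>avg n g x - g x\<bar> < e"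
    using avg_tendsto[OF g e] unfolding eventually_sequentially by blast
  show "\<exists>no. \<forall>n\<ge>no. norm (corr n f g - sint (\<lambda>x. f x * g x)) < r"
  proof (intro exI allI impI)
    fix n assume n: "n \<ge> N"
    have "corr n f g - sint (\<lambda>x. f x * g x) = sint (\<lambda>x. f x * avg n g x - f x * g x)"
      unfolding corr_def by (subst sint_diff) (auto intro!: continuous_intros f g continuous_avg)
    also have "\<bar>\<dots>\<bar> \<le> sint (\<lambda>x. M * e)"
    proof (rule sint_abs_le)
      fix x assume x: "x \<in> S2"
      have "\<bar>f x * avg n g x - f x * g x\<bar> = \<bar>f x\<bar> * \<bar>avg n g x - g x\<bar>"
        by (simp add: abs_mult flip: right_diff_distrib)
      also have "\<dots> \<le> M * e" using M N[OF n x] x by (intro mult_mono) auto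
      finally show "\<bar>f x * avg n g x - f x * g x\<bar> \<le> M * e" .
    qed (auto intro!: continuous_intros f g continuous_avg)
    also have "\<dots> < r" using r M by (simp add: sint_const e_def)
    finally show "norm (corr n f g - sint (\<lambda>x. f x * g x)) < r" by simp
  qed
qed

text \<open>
  Write \<open>X = - Lap\<close>, \<open>L = (m + 1) (m + 2)\<close> and \<open>A\<^sub>n = avg n\<close>. The relation
  \<open>A\<^sub>n = (1 - X / ((n + 1) (n + 2))) A\<^sub>n\<^sub>+\<^sub>1\<close> and positivity of \<open>(X - L)\<^sup>2 A\<^sub>n\<^sub>+\<^sub>1\<close> propagate
  nonnegativity of \<open>\<langle>f, (X - L) A\<^sub>n f\<rangle>\<close> from \<open>n\<close> to \<open>n + 1\<close>.
\<close>
theorem spectral_gap: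
  assumes f: "smooth_S2 f" and 0: "\<And>x. x \<in> S2 \<Longrightarrow> avg m f x = 0"
  shows "(real m + 1) * (real m + 2) * sint (\<lambda>x. (f x)\<^sup>2) \<le> dirichlet f"
proof -
  define N where "N n = (real n + 1) * (real n + 2)" for n
  define L where "L = N m"
  define q d e where "q n = corr n f f" and "d n = - corr n f (Lap f)" and "e n = corr n (Lap f) (Lap f)" for n
  have cf: "continuous_on S2 f" "continuous_on S2 (Lap f)" using f smooth_S2_continuous by blast+
  have Npos: "N n > 0" for n unfolding N_def by (intro mult_pos_pos) auto
  have q: "q n = q (Suc n) - d (Suc n) / N n" for n
    unfolding q_def d_def N_def by (subst corr_step[OF cf(1) f]) simp
  have d: "d n = d (Suc n) - e (Suc n) / N n" for n
    unfolding e_def d_def N_def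
    by (subst (1 2) corr_sym[OF cf]) (subst corr_step[OF cf(2) f], simp)
  have pos: "0 \<le> e n - 2 * L * d n + L\<^sup>2 * q n" for n
  proof -
    have "0 \<le> corr n (\<lambda>x. Lap f x + L * f x) (\<lambda>x. Lap f x + L * f x)"
      by (intro corr_nonneg continuous_intros cf)
    then show ?thesis
      unfolding corr_combination[OF cf(2,1)] e_def d_def q_def by (simp add: corr_sym[OF cf(2,1)])
  qed
  \<comment> \<open>The induction starts at \<open>Suc m\<close>, where \<open>q m = 0\<close> turns
    the recursion into an equality with \<open>N m = L\<close>; from there on \<open>N n > L\<close>
    strictly.\<close>
  have main: "L * q n \<le> d n" if "n \<ge> Suc m" for n
    using that
  proof (induction n rule: dec_induct)
    case base
    have "q m = sint (\<lambda>x. 0)" unfolding q_def corr_def by (rule sint_cong) (use 0 in simp)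
    then have "q m = 0" by (simp add: sint_const)
    then have "q (Suc m) = d (Suc m) / N m" using q[of m] by simp
    then show ?case using Npos[of m] by (simp add: L_def)
  next
    case (step n)
    have LN: "L < N n"
      unfolding L_def N_def using step.hyps by (intro mult_strict_mono) auto
    define t where "t = d (Suc n) - L * q (Suc n)"
    have "L * (q (Suc n) - d (Suc n) / N n) \<le> d (Suc n) - e (Suc n) / N n"
      using step.IH q[of n] d[of n] by simp
    then have "(e (Suc n) - L * d (Suc n)) / N n \<le> t"
      by (simp add: t_def algebra_simps diff_divide_distrib)
    moreover have "L * t \<le> e (Suc n) - L * d (Suc n)"
      using pos[of "Suc n"] by (simp add: t_def power2_eq_square algebra_simps)
    ultimately have "L * t / N n \<le> t"
      using Npos[of n] by (meson divide_right_mono less_imp_le order_trans)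
    then have "0 \<le> (N n - L) * t" using Npos[of n] by (simp add: field_simps)
    then have "0 \<le> t" using LN by (simp add: zero_le_mult_iff)
    then show ?case by (simp add: t_def)
  qed
  have "(\<lambda>n. L * q n) \<longlonglongrightarrow> L * sint (\<lambda>x. f x * f x)"
    unfolding q_def by (intro tendsto_intros corr_tendsto cf)
  moreover have "d \<longlonglongrightarrow> - sint (\<lambda>x. f x * Lap f x)"
    unfolding d_def by (intro tendsto_intros corr_tendsto cf)
  ultimately have "L * sint (\<lambda>x. f x * f x) \<le> - sint (\<lambda>x. f x * Lap f x)"
    by (rule LIMSEQ_le) (use main in blast)
  then show ?thesis by (simp add: L_def N_def dirichlet_Green[OF f] power2_eq_square)
qed

text \<open>The increments of \<open>q\<close> are \<open>d (Suc n) / N n\<close>, and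
  \<open>d\<close> increases to the energy because \<open>e\<close> is nonnegative. Since
  \<open>1 / N n\<close> telescopes, everything beyond level \<open>m\<close> costs at most
  \<open>1 / (m + 1)\<close> of the energy. This is the uniform remainder estimate behind Rellich's
  theorem.\<close>

theorem sint_square_le_corr:
  assumes f: "smooth_S2 f"
  shows "sint (\<lambda>x. (f x)\<^sup>2) \<le> corr m f f + dirichlet f / (real m + 1)"
proof -
  define N where "N n = (real n + 1) * (real n + 2)" for n
  define q d e where "q n = corr n f f" and "d n = - corr n f (Lap f)" and "e n = corr n (Lap f) (Lap f)" for n
  have cf: "continuous_on S2 f" "continuous_on S2 (Lap f)" using f smooth_S2_continuous by blast+
  have Npos: "N n > 0" for n unfolding N_def by (intro mult_pos_pos) auto
  have q: "q n = q (Suc n) - d (Suc n) / N n" for n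
    unfolding q_def d_def N_def by (subst corr_step[OF cf(1) f]) simp
  have d: "d n = d (Suc n) - e (Suc n) / N n" for n
    unfolding e_def d_def N_def
    by (subst (1 2) corr_sym[OF cf]) (subst corr_step[OF cf(2) f], simp)
  have "incseq d"
  proof (rule incseq_SucI)
    fix n
    have "0 \<le> e (Suc n) / N n"
      unfolding e_def by (intro divide_nonneg_pos corr_nonneg cf Npos)
    then show "d n \<le> d (Suc n)" using d[of n] by linarith
  qed
  moreover have "d \<longlonglongrightarrow> dirichlet f"
    unfolding d_def dirichlet_Green[OF f] by (intro tendsto_intros corr_tendsto cf)
  ultimately have dD: "d n \<le> dirichlet f" for n by (rule incseq_le)
  have main: "q n \<le> q m + dirichlet f * (1 / (real m + 1) - 1 / (real n + 1))" if "n \<ge> m" for n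
    using that
  proof (induction n rule: dec_induct)
    case (step n)
    have "q (Suc n) = q n + d (Suc n) / N n" using q[of n] by simp
    also have "d (Suc n) / N n \<le> dirichlet f / N n" using dD Npos by (intro divide_right_mono) (auto simp: less_imp_le)
    also have "dirichlet f / N n = dirichlet f * (1 / (real n + 1) - 1 / (real n + 2))"
    proof -
      have "1 / (real n + 1) - 1 / (real n + 2) = 1 / N n" by (simp add: N_def field_simps)
      then show ?thesis by simp
    qed
    finally show ?case using step.IH by (simp add: algebra_simps)
  qed simp
  have "q \<longlonglongrightarrow> sint (\<lambda>x. f x * f x)" unfolding q_def by (intro corr_tendsto cf)
  moreover have "q n \<le> q m + dirichlet f / (real m + 1)" if "n \<ge> m" for n
  proof -
    have "dirichlet f * (1 / (real m + 1) - 1 / (real n + 1)) \<le> dirichlet f * (1 / (real m + 1))"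
      by (intro mult_left_mono dirichlet_nonneg) simp
    then show ?thesis using main[OF that] by simp
  qed
  ultimately have "sint (\<lambda>x. f x * f x) \<le> q m + dirichlet f / (real m + 1)"
    by (intro LIMSEQ_le_const2) auto
  then show ?thesis by (simp add: q_def power2_eq_square)
qed

section \<open>Square integrable functions and completeness\<close>

definition nsq :: "'a measure \<Rightarrow> ('a \<Rightarrow> 'b::euclidean_space) \<Rightarrow> real"
  where "nsq M f = (\<integral>x. (norm (f x))\<^sup>2 \<partial>M)"

lemma nsq_real: "nsq M (f :: _ \<Rightarrow> real) = (\<integral>x. (f x)\<^sup>2 \<partial>M)"
  by (simp add: nsq_def)

lemma L2_real: "(f :: _ \<Rightarrow> real) \<in> L2 M \<longleftrightarrow> f \<in> borel_measurable M \<and> integrable M (\<lambda>x. (f x)\<^sup>2)"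
  by (simp add: L2_def)

lemma nsq_nonneg: "0 \<le> nsq M f"
  unfolding nsq_def by (rule integral_nonneg_AE) simp

text \<open>Replaces Minkowski's inequality and avoids square roots; the factor two costs only
  constants.\<close>

lemma norm_add_square_le: "(norm (a + b :: 'b::euclidean_space))\<^sup>2 \<le> 2 * (norm a)\<^sup>2 + 2 * (norm b)\<^sup>2"
proof -
  have "(norm (a + b))\<^sup>2 \<le> (norm a + norm b)\<^sup>2" by (intro power_mono norm_triangle_ineq) simp
  also have "\<dots> \<le> 2 * (norm a)\<^sup>2 + 2 * (norm b)\<^sup>2"
    using zero_le_power2[of "norm a - norm b"] by (simp add: power2_eq_square algebra_simps)
  finally show ?thesis .
qed

lemma L2_add:
  assumes "f \<in> L2 M" "g \<in> L2 M"
  shows "(\<lambda>x. f x + g x) \<in> L2 M" "nsq M (\<lambda>x. f x + g x) \<le> 2 * nsq M f + 2 * nsq M g"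
proof -
  have m [measurable]: "f \<in> borel_measurable M" "g \<in> borel_measurable M"
    and i: "integrable M (\<lambda>x. (norm (f x))\<^sup>2)" "integrable M (\<lambda>x. (norm (g x))\<^sup>2)"
    using assms by (auto simp: L2_def)
  have i2: "integrable M (\<lambda>x. 2 * (norm (f x))\<^sup>2 + 2 * (norm (g x))\<^sup>2)" using i by auto
  then have i3: "integrable M (\<lambda>x. (norm (f x + g x))\<^sup>2)"
    by (rule Bochner_Integration.integrable_bound) (auto simp: norm_add_square_le)
  then show "(\<lambda>x. f x + g x) \<in> L2 M" by (simp add: L2_def)
  have "nsq M (\<lambda>x. f x + g x) \<le> (\<integral>x. 2 * (norm (f x))\<^sup>2 + 2 * (norm (g x))\<^sup>2 \<partial>M)"
    unfolding nsq_def by (intro integral_mono i2 i3 norm_add_square_le)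
  then show "nsq M (\<lambda>x. f x + g x) \<le> 2 * nsq M f + 2 * nsq M g"
    using i by (simp add: nsq_def)
qed

lemma L2_uminus: "f \<in> L2 M \<Longrightarrow> (\<lambda>x. - f x) \<in> L2 M"
  by (simp add: L2_def)

lemma L2_diff:
  assumes "f \<in> L2 M" "g \<in> L2 M"
  shows "(\<lambda>x. f x - g x) \<in> L2 M" "nsq M (\<lambda>x. f x - g x) \<le> 2 * nsq M f + 2 * nsq M g"
  using L2_add[OF assms(1) L2_uminus[OF assms(2)]] by (simp_all add: nsq_def)

lemma nsq_triangle:
  assumes "f \<in> L2 M" "g \<in> L2 M" "h \<in> L2 M"
  shows "nsq M (\<lambda>x. f x - h x) \<le> 2 * nsq M (\<lambda>x. f x - g x) + 2 * nsq M (\<lambda>x. g x - h x)"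
  using L2_add(2)[OF L2_diff(1)[OF assms(1,2)] L2_diff(1)[OF assms(2,3)]] by simp

lemma nsq_commute: "nsq M (\<lambda>x. f x - g x) = nsq M (\<lambda>x. g x - f x)"
  by (simp add: nsq_def norm_minus_commute)

lemma nsq_zero_AE:
  assumes "f \<in> L2 M" "nsq M f = 0"
  shows "AE x in M. f x = 0"
  using integral_nonneg_eq_0_iff_AE[of M "\<lambda>x. (norm (f x))\<^sup>2"] assms by (simp add: L2_def nsq_def)

lemma L2_integrable:
  assumes "finite_measure M" "f \<in> L2 M"
  shows "integrable M f"
proof -
  have "integrable M (\<lambda>x. 1 + (norm (f x))\<^sup>2)"
    using assms finite_measure.integrable_const[OF assms(1), of "1::real"]
    by (intro Bochner_Integration.integrable_add) (auto simp: L2_def)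
  moreover have "norm (f x) \<le> norm (1 + (norm (f x))\<^sup>2)" for x
    using zero_le_power2[of "norm (f x) - 1"] by (simp add: power2_eq_square algebra_simps abs_if)
  ultimately show ?thesis
    using assms by (intro Bochner_Integration.integrable_bound[of M "\<lambda>x. 1 + (norm (f x))\<^sup>2" f]) (auto simp: L2_def)
qed

text \<open>The Riesz-Fischer argument: on a finite measure space an \<open>L\<^sup>2\<close> Cauchy
  sequence is Cauchy in \<open>L\<^sup>1\<close>, so a subsequence converges almost everywhere, and
  Fatou's lemma carries the estimate back to \<open>L\<^sup>2\<close>.\<close>

lemma L2_complete:
  fixes f :: "nat \<Rightarrow> 'a \<Rightarrow> real"
  assumes fin: "finite_measure M" and f: "\<And>n. f n \<in> L2 M"
    and cauchy: "\<And>e. e > 0 \<Longrightarrow> \<exists>N. \<forall>i\<ge>N. \<forall>j\<ge>N. nsq M (\<lambda>x. f i x - f j x) < e"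
  obtains v where "v \<in> L2 M" "(\<lambda>n. nsq M (\<lambda>x. f n x - v x)) \<longlonglongrightarrow> 0"
proof -
  interpret finite_measure M by fact
  have m [measurable]: "f n \<in> borel_measurable M" for n using f[of n] by (simp add: L2_def)
  have int: "integrable M (f n)" for n by (rule L2_integrable) fact+
  have "\<exists>N. \<forall>i\<ge>N. \<forall>j\<ge>N. (LINT x|M. norm (f i x - f j x)) < e" if e: "e > 0" for e
  proof -
    \<comment> \<open>Weighted arithmetic-geometric mean: the \<open>L\<^sup>1\<close> norm is at
      most \<open>t * K / 2\<close> plus the squared \<open>L\<^sup>2\<close> norm over
      \<open>2 * t\<close>. The \<open>+ 1\<close> in \<open>t\<close> is for
      \<open>K = 0\<close>.\<close>
    define K where "K = measure M (space M)"
    define t where "t = e / (K + 1)"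
    have K: "K \<ge> 0" by (simp add: K_def)
    have t: "t > 0" "t * K < e" using e K by (auto simp: t_def field_simps)
    obtain N where N: "\<And>i j. i \<ge> N \<Longrightarrow> j \<ge> N \<Longrightarrow> nsq M (\<lambda>x. f i x - f j x) < e * t"
      using cauchy[of "e * t"] e t by auto
    have "(LINT x|M. norm (f i x - f j x)) < e" if "i \<ge> N" "j \<ge> N" for i j
    proof -
      have L: "(\<lambda>x. f i x - f j x) \<in> L2 M" by (intro L2_diff f)
      have "(LINT x|M. norm (f i x - f j x)) \<le> (LINT x|M. t / 2 + (norm (f i x - f j x))\<^sup>2 / (2 * t))"
      proof (rule integral_mono)
        show "integrable M (\<lambda>x. norm (f i x - f j x))" using int by auto
        show "integrable M (\<lambda>x. t / 2 + (norm (f i x - f j x))\<^sup>2 / (2 * t))"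
          using L by (auto simp: L2_def)
        show "norm (f i x - f j x) \<le> t / 2 + (norm (f i x - f j x))\<^sup>2 / (2 * t)" for x
          using t zero_le_power2[of "norm (f i x - f j x) - t"]
          by (simp add: field_simps power2_eq_square)
      qed
      also have "\<dots> = t / 2 * K + nsq M (\<lambda>x. f i x - f j x) / (2 * t)"
        using L by (simp add: L2_def nsq_def K_def)
      also have "\<dots> < e / 2 + e / 2"
        using t N[OF that] by (intro add_less_le_mono) (auto simp: field_simps intro: less_imp_le)
      finally show ?thesis by simp
    qed
    then show ?thesis by blast
  qed
  then obtain r where r: "strict_mono r" "AE x in M. Cauchy (\<lambda>i. f (r i) x)"
    using cauchy_L1_AE_cauchy_subseq[of M f] int by metis
  define v where "v x = lim (\<lambda>i. f (r i) x)" for x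
  have v [measurable]: "v \<in> borel_measurable M" unfolding v_def by measurable
  have conv: "AE x in M. (\<lambda>i. f (r i) x) \<longlonglongrightarrow> v x"
    using r(2) by eventually_elim (simp add: v_def Cauchy_convergent_iff convergent_LIMSEQ_iff)
  have bound: "(\<integral>\<^sup>+x. ennreal ((f n x - v x)\<^sup>2) \<partial>M) \<le> ennreal e"
    if e: "e > 0" and N: "\<And>i j. i \<ge> N \<Longrightarrow> j \<ge> N \<Longrightarrow> nsq M (\<lambda>x. f i x - f j x) < e" and n: "n \<ge> N" for e N n
  proof -
    have "AE x in M. ennreal ((f n x - v x)\<^sup>2) = liminf (\<lambda>i. ennreal ((f n x - f (r i) x)\<^sup>2))"
      using conv
    proof eventually_elim
      case (elim x)
      have "(\<lambda>i. ennreal ((f n x - f (r i) x)\<^sup>2)) \<longlonglongrightarrow> ennreal ((f n x - v x)\<^sup>2)"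
        by (intro tendsto_intros elim)
      then show ?case 
        by (subst lim_imp_Liminf) auto
    qed
    then have "(\<integral>\<^sup>+x. ennreal ((f n x - v x)\<^sup>2) \<partial>M) = (\<integral>\<^sup>+x. liminf (\<lambda>i. ennreal ((f n x - f (r i) x)\<^sup>2)) \<partial>M)"
      by (rule nn_integral_cong_AE)
    also have "\<dots> \<le> liminf (\<lambda>i. \<integral>\<^sup>+x. ennreal ((f n x - f (r i) x)\<^sup>2) \<partial>M)"
      by (rule nn_integral_liminf) measurable
    also have "\<dots> \<le> limsup (\<lambda>i. \<integral>\<^sup>+x. ennreal ((f n x - f (r i) x)\<^sup>2) \<partial>M)"
      by (rule Liminf_le_Limsup) simp
    also have "\<dots> \<le> ennreal e"
    proof (rule Limsup_bounded)
      show "\<forall>\<^sub>F i in sequentially. (\<integral>\<^sup>+x. ennreal ((f n x - f (r i) x)\<^sup>2) \<partial>M) \<le> ennreal e"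
        using eventually_ge_at_top[of N]
      proof eventually_elim
        case (elim i)
        have "(\<lambda>x. f n x - f (r i) x) \<in> L2 M" by (intro L2_diff f)
        then have "(\<integral>\<^sup>+x. ennreal ((f n x - f (r i) x)\<^sup>2) \<partial>M) = ennreal (nsq M (\<lambda>x. f n x - f (r i) x))"
          unfolding nsq_real by (intro nn_integral_eq_integral) (auto simp: L2_real)
        also have "\<dots> \<le> ennreal e"
          using N[OF n, of "r i"] elim seq_suble[OF r(1), of i] by (intro ennreal_leI) simp
        finally show ?case .
      qed
    qed
    finally show ?thesis .
  qed
  have fv: "(\<lambda>x. f n x - v x) \<in> L2 M \<and> nsq M (\<lambda>x. f n x - v x) \<le> e"
    if e: "e > 0" and N: "\<And>i j. i \<ge> N \<Longrightarrow> j \<ge> N \<Longrightarrow> nsq M (\<lambda>x. f i x - f j x) < e" and n: "n \<ge> N" for e N n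
  proof -
    have b: "(\<integral>\<^sup>+x. ennreal ((f n x - v x)\<^sup>2) \<partial>M) \<le> ennreal e" by (rule bound[OF that])
    have "integrable M (\<lambda>x. (f n x - v x)\<^sup>2)"
    proof (rule integrableI_bounded)
      have "(\<integral>\<^sup>+x. ennreal (norm ((f n x - v x)\<^sup>2)) \<partial>M) \<le> ennreal e" using b by simp
      then show "(\<integral>\<^sup>+x. ennreal (norm ((f n x - v x)\<^sup>2)) \<partial>M) < \<infinity>"
        using le_less_trans ennreal_less_top by fastforce
    qed simp
    moreover from this have "ennreal (nsq M (\<lambda>x. f n x - v x)) \<le> ennreal e"
      using b unfolding nsq_real by (subst (asm) nn_integral_eq_integral) auto
    ultimately show ?thesis using e by (auto simp: L2_real)
  qed
  obtain N where N: "\<And>i j. i \<ge> N \<Longrightarrow> j \<ge> N \<Longrightarrow> nsq M (\<lambda>x. f i x - f j x) < 1"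
    using cauchy[of 1] by auto
  have "(\<lambda>x. f N x - v x) \<in> L2 M" using fv[of 1 N N] N by simp
  from L2_diff(1)[OF f this, of N] have "(\<lambda>x. f N x - (f N x - v x)) \<in> L2 M" .
  then have "v \<in> L2 M" by simp
  moreover have "(\<lambda>n. nsq M (\<lambda>x. f n x - v x)) \<longlonglongrightarrow> 0"
  proof (rule LIMSEQ_I)
    fix e :: real assume e: "e > 0"
    obtain N where N: "\<And>i j. i \<ge> N \<Longrightarrow> j \<ge> N \<Longrightarrow> nsq M (\<lambda>x. f i x - f j x) < e / 2"
      using cauchy[of "e / 2"] e by auto
    show "\<exists>no. \<forall>n\<ge>no. norm (nsq M (\<lambda>x. f n x - v x) - 0) < e"
    proof (intro exI allI impI)
      fix n assume "n \<ge> N"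
      then show "norm (nsq M (\<lambda>x. f n x - v x) - 0) < e"
        using fv[of "e / 2" N n] N e nsq_nonneg[of M "\<lambda>x. f n x - v x"] by auto
    qed
  qed
  ultimately show ?thesis using that by blast
qed

section \<open>The Sobolev space of the sphere\<close>

abbreviation \<sigma> :: "(real^3) measure" where "\<sigma> \<equiv> area_measure 1"

lemma continuous_L2:
  fixes f :: "real^3 \<Rightarrow> real"
  assumes "continuous_on S2 f" shows "f \<in> L2 \<sigma>"
  unfolding L2_real using assms
  by (auto intro!: continuous_S2_measurable integrable_area_measure continuous_intros)

lemma grad_S2_measurable: "smooth_S2 f \<Longrightarrow> grad_S2 f \<in> borel_measurable \<sigma>"
  using borel_measurable_continuous_on_restrict[OF continuous_on_grad_S2] by (simp cong: measurable_cong_sets)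

lemma grad_S2_L2:
  assumes "smooth_S2 f" shows "grad_S2 f \<in> L2 \<sigma>"
  unfolding L2_def
  using assms by (auto intro!: grad_S2_measurable integrable_area_measure continuous_intros continuous_on_grad_S2)

lemma nsq_grad_S2: "nsq \<sigma> (grad_S2 f) = dirichlet f"
  by (simp add: nsq_def dirichlet_def sint_def power2_norm_eq_inner)

lemma nsq_sint: "nsq \<sigma> (f :: _ \<Rightarrow> real) = sint (\<lambda>x. (f x)\<^sup>2)"
  by (simp add: nsq_real sint_def)

lemma grad_S2_diff:
  assumes "smooth_S2 f" "smooth_S2 g" "x \<in> S2"
  shows "grad_S2 (\<lambda>x. f x - g x) x = grad_S2 f x - grad_S2 g x"
  by (rule grad_S2_eqI)
     (use assms in \<open>auto intro!: derivative_eq_intros smooth_S2_grad simp: algebra_simps smooth_S2_grad(2)\<close>)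

lemma nsq_cong: "(\<And>x. x \<in> S2 \<Longrightarrow> f x = g x) \<Longrightarrow> nsq \<sigma> f = nsq \<sigma> g"
  unfolding nsq_def by (rule Bochner_Integration.integral_cong) auto

lemma nsq_grad_diff:
  "smooth_S2 f \<Longrightarrow> smooth_S2 g \<Longrightarrow> nsq \<sigma> (\<lambda>x. grad_S2 f x - grad_S2 g x) = dirichlet (\<lambda>x. f x - g x)"
  unfolding nsq_grad_S2[symmetric] by (rule nsq_cong) (simp add: grad_S2_diff)

lemma dirichlet_diff_le:
  assumes "smooth_S2 f" "smooth_S2 g"
  shows "dirichlet (\<lambda>x. f x - g x) \<le> 2 * dirichlet f + 2 * dirichlet g"
  using L2_diff(2)[OF assms[THEN grad_S2_L2]] assms by (simp add: nsq_grad_diff nsq_grad_S2)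

lemma dirichlet_diff_expand:
  assumes "smooth_S2 f" "smooth_S2 g"
  shows "dirichlet (\<lambda>x. f x - g x) = dirichlet f + dirichlet g + 2 * sint (\<lambda>x. f x * Lap g x)"
proof -
  have c: "continuous_on S2 (\<lambda>x. grad_S2 f x \<bullet> grad_S2 f x)" "continuous_on S2 (\<lambda>x. grad_S2 g x \<bullet> grad_S2 g x)"
    "continuous_on S2 (\<lambda>x. grad_S2 f x \<bullet> grad_S2 g x)"
    using assms by (auto intro!: smooth_S2_continuous)
  have "dirichlet (\<lambda>x. f x - g x) = sint (\<lambda>x. (grad_S2 f x \<bullet> grad_S2 f x + grad_S2 g x \<bullet> grad_S2 g x)
      - 2 * (grad_S2 f x \<bullet> grad_S2 g x))"
    unfolding dirichlet_def
    by (rule sint_cong) (simp only: grad_S2_diff[OF assms], simp add: inner_diff inner_commute algebra_simps)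
  also have "\<dots> = dirichlet f + dirichlet g - 2 * sint (\<lambda>x. grad_S2 f x \<bullet> grad_S2 g x)"
    by (simp add: sint_diff sint_add sint_cmult continuous_intros c dirichlet_def)
  finally show ?thesis by (simp add: sint_Green[OF assms])
qed

text \<open>
  For a fixed \<open>m\<close> the mixed term of the energy of \<open>g n - g m\<close> is \<open>2 \<integral> g n * Lap (g m)\<close>, which tends to
  zero, so the energy of \<open>g m\<close> is bounded by that of differences far out in the sequence.
\<close>
lemma grad_closable:
  assumes g: "\<And>n. smooth_S2 (g n)" and g0: "(\<lambda>n. sint (\<lambda>x. (g n x)\<^sup>2)) \<longlonglongrightarrow> 0"
    and H: "H \<in> L2 \<sigma>" and gH: "(\<lambda>n. nsq \<sigma> (\<lambda>x. grad_S2 (g n) x - H x)) \<longlonglongrightarrow> 0"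
  shows "nsq \<sigma> H = 0"
proof -
  have D0: "(\<lambda>n. dirichlet (g n)) \<longlonglongrightarrow> 0"
  proof (rule LIMSEQ_I)
    fix e :: real assume e: "e > 0"
    obtain M where M: "\<And>n. n \<ge> M \<Longrightarrow> nsq \<sigma> (\<lambda>x. grad_S2 (g n) x - H x) < e / 8"
    proof -
      have "\<forall>\<^sub>F n in sequentially. nsq \<sigma> (\<lambda>x. grad_S2 (g n) x - H x) < e / 8"
        using e by (intro order_tendstoD(2)[OF gH]) simp
      then show ?thesis using that unfolding eventually_sequentially by blast
    qed
    have "dirichlet (g m) \<le> e / 2" if m: "m \<ge> M" for m
    proof -
      have lim: "(\<lambda>n. sint (\<lambda>x. g n x * Lap (g m) x)) \<longlonglongrightarrow> 0"
      proof -
        have "(\<lambda>n. sqrt (sint (\<lambda>x. (g n x)\<^sup>2) * sint (\<lambda>x. (Lap (g m) x)\<^sup>2))) \<longlonglongrightarrow> sqrt (0 * sint (\<lambda>x. (Lap (g m) x)\<^sup>2))"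
          by (intro tendsto_intros g0)
        then have "(\<lambda>n. sqrt (sint (\<lambda>x. (g n x)\<^sup>2) * sint (\<lambda>x. (Lap (g m) x)\<^sup>2))) \<longlonglongrightarrow> 0" by simp
        then show ?thesis
        proof (rule Lim_null_comparison[rotated])
          have "\<bar>sint (\<lambda>x. g n x * Lap (g m) x)\<bar> \<le> sqrt (sint (\<lambda>x. (g n x)\<^sup>2) * sint (\<lambda>x. (Lap (g m) x)\<^sup>2))" for n
            by (rule real_le_rsqrt, simp only: power2_abs, rule sint_Cauchy_Schwarz)
               (intro smooth_S2_continuous smooth_S2_Lap g)+
          then show "\<forall>\<^sub>F n in sequentially. norm (sint (\<lambda>x. g n x * Lap (g m) x))
              \<le> sqrt (sint (\<lambda>x. (g n x)\<^sup>2) * sint (\<lambda>x. (Lap (g m) x)\<^sup>2))"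
            by simp
        qed
      qed
      have ev: "\<forall>\<^sub>F n in sequentially. dirichlet (g m) \<le> e / 2 - 2 * sint (\<lambda>x. g n x * Lap (g m) x)"
        using eventually_ge_at_top[of M]
      proof eventually_elim
        case (elim n)
        have "dirichlet (\<lambda>x. g n x - g m x) \<le> 2 * nsq \<sigma> (\<lambda>x. grad_S2 (g n) x - H x) + 2 * nsq \<sigma> (\<lambda>x. H x - grad_S2 (g m) x)"
          unfolding nsq_grad_diff[OF g g, symmetric] by (intro nsq_triangle grad_S2_L2 g H)
        also have "\<dots> \<le> e / 2"
          using M[OF elim] M[OF m] nsq_commute[of \<sigma> H "grad_S2 (g m)"] by simp
        finally show ?case
          using dirichlet_diff_expand[OF g g, of n m] dirichlet_nonneg[of "g n"] by linarith
      qed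
      have "(\<lambda>n. e / 2 - 2 * sint (\<lambda>x. g n x * Lap (g m) x)) \<longlonglongrightarrow> e / 2 - 2 * 0"
        by (intro tendsto_intros lim)
      then have "dirichlet (g m) \<le> e / 2 - 2 * 0"
        by (rule tendsto_lowerbound[OF _ ev]) simp
      then show ?thesis by simp
    qed
    then have "norm (dirichlet (g n) - 0) < e" if "n \<ge> M" for n
      using e dirichlet_nonneg[of "g n"] that by fastforce
    then show "\<exists>no. \<forall>n\<ge>no. norm (dirichlet (g n) - 0) < e" by blast
  qed
  have "nsq \<sigma> H \<le> 2 * nsq \<sigma> (\<lambda>x. grad_S2 (g n) x - H x) + 2 * dirichlet (g n)" for n
    using L2_diff(2)[OF grad_S2_L2[OF g] L2_diff(1)[OF grad_S2_L2[OF g] H], of n n]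
    by (simp add: nsq_grad_S2)
  moreover have "(\<lambda>n. 2 * nsq \<sigma> (\<lambda>x. grad_S2 (g n) x - H x) + 2 * dirichlet (g n)) \<longlonglongrightarrow> 2 * 0 + 2 * 0"
    by (intro tendsto_intros gH D0)
  ultimately have "nsq \<sigma> H \<le> 0"
    by (intro LIMSEQ_le_const[of _ 0]) auto
  then show ?thesis using nsq_nonneg[of \<sigma> H] by linarith
qed

lemma is_sobolev_grad_smooth:
  assumes "smooth_S2 f" shows "is_sobolev_grad f (grad_S2 f)"
  unfolding is_sobolev_grad_def
  using assms by (auto intro!: continuous_L2 smooth_S2_continuous grad_S2_L2 exI[of _ "\<lambda>_. f"])

lemma smooth_W12: "smooth_S2 f \<Longrightarrow> f \<in> W12"
  unfolding W12_def using is_sobolev_grad_smooth by blast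

lemma is_sobolev_grad_sobolev_grad: "u \<in> W12 \<Longrightarrow> is_sobolev_grad u (sobolev_grad u)"
  unfolding W12_def sobolev_grad_def by (auto intro: someI[of "is_sobolev_grad u"])

text \<open>\<open>sobolev_grad\<close> is some limit gradient. Closability, applied to
  \<open>h n - f\<close>, shows that it agrees with \<open>grad_S2 f\<close> almost everywhere; this
  makes Sobolev norms of smooth functions computable.\<close>

lemma nsq_sobolev_grad_smooth:
  assumes f: "smooth_S2 f" shows "nsq \<sigma> (sobolev_grad f) = dirichlet f"
proof -
  define G where "G = sobolev_grad f"
  have "is_sobolev_grad f G"
    unfolding G_def by (intro is_sobolev_grad_sobolev_grad smooth_W12 f)
  then obtain h where G: "G \<in> L2 \<sigma>" and h: "\<And>n. smooth_S2 (h n)"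
    and h1: "(\<lambda>n. \<integral>x. (h n x - f x)\<^sup>2 \<partial>\<sigma>) \<longlonglongrightarrow> 0" and h2: "(\<lambda>n. \<integral>x. (norm (grad_S2 (h n) x - G x))\<^sup>2 \<partial>\<sigma>) \<longlonglongrightarrow> 0"
    unfolding is_sobolev_grad_def by blast
  define H where "H x = G x - grad_S2 f x" for x
  have H: "H \<in> L2 \<sigma>" unfolding H_def by (intro L2_diff G grad_S2_L2 f)
  have "nsq \<sigma> (\<lambda>x. grad_S2 (\<lambda>x. h n x - f x) x - H x) = nsq \<sigma> (\<lambda>x. grad_S2 (h n) x - G x)" for n
    by (rule nsq_cong) (simp add: H_def grad_S2_diff h f)
  then have "nsq \<sigma> H = 0"
    using h f H h1 h2 by (intro grad_closable[of "\<lambda>n x. h n x - f x"]) (auto simp: sint_def nsq_def)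
  then have "AE x in \<sigma>. H x = 0" by (rule nsq_zero_AE[OF H])
  then have "nsq \<sigma> G = nsq \<sigma> (grad_S2 f)"
    unfolding nsq_def using G grad_S2_L2[OF f]
    by (intro integral_cong_AE) (auto simp: L2_def H_def)
  then show ?thesis by (simp add: nsq_grad_S2 G_def)
qed

text \<open>In dimension two the factor \<open>1 / r\<close> of the squared gradient cancels against
  the \<open>r\<close> of the area, so only the term of order zero depends on
  \<open>r\<close>.\<close>

lemma W12_norm_square:
  assumes u: "u \<in> W12" and r: "r > 0"
  shows "(W12_norm r u)\<^sup>2 = nsq \<sigma> (sobolev_grad u) + r * nsq \<sigma> u"
proof -
  have "sobolev_grad u \<in> L2 \<sigma>" "u \<in> L2 \<sigma>"
    using is_sobolev_grad_sobolev_grad[OF u] by (auto simp: is_sobolev_grad_def)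
  then have "(\<integral>x. (norm (sobolev_grad u x))\<^sup>2 / r \<partial>area_measure r) = nsq \<sigma> (sobolev_grad u)"
    "(\<integral>x. (u x)\<^sup>2 \<partial>area_measure r) = r * nsq \<sigma> u"
    using r by (subst integral_area_measure; auto simp: L2_def nsq_def cong: measurable_cong_sets)+
  then show ?thesis
    using r nsq_nonneg[of \<sigma> "sobolev_grad u"] nsq_nonneg[of \<sigma> u] by (simp add: W12_norm_def)
qed

lemma W12_norm_nonneg: "r > 0 \<Longrightarrow> 0 \<le> W12_norm r u"
  unfolding W12_norm_def by (intro real_sqrt_ge_zero add_nonneg_nonneg integral_nonneg_AE) auto

lemma W12_norm_smooth:
  assumes "smooth_S2 f" "r > 0"
  shows "(W12_norm r f)\<^sup>2 = dirichlet f + r * sint (\<lambda>x. (f x)\<^sup>2)"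
  using W12_norm_square[OF smooth_W12] assms by (simp add: nsq_sobolev_grad_smooth nsq_sint)

section \<open>Compactness of the Sobolev embedding\<close>

lemma diagonal_convergent:
  fixes a :: "nat \<Rightarrow> nat \<Rightarrow> real"
  assumes bdd: "\<And>i. \<exists>B. \<forall>n. \<bar>a n i\<bar> \<le> B"
  obtains s where "strict_mono (s :: nat \<Rightarrow> nat)" "\<And>i. convergent (\<lambda>n. a (s n) i)"
proof -
  interpret subseqs "\<lambda>i s. convergent (\<lambda>n. a (s n) i)"
  proof
    fix i and s :: "nat \<Rightarrow> nat" assume "strict_mono s"
    obtain B where "\<forall>n. \<bar>a n i\<bar> \<le> B" using bdd by blast
    then have "bounded (range (\<lambda>n. a (s n) i))" by (auto simp: bounded_iff)
    then obtain l r where "strict_mono r" "((\<lambda>n. a (s n) i) \<circ> r) \<longlonglongrightarrow> l"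
      using bounded_imp_convergent_subsequence by blast
    then show "\<exists>r'. strict_mono r' \<and> convergent (\<lambda>n. a ((s \<circ> r') n) i)"
      by (auto simp: comp_def convergent_def)
  qed
  have "convergent (\<lambda>n. a (diagseq n) i)" for i
  proof -
    have "convergent (\<lambda>n. a ((diagseq \<circ> ((+) (Suc i))) n) i)"
    proof (rule diagseq_holds)
      fix r s :: "nat \<Rightarrow> nat" and n assume r: "strict_mono r" and "convergent (\<lambda>k. a (s k) n)"
      then obtain l where "(\<lambda>k. a (s k) n) \<longlonglongrightarrow> l" by (auto simp: convergent_def)
      from LIMSEQ_subseq_LIMSEQ[OF this r] show "convergent (\<lambda>k. a ((s \<circ> r) k) n)"
        by (auto simp: convergent_def comp_def)
    qed
    then have "convergent (\<lambda>n. a (diagseq (n + Suc i)) i)" by (simp add: add.commute)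
    then show ?thesis by (rule convergent_ignore_initial_segment[THEN iffD1])
  qed
  then show ?thesis using that subseq_diagseq by blast
qed

text \<open>
  Rellich: along a subsequence the countably many moments against the features of the kernels
  converge, and \<open>sint_square_le_corr\<close> controls the remainder.
\<close>
lemma Rellich_smooth:
  fixes f :: "nat \<Rightarrow> real^3 \<Rightarrow> real"
  assumes f: "\<And>n. smooth_S2 (f n)" and C: "\<And>n. dirichlet (f n) \<le> C" "\<And>n. nsq \<sigma> (f n) \<le> C"
  obtains s where "strict_mono (s :: nat \<Rightarrow> nat)"
    "\<And>e. e > 0 \<Longrightarrow> \<exists>N. \<forall>i\<ge>N. \<forall>j\<ge>N. nsq \<sigma> (\<lambda>x. f (s i) x - f (s j) x) < e"
proof -
  define A where "A n m k = sint (\<lambda>y. (feat m ! k) y * f n y)" for n m k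
  \<comment> \<open>\<open>prod_decode\<close> enumerates the pairs of a level and a feature; the
    value 0 fills the indices beyond the end of the list.\<close>
  define a where "a n i = (case prod_decode i of (m, k) \<Rightarrow> if k < length (feat m) then A n m k else 0)" for n i
  have cf: "continuous_on S2 (f n)" for n using f smooth_S2_continuous by blast
  have "\<exists>B. \<forall>n. \<bar>a n i\<bar> \<le> B" for i
  proof -
    obtain m k where mk: "prod_decode i = (m, k)" by fastforce
    define B where "B = (if k < length (feat m) then sqrt (sint (\<lambda>y. ((feat m ! k) y)\<^sup>2) * C) else 0)"
    have "\<bar>a n i\<bar> \<le> B" for n
    proof (cases "k < length (feat m)")
      case True
      have "\<bar>A n m k\<bar> \<le> sqrt (sint (\<lambda>y. ((feat m ! k) y)\<^sup>2) * C)"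
      proof (rule real_le_rsqrt)
        have "\<bar>A n m k\<bar>\<^sup>2 \<le> sint (\<lambda>y. ((feat m ! k) y)\<^sup>2) * sint (\<lambda>y. (f n y)\<^sup>2)"
          unfolding A_def power2_abs by (intro sint_Cauchy_Schwarz feat_cont True cf)
        also have "\<dots> \<le> sint (\<lambda>y. ((feat m ! k) y)\<^sup>2) * C"
          using C(2)[of n] by (intro mult_left_mono) (auto simp: nsq_sint intro!: sint_nonneg)
        finally show "\<bar>A n m k\<bar>\<^sup>2 \<le> sint (\<lambda>y. ((feat m ! k) y)\<^sup>2) * C" .
      qed
      then show ?thesis using True by (simp add: a_def mk B_def)
    qed (simp add: a_def mk B_def)
    then show ?thesis by blast
  qed
  then obtain s where s: "strict_mono s" "\<And>i. convergent (\<lambda>n. a (s n) i)"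
    using diagonal_convergent[of a] by metis
  have conv: "convergent (\<lambda>n. A (s n) m k)" if "k < length (feat m)" for m k
    using s(2)[of "prod_encode (m, k)"] that by (simp add: a_def)
  have C0: "C \<ge> 0" using C(1) dirichlet_nonneg order_trans by blast
  have "\<exists>N. \<forall>i\<ge>N. \<forall>j\<ge>N. nsq \<sigma> (\<lambda>x. f (s i) x - f (s j) x) < e" if e: "e > 0" for e
  proof -
    \<comment> \<open>This level makes the remainder, at most \<open>4 * C / (m + 1)\<close>,
      smaller than \<open>e / 2\<close>; only finitely many moments are then left.\<close>
    obtain m :: nat where m: "8 * C / e < real m" using reals_Archimedean2 by blast
    have "4 * C / (real m + 1) < e / 2" using m e C0 by (simp add: field_simps)
    note m = this
    define c where "c = (real m + 1) / (4 * pi)"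
    have c: "c > 0" by (simp add: c_def)
    define l where "l k = lim (\<lambda>n. A (s n) m k)" for k
    define h where "h n = (\<Sum>k<length (feat m). (A (s n) m k - l k)\<^sup>2)" for n
    have "h \<longlonglongrightarrow> (\<Sum>k<length (feat m). (l k - l k)\<^sup>2)"
      unfolding h_def using conv by (intro tendsto_intros) (auto simp: l_def convergent_LIMSEQ_iff)
    then have "h \<longlonglongrightarrow> 0" by simp
    then have "\<forall>\<^sub>F n in sequentially. h n < e / (8 * c)" using e c by (intro order_tendstoD) auto
    then obtain N where N: "\<And>n. n \<ge> N \<Longrightarrow> h n < e / (8 * c)" by (auto simp: eventually_sequentially)
    have "nsq \<sigma> (\<lambda>x. f (s i) x - f (s j) x) < e" if ij: "i \<ge> N" "j \<ge> N" for i j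
    proof -
      let ?u = "\<lambda>x. f (s i) x - f (s j) x"
      have su: "smooth_S2 ?u" using f by blast
      have "nsq \<sigma> ?u \<le> corr m ?u ?u + dirichlet ?u / (real m + 1)"
        unfolding nsq_sint by (rule sint_square_le_corr[OF su])
      also have "dirichlet ?u \<le> 4 * C"
        using dirichlet_diff_le[OF f f, of "s i" "s j"] C(1)[of "s i"] C(1)[of "s j"] by linarith
      also have "corr m ?u ?u \<le> c * (2 * h i + 2 * h j)"
      proof -
        have eq: "sint (\<lambda>y. (feat m ! k) y * ?u y) = A (s i) m k - A (s j) m k" if "k < length (feat m)" for k
        proof -
          have "sint (\<lambda>y. (feat m ! k) y * ?u y) = sint (\<lambda>y. (feat m ! k) y * f (s i) y - (feat m ! k) y * f (s j) y)"
            by (rule sint_cong) (simp add: algebra_simps)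
          then show ?thesis unfolding A_def using that by (simp add: sint_diff continuous_intros feat_cont cf)
        qed
        have "corr m ?u ?u = c * (\<Sum>k<length (feat m). (A (s i) m k - A (s j) m k)\<^sup>2)"
          unfolding corr_eq_feat[OF smooth_S2_continuous[OF su] smooth_S2_continuous[OF su]] c_def
          by (intro arg_cong2[where f="(*)"] refl sum.cong) (simp add: eq power2_eq_square)
        also have "\<dots> \<le> c * (\<Sum>k<length (feat m). 2 * (A (s i) m k - l k)\<^sup>2 + 2 * (A (s j) m k - l k)\<^sup>2)"
        proof (intro mult_left_mono sum_mono)
          fix k
          show "(A (s i) m k - A (s j) m k)\<^sup>2 \<le> 2 * (A (s i) m k - l k)\<^sup>2 + 2 * (A (s j) m k - l k)\<^sup>2"
            using norm_add_square_le[of "A (s i) m k - l k" "l k - A (s j) m k"] by (simp add: power2_commute)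
        qed (use c in auto)
        also have "\<dots> = c * (2 * h i + 2 * h j)"
          by (simp add: h_def sum.distrib sum_distrib_left)
        finally show ?thesis .
      qed
      also have "c * (2 * h i + 2 * h j) \<le> c * (2 * (e / (8 * c)) + 2 * (e / (8 * c)))"
        using N[OF ij(1)] N[OF ij(2)] c by (intro mult_left_mono add_mono) auto
      also have "\<dots> = e / 2" using c by simp
      finally show ?thesis using m by (simp add: divide_right_mono)
    qed
    then show ?thesis by blast
  qed
  then show ?thesis using that s(1) by blast
qed

text \<open>Each \<open>u n\<close> is replaced by a smooth function. The \<open>L\<^sup>2\<close>
  error has to vanish in the limit, whereas a bounded error of the gradient suffices, since
  \<open>Rellich_smooth\<close> asks for energy bounds.\<close>

lemma Rellich_W12:
  fixes u :: "nat \<Rightarrow> real^3 \<Rightarrow> real"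
  assumes r: "r > 0" and u: "\<And>n. u n \<in> W12" "\<And>n. W12_norm r (u n) \<le> C"
  obtains s v where "strict_mono (s :: nat \<Rightarrow> nat)" "v \<in> L2 \<sigma>"
    "(\<lambda>n. nsq \<sigma> (\<lambda>x. u (s n) x - v x)) \<longlonglongrightarrow> 0"
proof -
  define G where "G n = sobolev_grad (u n)" for n
  have G: "is_sobolev_grad (u n) (G n)" for n
    unfolding G_def using u(1) by (rule is_sobolev_grad_sobolev_grad)
  then have L: "u n \<in> L2 \<sigma>" "G n \<in> L2 \<sigma>" for n by (auto simp: is_sobolev_grad_def)
  have "\<exists>h. smooth_S2 h \<and> nsq \<sigma> (\<lambda>x. h x - u n x) < 1 / (real n + 1) \<and> nsq \<sigma> (\<lambda>x. grad_S2 h x - G n x) < 1" for n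
  proof -
    obtain h where h: "\<And>k. smooth_S2 (h k)" and h1: "(\<lambda>k. nsq \<sigma> (\<lambda>x. h k x - u n x)) \<longlonglongrightarrow> 0"
      and h2: "(\<lambda>k. nsq \<sigma> (\<lambda>x. grad_S2 (h k) x - G n x)) \<longlonglongrightarrow> 0"
      using G[of n] unfolding is_sobolev_grad_def nsq_def by auto
    have "\<forall>\<^sub>F k in sequentially. nsq \<sigma> (\<lambda>x. h k x - u n x) < 1 / (real n + 1)"
      by (rule order_tendstoD(2)[OF h1]) simp
    moreover have "\<forall>\<^sub>F k in sequentially. nsq \<sigma> (\<lambda>x. grad_S2 (h k) x - G n x) < 1"
      by (rule order_tendstoD(2)[OF h2]) simp
    ultimately have "\<forall>\<^sub>F k in sequentially. nsq \<sigma> (\<lambda>x. h k x - u n x) < 1 / (real n + 1) \<and> nsq \<sigma> (\<lambda>x. grad_S2 (h k) x - G n x) < 1"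
      by eventually_elim auto
    from eventually_happens'[OF sequentially_bot this] obtain k
      where "nsq \<sigma> (\<lambda>x. h k x - u n x) < 1 / (real n + 1) \<and> nsq \<sigma> (\<lambda>x. grad_S2 (h k) x - G n x) < 1" ..
    then show ?thesis using h[of k] by (intro exI[of _ "h k"]) simp
  qed
  then have "\<forall>n. \<exists>h. smooth_S2 h \<and> nsq \<sigma> (\<lambda>x. h x - u n x) < 1 / (real n + 1) \<and> nsq \<sigma> (\<lambda>x. grad_S2 h x - G n x) < 1"
    by (rule allI)
  from choice[OF this] obtain f where f': "\<forall>n. smooth_S2 (f n) \<and> nsq \<sigma> (\<lambda>x. f n x - u n x) < 1 / (real n + 1)
    \<and> nsq \<sigma> (\<lambda>x. grad_S2 (f n) x - G n x) < 1" ..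
  then have f: "smooth_S2 (f n)" and f1: "nsq \<sigma> (\<lambda>x. f n x - u n x) < 1 / (real n + 1)"
    and f2: "nsq \<sigma> (\<lambda>x. grad_S2 (f n) x - G n x) < 1" for n
    by simp_all
  have bd: "nsq \<sigma> (G n) + r * nsq \<sigma> (u n) \<le> C\<^sup>2" for n
  proof -
    have "(W12_norm r (u n))\<^sup>2 \<le> C\<^sup>2" by (intro power_mono u W12_norm_nonneg r)
    then show ?thesis by (simp add: W12_norm_square[OF u(1) r] G_def)
  qed
  have bG: "nsq \<sigma> (G n) \<le> C\<^sup>2" and bu: "nsq \<sigma> (u n) \<le> C\<^sup>2 / r" for n
  proof -
    show "nsq \<sigma> (G n) \<le> C\<^sup>2" using bd[of n] r nsq_nonneg[of \<sigma> "u n"] mult_nonneg_nonneg[of r "nsq \<sigma> (u n)"] by linarith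
    have "r * nsq \<sigma> (u n) \<le> C\<^sup>2" using bd[of n] nsq_nonneg[of \<sigma> "G n"] by linarith
    then show "nsq \<sigma> (u n) \<le> C\<^sup>2 / r" using r by (simp add: field_simps)
  qed
  define C' where "C' = 2 + 2 * C\<^sup>2 + 2 * (C\<^sup>2 / r)"
  have "0 \<le> C\<^sup>2 / r" "0 \<le> C\<^sup>2" using r by simp_all
  have D: "dirichlet (f n) \<le> C'" for n
  proof -
    have "nsq \<sigma> (grad_S2 (f n)) \<le> 2 * nsq \<sigma> (\<lambda>x. grad_S2 (f n) x - G n x) + 2 * nsq \<sigma> (G n)"
      using L2_add(2)[OF L2_diff(1)[OF grad_S2_L2[OF f] L(2)] L(2), of n n n] by simp
    then show ?thesis
      using f2[of n] bG[of n] \<open>0 \<le> C\<^sup>2 / r\<close> unfolding C'_def nsq_grad_S2 by linarith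
  qed
  have fL: "f n \<in> L2 \<sigma>" for n by (intro continuous_L2 smooth_S2_continuous f)
  have "1 / (real n + 1) \<le> 1" for n by simp
  then have S: "nsq \<sigma> (f n) \<le> C'" for n
  proof -
    have "nsq \<sigma> (f n) \<le> 2 * nsq \<sigma> (\<lambda>x. f n x - u n x) + 2 * nsq \<sigma> (u n)"
      using L2_add(2)[OF L2_diff(1)[OF fL L(1)] L(1), of n n n] by simp
    moreover have "nsq \<sigma> (f n) \<ge> 0" by (rule nsq_nonneg)
    ultimately show ?thesis
      using f1[of n] bu[of n] \<open>0 \<le> C\<^sup>2\<close> \<open>1 / (real n + 1) \<le> 1\<close> unfolding C'_def by linarith
  qed
  obtain s where s: "strict_mono (s :: nat \<Rightarrow> nat)" "\<And>e. e > 0 \<Longrightarrow> \<exists>N. \<forall>i\<ge>N. \<forall>j\<ge>N. nsq \<sigma> (\<lambda>x. f (s i) x - f (s j) x) < e"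
    by (rule Rellich_smooth[of f C', OF f D S]) (rule that)
  obtain v where v: "v \<in> L2 \<sigma>" "(\<lambda>n. nsq \<sigma> (\<lambda>x. f (s n) x - v x)) \<longlonglongrightarrow> 0"
    by (rule L2_complete[OF finite_measure_area_measure, of "\<lambda>n. f (s n)"]) (use fL s(2) in auto)
  have "(\<lambda>n. nsq \<sigma> (\<lambda>x. u (s n) x - v x)) \<longlonglongrightarrow> 0"
  proof (rule tendsto_sandwich)
    show "\<forall>\<^sub>F n in sequentially. 0 \<le> nsq \<sigma> (\<lambda>x. u (s n) x - v x)" by (simp add: nsq_nonneg)
    show "\<forall>\<^sub>F n in sequentially. nsq \<sigma> (\<lambda>x. u (s n) x - v x) \<le> 2 * (1 / (real n + 1)) + 2 * nsq \<sigma> (\<lambda>x. f (s n) x - v x)"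
    proof (rule always_eventually, rule allI)
      fix n
      have "nsq \<sigma> (\<lambda>x. u (s n) x - v x) \<le> 2 * nsq \<sigma> (\<lambda>x. u (s n) x - f (s n) x) + 2 * nsq \<sigma> (\<lambda>x. f (s n) x - v x)"
        by (intro nsq_triangle L fL v)
      also have "nsq \<sigma> (\<lambda>x. u (s n) x - f (s n) x) \<le> 1 / (real (s n) + 1)"
        using f1[of "s n"] nsq_commute[of \<sigma> "u (s n)" "f (s n)"] by simp
      also have "\<dots> \<le> 1 / (real n + 1)"
        using seq_suble[OF s(1), of n] by (simp add: field_simps)
      finally show "nsq \<sigma> (\<lambda>x. u (s n) x - v x) \<le> 2 * (1 / (real n + 1)) + 2 * nsq \<sigma> (\<lambda>x. f (s n) x - v x)" by simp
    qed
    have "(\<lambda>n. 1 / (real n + 1)) \<longlonglongrightarrow> 0" by real_asymp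
    then have "(\<lambda>n. 2 * (1 / (real n + 1)) + 2 * nsq \<sigma> (\<lambda>x. f (s n) x - v x)) \<longlonglongrightarrow> 2 * 0 + 2 * 0"
      by (intro tendsto_intros v)
    then show "(\<lambda>n. 2 * (1 / (real n + 1)) + 2 * nsq \<sigma> (\<lambda>x. f (s n) x - v x)) \<longlonglongrightarrow> 0" by simp
  qed simp
  then show ?thesis using that s(1) v(1) by blast
qed

text \<open>A bounded density is dominated by the area, so the identity itself serves as the compact
  extension, by Rellich's theorem.\<close>

lemma admissible_density:
  assumes r: "r > 0" and w: "continuous_on S2 w" "\<And>x. x \<in> S2 \<Longrightarrow> 0 < w x"
  shows "admissible r (density \<sigma> (\<lambda>x. ennreal (w x)))" (is "admissible r ?\<mu>")
proof -
  obtain K where K: "K > 0" "\<And>x. x \<in> S2 \<Longrightarrow> \<bar>w x\<bar> \<le> K" using continuous_S2_bounded[OF w(1)] by metis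
  have wm [measurable]: "w \<in> borel_measurable \<sigma>" by (rule continuous_S2_measurable[OF _ w(1)]) simp
  have wpos: "AE x in \<sigma>. 0 \<le> w x" by (rule AE_I2) (use w in \<open>auto simp: less_imp_le\<close>)
  have dom: "integrable ?\<mu> (\<lambda>x. (f x)\<^sup>2)" "nsq ?\<mu> f \<le> K * nsq \<sigma> f" if f: "f \<in> L2 \<sigma>" for f :: "real^3 \<Rightarrow> real"
  proof -
    have fm [measurable]: "f \<in> borel_measurable \<sigma>" and i: "integrable \<sigma> (\<lambda>x. (f x)\<^sup>2)"
      using f by (auto simp: L2_real)
    have le: "w x * (f x)\<^sup>2 \<le> K * (f x)\<^sup>2" "0 \<le> w x * (f x)\<^sup>2" if "x \<in> S2" for x
      using K(2)[OF that] w(2)[OF that] by (auto intro: mult_right_mono)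
    have i2: "integrable \<sigma> (\<lambda>x. w x * (f x)\<^sup>2)"
      by (rule Bochner_Integration.integrable_bound[of _ "\<lambda>x. K * (f x)\<^sup>2"])
         (use i le K in \<open>auto intro!: AE_I2 simp: abs_of_nonneg\<close>)
    then show "integrable ?\<mu> (\<lambda>x. (f x)\<^sup>2)"
      by (subst integrable_density) (use wpos in auto)
    have "nsq ?\<mu> f = (\<integral>x. w x * (f x)\<^sup>2 \<partial>\<sigma>)"
      unfolding nsq_real by (subst integral_density) (use wpos in auto)
    also have "\<dots> \<le> (\<integral>x. K * (f x)\<^sup>2 \<partial>\<sigma>)"
      by (intro integral_mono i2) (use i le in auto)
    finally show "nsq ?\<mu> f \<le> K * nsq \<sigma> f" by (simp add: nsq_real)
  qed
  have domL: "f \<in> L2 ?\<mu>" if "f \<in> L2 \<sigma>" for f :: "real^3 \<Rightarrow> real"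
    using dom(1)[OF that] that by (auto simp: L2_real)
  have "compact_extension r ?\<mu> (\<lambda>u. u)"
    unfolding compact_extension_def
  proof (intro conjI ballI allI impI)
    fix u assume "u \<in> W12"
    then show "u \<in> L2 ?\<mu>" by (auto intro!: domL simp: W12_def is_sobolev_grad_def)
  next
    fix u :: "nat \<Rightarrow> real^3 \<Rightarrow> real" and C assume u: "\<forall>n. u n \<in> W12 \<and> W12_norm r (u n) \<le> C"
    obtain s v where s: "strict_mono (s :: nat \<Rightarrow> nat)" and v: "v \<in> L2 \<sigma>"
      and lim: "(\<lambda>n. nsq \<sigma> (\<lambda>x. u (s n) x - v x)) \<longlonglongrightarrow> 0"
      by (rule Rellich_W12[OF r, of u C]) (use u in auto)
    have uL: "u n \<in> L2 \<sigma>" for n using u by (auto simp: W12_def is_sobolev_grad_def)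
    have "(\<lambda>n. nsq ?\<mu> (\<lambda>x. u (s n) x - v x)) \<longlonglongrightarrow> 0"
    proof (rule tendsto_sandwich[of "\<lambda>_. 0" _ _ "\<lambda>n. K * nsq \<sigma> (\<lambda>x. u (s n) x - v x)"])
      show "\<forall>\<^sub>F n in sequentially. nsq ?\<mu> (\<lambda>x. u (s n) x - v x) \<le> K * nsq \<sigma> (\<lambda>x. u (s n) x - v x)"
        by (intro always_eventually allI dom L2_diff uL v)
      show "(\<lambda>n. K * nsq \<sigma> (\<lambda>x. u (s n) x - v x)) \<longlonglongrightarrow> 0"
        using tendsto_mult_left[OF lim, of K] by simp
    qed (simp_all add: nsq_nonneg)
    then show "\<exists>s v. strict_mono (s :: nat \<Rightarrow> nat) \<and> v \<in> L2 ?\<mu> \<and> (\<lambda>n. \<integral>x. (u (s n) x - v x)\<^sup>2 \<partial>?\<mu>) \<longlonglongrightarrow> 0"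
      using s domL[OF v] by (auto simp: nsq_real)
  qed auto
  moreover have fin: "finite_measure ?\<mu>"
  proof (rule finite_measureI)
    have "emeasure ?\<mu> (space ?\<mu>) = (\<integral>\<^sup>+x. ennreal (w x) \<partial>\<sigma>)"
      using sets_borel_S2 by (subst emeasure_density) (auto intro!: nn_integral_cong)
    also have "\<dots> = ennreal (sint w)"
      unfolding sint_def by (rule nn_integral_eq_integral) (use wpos w integrable_area_measure in auto)
    finally show "emeasure ?\<mu> (space ?\<mu>) \<noteq> \<infinity>" by simp
  qed
  moreover have "emeasure ?\<mu> S2 \<noteq> 0"
  proof
    assume 0: "emeasure ?\<mu> S2 = 0"
    have "emeasure ?\<mu> S2 = (\<integral>\<^sup>+x. ennreal (w x) \<partial>\<sigma>)"
      using sets_borel_S2 by (subst emeasure_density) (auto intro!: nn_integral_cong)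
    then have "(\<integral>\<^sup>+x. ennreal (w x) \<partial>\<sigma>) = 0" using 0 by simp
    then have "AE x in \<sigma>. ennreal (w x) = 0" by (subst (asm) nn_integral_0_iff_AE) auto
    then have "AE x in \<sigma>. False"
      using AE_space
    proof eventually_elim
      case (elim x)
      then show False using w(2)[of x] by (simp add: ennreal_eq_0_iff)
    qed
    then have "sint (\<lambda>x. 1) = sint (\<lambda>x. 0)"
      unfolding sint_def by (intro integral_cong_AE) auto
    then show False by (simp add: sint_const)
  qed
  ultimately show ?thesis unfolding admissible_def by auto
qed

section \<open>The first eigenvalue\<close>

lemma nsq_expand:
  fixes f g :: "real^3 \<Rightarrow> real"
  assumes M: "finite_measure M" "sets M = sets borel_S2" and c: "continuous_on S2 f" "continuous_on S2 g"
  shows "nsq M (\<lambda>x. a * f x + b * g x) = a\<^sup>2 * nsq M f + 2 * a * b * (\<integral>x. f x * g x \<partial>M) + b\<^sup>2 * nsq M g"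
proof -
  have i: "integrable M (\<lambda>x. (f x)\<^sup>2)" "integrable M (\<lambda>x. f x * g x)" "integrable M (\<lambda>x. (g x)\<^sup>2)"
    by (intro integrable_continuous_S2 M continuous_intros c)+
  have "nsq M (\<lambda>x. a * f x + b * g x) = (\<integral>x. a\<^sup>2 * (f x)\<^sup>2 + 2 * a * b * (f x * g x) + b\<^sup>2 * (g x)\<^sup>2 \<partial>M)"
    unfolding nsq_real by (rule Bochner_Integration.integral_cong) (auto simp: power2_eq_square algebra_simps)
  then show ?thesis using i by (simp add: nsq_real)
qed

lemma dirichlet_cmult:
  assumes "smooth_S2 f" shows "dirichlet (\<lambda>x. c * f x) = c\<^sup>2 * dirichlet f"
proof -
  have "dirichlet (\<lambda>x. c * f x) = sint (\<lambda>x. c\<^sup>2 * (grad_S2 f x \<bullet> grad_S2 f x))"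
    unfolding dirichlet_def
    by (rule sint_cong) (simp add: assms grad_S2_mult grad_S2_const power2_eq_square)
  then show ?thesis by (simp add: sint_cmult dirichlet_def)
qed

lemma dirichlet_combination_le:
  assumes f: "smooth_S2 f" and h: "smooth_S2 h"
  shows "dirichlet (\<lambda>x. a * f x + b * h x) \<le> 2 * a\<^sup>2 * dirichlet f + 2 * b\<^sup>2 * dirichlet h"
proof -
  have "dirichlet (\<lambda>x. a * f x - (- b) * h x) \<le> 2 * dirichlet (\<lambda>x. a * f x) + 2 * dirichlet (\<lambda>x. (- b) * h x)"
    by (intro dirichlet_diff_le smooth_S2_cmult f h)
  also have "\<dots> = 2 * a\<^sup>2 * dirichlet f + 2 * b\<^sup>2 * dirichlet h"
    using dirichlet_cmult[OF f, of a] dirichlet_cmult[OF h, of "- b"] by simp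
  finally show ?thesis by simp
qed

lemma rayleigh_smooth:
  assumes "smooth_S2 f" "r > 0"
  shows "rayleigh r M f = dirichlet f / nsq M f"
proof -
  have m: "(\<lambda>x. (norm (grad_S2 f x))\<^sup>2 / r) \<in> borel_measurable borel_S2"
    using grad_S2_measurable[OF assms(1)] by (simp cong: measurable_cong_sets)
  have "(\<integral>x. (norm (grad_S2 f x))\<^sup>2 / r \<partial>area_measure r) = nsq \<sigma> (grad_S2 f)"
    using assms(2) by (subst integral_area_measure[OF _ m]) (auto simp: nsq_def)
  then show ?thesis by (simp add: rayleigh_def nsq_grad_S2 nsq_real)
qed

text \<open>Linear independence in \<open>L\<^sup>2\<close> makes the Gram matrix positive definite,
  and this bounds the Rayleigh quotients on \<open>E\<close>: without such a bound the
  \<open>SUP\<close> in \<open>lambda1\<close> would have no meaning.\<close>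

lemma two_dim_subspaceE:
  assumes M: "finite_measure M" "sets M = sets borel_S2" and r: "r > 0" and E: "two_dim_subspace M E"
  obtains f h where "smooth_S2 f" "smooth_S2 h" "E = {\<lambda>x. a * f x + b * h x | a b. True}"
    "\<And>a b. (a, b) \<noteq> (0, 0) \<Longrightarrow> (\<lambda>x. a * f x + b * h x) \<in> E - {\<lambda>x. 0}"
    "\<And>g. g \<in> E - {\<lambda>x. 0} \<Longrightarrow> smooth_S2 g \<and> nsq M g > 0"
    "bdd_above (rayleigh r M ` (E - {\<lambda>x. 0}))"
proof -
  obtain f h where f: "smooth_S2 f" and h: "smooth_S2 h" and EE: "E = {\<lambda>x. a * f x + b * h x | a b. True}"
    and ind: "\<And>a b. (AE x in M. a * f x + b * h x = 0) \<Longrightarrow> a = 0 \<and> b = 0"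
    using E unfolding two_dim_subspace_def by blast
  define A B C where "A = nsq M f" and "B = (\<integral>x. f x * h x \<partial>M)" and "C = nsq M h"
  let ?g = "\<lambda>a b x. a * f x + b * h x"
  have sg: "smooth_S2 (?g a b)" for a b by (intro smooth_S2_add smooth_S2_cmult f h)
  have N: "nsq M (?g a b) = a\<^sup>2 * A + 2 * a * b * B + b\<^sup>2 * C" for a b
    unfolding A_def B_def C_def by (intro nsq_expand M smooth_S2_continuous f h)
  have gL: "?g a b \<in> L2 M" for a b
    unfolding L2_real
    by (intro conjI continuous_S2_measurable integrable_continuous_S2 M continuous_intros smooth_S2_continuous f h)
  have Npos: "nsq M (?g a b) > 0" if "(a, b) \<noteq> (0, 0)" for a b
  proof (rule ccontr)
    assume "\<not> nsq M (?g a b) > 0"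
    then have "nsq M (?g a b) = 0" using nsq_nonneg[of M "?g a b"] by linarith
    then have "AE x in M. ?g a b x = 0" by (rule nsq_zero_AE[OF gL])
    then show False using ind[of a b] that by simp
  qed
  have A: "A > 0" using Npos[of 1 0] by (simp add: A_def)
  define \<Delta> where "\<Delta> = A * C - B\<^sup>2"
  \<comment> \<open>The combination orthogonal to \<open>f\<close>; its squared norm is
    \<open>A\<close> times the Gram determinant.\<close>
  have "0 < nsq M (?g (- B) A)" by (rule Npos) (use A in simp)
  also have "\<dots> = A * \<Delta>" unfolding N \<Delta>_def by (simp add: power2_eq_square algebra_simps)
  finally have "0 < A * \<Delta>" .
  then have \<Delta>: "\<Delta> > 0" using A by (simp add: zero_less_mult_iff)
  have C0: "C \<ge> 0" unfolding C_def by (rule nsq_nonneg)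
  \<comment> \<open>Cayley-Hamilton for the Gram matrix \<open>G\<close>: the trace times
    \<open>G\<close> minus the determinant equals \<open>G\<^sup>2\<close>, which is
    nonnegative.\<close>
  have lower: "\<Delta> * (a\<^sup>2 + b\<^sup>2) \<le> (A + C) * nsq M (?g a b)" for a b
  proof -
    have "(A + C) * nsq M (?g a b) - \<Delta> * (a\<^sup>2 + b\<^sup>2) = (a * A + b * B)\<^sup>2 + (a * B + b * C)\<^sup>2"
      unfolding N \<Delta>_def by (simp add: power2_eq_square algebra_simps)
    also have "\<dots> \<ge> 0" by simp
    finally show ?thesis by linarith
  qed
  define K where "K = 2 * (dirichlet f + dirichlet h)"
  have K: "K \<ge> 0" using dirichlet_nonneg[of f] dirichlet_nonneg[of h] by (simp add: K_def)
  have upper: "dirichlet (?g a b) \<le> K * (a\<^sup>2 + b\<^sup>2)" for a b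
  proof -
    have "0 \<le> a\<^sup>2 * dirichlet h" "0 \<le> b\<^sup>2 * dirichlet f" by (simp_all add: dirichlet_nonneg)
    then show ?thesis using dirichlet_combination_le[OF f h, of a b] by (simp add: K_def algebra_simps)
  qed
  have nz: "\<exists>a b. g = ?g a b \<and> (a, b) \<noteq> (0, 0)" if gE: "g \<in> E - {\<lambda>x. 0}" for g
  proof -
    from gE have "g \<in> {\<lambda>x. a * f x + b * h x | a b. True}" unfolding EE by simp
    then obtain a b where g: "g = ?g a b" by blast
    have "(a, b) \<noteq> (0, 0)"
    proof
      assume "(a, b) = (0, 0)"
      then show False using gE g by simp
    qed
    then show ?thesis using g by blast
  qed
  have "rayleigh r M g \<le> K * (A + C) / \<Delta>" if "g \<in> E - {\<lambda>x. 0}" for g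
  proof -
    from nz[OF that] obtain a b where g: "g = ?g a b" "(a, b) \<noteq> (0, 0)" by blast
    have "dirichlet g * \<Delta> \<le> K * ((a\<^sup>2 + b\<^sup>2) * \<Delta>)"
      using upper[of a b] \<Delta> by (simp add: g mult.assoc[symmetric])
    also have "\<dots> \<le> K * ((A + C) * nsq M g)"
      using lower[of a b] K by (intro mult_left_mono) (auto simp: g mult.commute)
    finally have "dirichlet g / nsq M g \<le> K * (A + C) / \<Delta>"
      using Npos[OF g(2)] \<Delta> by (simp add: g(1)[symmetric] field_simps)
    then show ?thesis using sg r by (simp add: g rayleigh_smooth)
  qed
  then have "bdd_above (rayleigh r M ` (E - {\<lambda>x. 0}))" by (intro bdd_aboveI2)
  moreover have "?g a b \<in> E - {\<lambda>x. 0}" if "(a, b) \<noteq> (0, 0)" for a b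
  proof -
    have "?g a b \<noteq> (\<lambda>x. 0)"
    proof
      assume *: "?g a b = (\<lambda>x. 0)"
      show False using Npos[OF that] unfolding * by (simp add: nsq_def)
    qed
    then show ?thesis unfolding EE by blast
  qed
  moreover have "smooth_S2 g \<and> nsq M g > 0" if "g \<in> E - {\<lambda>x. 0}" for g
  proof -
    from nz[OF that] obtain a b where g: "g = ?g a b" "(a, b) \<noteq> (0, 0)" by blast
    then show ?thesis using Npos sg by simp
  qed
  ultimately show ?thesis using that[OF f h EE] by blast
qed

text \<open>One linear condition still leaves a nonzero element of any two-dimensional space. The
  condition is mean value zero for the area, not for \<open>M\<close>, so that the spectral gap of
  the round sphere applies to the test function. \<open>E0\<close> keeps the infimum from ranging
  over the empty set.\<close>

lemma lambda1_ge:
  assumes M: "finite_measure M" "sets M = sets borel_S2" and r: "r > 0"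
    and ex: "two_dim_subspace M E0"
    and B: "\<And>f. smooth_S2 f \<Longrightarrow> sint f = 0 \<Longrightarrow> B * nsq M f \<le> dirichlet f"
  shows "B \<le> lambda1 r M"
  unfolding lambda1_def
proof (rule cINF_greatest)
  show "Collect (two_dim_subspace M) \<noteq> {}" using ex by blast
  fix E assume "E \<in> Collect (two_dim_subspace M)"
  then have E: "two_dim_subspace M E" by simp
  show "B \<le> (SUP f\<in>E - {\<lambda>x. 0}. rayleigh r M f)"
  proof (rule two_dim_subspaceE[OF M r E])
    fix f h assume f: "smooth_S2 f" and h: "smooth_S2 h"
      and ne: "\<And>a b. (a, b) \<noteq> (0, 0) \<Longrightarrow> (\<lambda>x. a * f x + b * h x) \<in> E - {\<lambda>x. 0}"
      and pos: "\<And>g. g \<in> E - {\<lambda>x. 0} \<Longrightarrow> smooth_S2 g \<and> nsq M g > 0"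
      and bdd: "bdd_above (rayleigh r M ` (E - {\<lambda>x. 0}))"
    have s: "sint (\<lambda>x. a * f x + b * h x) = a * sint f + b * sint h" for a b
      by (simp add: sint_add sint_cmult continuous_intros smooth_S2_continuous f h)
    obtain a b where ab: "(a, b) \<noteq> (0, 0)" "a * sint f + b * sint h = 0"
    proof (cases "sint f = 0 \<and> sint h = 0")
      case True
      then show ?thesis using that[of 1 0] by simp
    next
      case False
      then show ?thesis using that[of "sint h" "- sint f"] by auto
    qed
    let ?g = "\<lambda>x. a * f x + b * h x"
    have g: "?g \<in> E - {\<lambda>x. 0}" by (rule ne[OF ab(1)])
    have "B * nsq M ?g \<le> dirichlet ?g" using B[of ?g] pos[OF g] s ab(2) by simp
    then have "B \<le> rayleigh r M ?g"
      using pos[OF g] r by (simp add: rayleigh_smooth pos_le_divide_eq)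
    also have "\<dots> \<le> (SUP f\<in>E - {\<lambda>x. 0}. rayleigh r M f)" by (rule cSUP_upper[OF g bdd])
    finally show ?thesis .
  qed
qed

lemma rayleigh_nonneg: "smooth_S2 f \<Longrightarrow> r > 0 \<Longrightarrow> 0 \<le> rayleigh r M f"
  by (simp add: rayleigh_smooth dirichlet_nonneg nsq_nonneg)

lemma two_dim_sup_nonneg:
  assumes M: "finite_measure M" "sets M = sets borel_S2" and r: "r > 0" and E: "two_dim_subspace M E"
  shows "0 \<le> (SUP f\<in>E - {\<lambda>x. 0}. rayleigh r M f)"
proof (rule two_dim_subspaceE[OF M r E])
  fix f h assume *: "\<And>a b. (a, b) \<noteq> (0, 0) \<Longrightarrow> (\<lambda>x. a * f x + b * h x) \<in> E - {\<lambda>x. 0}"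
    "\<And>g. g \<in> E - {\<lambda>x. 0} \<Longrightarrow> smooth_S2 g \<and> nsq M g > 0"
    "bdd_above (rayleigh r M ` (E - {\<lambda>x. 0}))"
  have g: "(\<lambda>x. 1 * f x + 0 * h x) \<in> E - {\<lambda>x. 0}" by (rule *(1)) simp
  have "0 \<le> rayleigh r M (\<lambda>x. 1 * f x + 0 * h x)"
    using *(2)[OF g] r by (intro rayleigh_nonneg) auto
  also have "\<dots> \<le> (SUP f\<in>E - {\<lambda>x. 0}. rayleigh r M f)" by (rule cSUP_upper[OF g *(3)])
  finally show ?thesis .
qed

text \<open>The infimum lies below each of its members because the suprema are nonnegative, hence
  bounded below.\<close>

lemma lambda1_le:
  assumes M: "finite_measure M" "sets M = sets borel_S2" and r: "r > 0"
    and E: "two_dim_subspace M E"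
    and B: "\<And>f. f \<in> E - {\<lambda>x. 0} \<Longrightarrow> rayleigh r M f \<le> B"
  shows "lambda1 r M \<le> B"
proof -
  have "lambda1 r M \<le> (SUP f\<in>E - {\<lambda>x. 0}. rayleigh r M f)"
    unfolding lambda1_def
    by (rule cINF_lower) (use E two_dim_sup_nonneg[OF M r] in \<open>auto intro!: bdd_belowI2[of _ 0]\<close>)
  also have "\<dots> \<le> B"
  proof (rule cSUP_least)
    show "E - {\<lambda>x. 0} \<noteq> {}"
    proof (rule two_dim_subspaceE[OF M r E])
      fix f h assume "\<And>a b. (a, b) \<noteq> (0, 0) \<Longrightarrow> (\<lambda>x. a * f x + b * h x) \<in> E - {\<lambda>x. 0}"
      from this[of 1 0] show ?thesis by auto
    qed
  qed (rule B)
  finally show ?thesis .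
qed

text \<open>Measures with the same null sets have the same competing spaces. This serves to rescale
  the perturbed measure to \<open>lambda1 = 2\<close>.\<close>

lemma lambda1_scale:
  assumes M: "finite_measure M" "sets M = sets borel_S2" and r: "r > 0" and s: "s > 0"
    and ex: "two_dim_subspace M E0"
    and AE: "\<And>P. (AE x in M'. P x) \<longleftrightarrow> (AE x in M. P x)"
    and N: "\<And>f. smooth_S2 f \<Longrightarrow> nsq M' f = s * nsq M f"
  shows "lambda1 r M' = lambda1 r M / s"
proof -
  have T: "two_dim_subspace M' = two_dim_subspace M"
    by (auto simp: two_dim_subspace_def AE)
  have m: "mono (\<lambda>x::real. x / s)" using s by (auto simp: mono_def divide_right_mono)
  have S: "(SUP f\<in>E - {\<lambda>x. 0}. rayleigh r M' f) = (SUP f\<in>E - {\<lambda>x. 0}. rayleigh r M f) / s"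
    if E: "two_dim_subspace M E" for E
  proof (rule two_dim_subspaceE[OF M r E])
    fix f h assume *: "\<And>a b. (a, b) \<noteq> (0, 0) \<Longrightarrow> (\<lambda>x. a * f x + b * h x) \<in> E - {\<lambda>x. 0}"
      "\<And>g. g \<in> E - {\<lambda>x. 0} \<Longrightarrow> smooth_S2 g \<and> nsq M g > 0"
      "bdd_above (rayleigh r M ` (E - {\<lambda>x. 0}))"
    have ne: "E - {\<lambda>x. 0} \<noteq> {}" using *(1)[of 1 0] by auto
    have "(SUP f\<in>E - {\<lambda>x. 0}. rayleigh r M f) / s = (SUP y\<in>rayleigh r M ` (E - {\<lambda>x. 0}). y / s)"
      by (rule continuous_at_Sup_mono[OF m]) (use s ne *(3) in \<open>auto intro!: continuous_intros\<close>)
    also have "\<dots> = (SUP f\<in>E - {\<lambda>x. 0}. rayleigh r M f / s)" by (simp add: image_image)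
    also have "\<dots> = (SUP f\<in>E - {\<lambda>x. 0}. rayleigh r M' f)"
      by (rule SUP_cong) (use *(2) N r in \<open>auto simp: rayleigh_smooth field_simps\<close>)
    finally show ?thesis by simp
  qed
  have "lambda1 r M / s = (INF y\<in>(\<lambda>E. SUP f\<in>E - {\<lambda>x. 0}. rayleigh r M f) ` Collect (two_dim_subspace M). y / s)"
    unfolding lambda1_def
    by (rule continuous_at_Inf_mono[OF m])
       (use s ex two_dim_sup_nonneg[OF M r] in \<open>auto intro!: continuous_intros bdd_belowI2[of _ 0]\<close>)
  also have "\<dots> = lambda1 r M'"
    unfolding lambda1_def image_image T by (rule INF_cong) (use S in auto)
  finally show ?thesis by simp
qed

section \<open>The dual norm\<close>

lemma W12_norm_cmult:
  assumes "smooth_S2 f" "r > 0"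
  shows "W12_norm r (\<lambda>x. c * f x) = \<bar>c\<bar> * W12_norm r f"
proof -
  have "(W12_norm r (\<lambda>x. c * f x))\<^sup>2 = (\<bar>c\<bar> * W12_norm r f)\<^sup>2"
    using assms
    by (simp add: W12_norm_smooth smooth_S2_cmult power_mult_distrib dirichlet_cmult sint_cmult algebra_simps)
  then show ?thesis
    by (rule power2_eq_imp_eq) (use W12_norm_nonneg[OF assms(2)] in auto)
qed

text \<open>Any bound \<open>K\<close>, however large, makes the set in
  \<open>Wm12_norm_diff\<close> bounded above, so that its \<open>Sup\<close> is a true supremum;
  the absolute value comes from replacing \<open>f\<close> by its negative.\<close>

lemma Wm12_norm_diff_bound:
  assumes r: "r > 0" and K: "\<And>f. smooth_S2 f \<Longrightarrow> \<bar>(\<integral>x. f x \<partial>M) - (\<integral>x. f x \<partial>N)\<bar> \<le> K * W12_norm r f"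
  shows "0 \<le> Wm12_norm_diff r M N"
    "smooth_S2 f \<Longrightarrow> \<bar>(\<integral>x. f x \<partial>M) - (\<integral>x. f x \<partial>N)\<bar> \<le> Wm12_norm_diff r M N * W12_norm r f"
proof -
  define l where "l f = (\<integral>x. f x \<partial>M) - (\<integral>x. f x \<partial>N)" for f :: "real^3 \<Rightarrow> real"
  have lc: "l (\<lambda>x. c * f x) = c * l f" for c f by (simp add: l_def right_diff_distrib)
  define S where "S = {l f | f. smooth_S2 f \<and> W12_norm r f = 1}"
  have Wm: "Wm12_norm_diff r M N = Sup S" by (simp add: Wm12_norm_diff_def S_def l_def)
  have bdd: "bdd_above S"
    by (rule bdd_aboveI[of _ K]) (use K in \<open>fastforce simp: S_def l_def\<close>)
  have up: "l f \<le> Sup S * W12_norm r f" if f: "smooth_S2 f" and n: "W12_norm r f > 0" for f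
  proof -
    define c where "c = 1 / W12_norm r f"
    have "W12_norm r (\<lambda>x. c * f x) = \<bar>c\<bar> * W12_norm r f" by (rule W12_norm_cmult[OF f r])
    also have "\<dots> = 1" using n by (simp add: c_def)
    finally have "l (\<lambda>x. c * f x) \<in> S"
      unfolding S_def using smooth_S2_cmult[OF f, of c] by blast
    then have "c * l f \<le> Sup S" unfolding lc[symmetric] by (intro cSup_upper bdd)
    then show ?thesis using n by (simp add: c_def field_simps)
  qed
  have ab: "\<bar>l f\<bar> \<le> Sup S * W12_norm r f" if f: "smooth_S2 f" for f
  proof (cases "W12_norm r f = 0")
    case True
    then show ?thesis using K[OF f] by (simp add: l_def)
  next
    case False
    then have n: "W12_norm r f > 0" using W12_norm_nonneg[OF r, of f] by simp
    have "W12_norm r (\<lambda>x. -1 * f x) = W12_norm r f" by (subst W12_norm_cmult[OF f r]) simp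
    then have "l (\<lambda>x. -1 * f x) \<le> Sup S * W12_norm r f"
      using up[of "\<lambda>x. -1 * f x"] f n by (simp add: smooth_S2_uminus)
    then show ?thesis using up[OF f n] lc[of "-1" f] by simp
  qed
  \<comment> \<open>A constant is a test function of positive norm, which forces the supremum to be
    nonnegative.\<close>
  have "(W12_norm r (\<lambda>x. 1))\<^sup>2 = dirichlet (\<lambda>x. 1) + r * (4 * pi)"
    using r by (simp add: W12_norm_smooth sint_const)
  then have "(W12_norm r (\<lambda>x. 1))\<^sup>2 > 0" using r dirichlet_nonneg[of "\<lambda>x. 1"] by (simp add: add_nonneg_pos)
  then have "W12_norm r (\<lambda>x. 1) > 0" using W12_norm_nonneg[OF r, of "\<lambda>x. 1"] by (simp add: zero_less_power2)
  then show "0 \<le> Wm12_norm_diff r M N"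
  proof -
    have "0 \<le> Sup S * W12_norm r (\<lambda>x. 1)" using ab[OF smooth_S2_const, of 1] by linarith
    then show ?thesis using \<open>W12_norm r (\<lambda>x. 1) > 0\<close> by (simp add: Wm zero_le_mult_iff)
  qed
  show "\<bar>(\<integral>x. f x \<partial>M) - (\<integral>x. f x \<partial>N)\<bar> \<le> Wm12_norm_diff r M N * W12_norm r f" if "smooth_S2 f"
    using ab[OF that] by (simp add: Wm l_def)
qed

section \<open>The lower bound for the first eigenvalue\<close>

text \<open>Moments come from \<open>sint_Lap\<close>: on the sphere the Laplacian of a homogeneous
  polynomial is a multiple of it plus terms of lower degree, and the whole has integral
  zero.\<close>

lemma sint_inner: "sint (\<lambda>x. a \<bullet> x) = 0"
proof -
  have "0 = sint (Lap (\<lambda>x. a \<bullet> x))" by (rule sint_Lap[symmetric]) simp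
  also have "\<dots> = sint (\<lambda>x. (- 2) * (a \<bullet> x))" by (rule sint_cong) (simp add: Lap_inner)
  finally have "0 = (- 2) * sint (\<lambda>x. a \<bullet> x)" by (simp only: sint_cmult)
  then show ?thesis by simp
qed

lemma grad_S2_inner_inner:
  "x \<in> S2 \<Longrightarrow> grad_S2 (\<lambda>x. a \<bullet> x) x \<bullet> grad_S2 (\<lambda>x. b \<bullet> x) x = a \<bullet> b - (a \<bullet> x) * (b \<bullet> x)"
  by (simp only: grad_S2_inner)
     (simp add: inner_diff_left inner_diff_right inner_commute dot_square_norm algebra_simps)

lemma Lap_inner_inner:
  assumes "x \<in> S2"
  shows "Lap (\<lambda>x. (a \<bullet> x) * (b \<bullet> x)) x = 2 * (a \<bullet> b) - 6 * ((a \<bullet> x) * (b \<bullet> x))"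
  by (subst Lap_mult) (use assms in \<open>simp_all add: Lap_inner grad_S2_inner_inner\<close>)

lemma sint_inner_inner: "sint (\<lambda>x. (a \<bullet> x) * (b \<bullet> x)) = 4 * pi / 3 * (a \<bullet> b)"
proof -
  have "0 = sint (Lap (\<lambda>x. (a \<bullet> x) * (b \<bullet> x)))" by (rule sint_Lap[symmetric]) (intro smooth_S2_mult smooth_S2_inner)
  also have "\<dots> = sint (\<lambda>x. 2 * (a \<bullet> b) - 6 * ((a \<bullet> x) * (b \<bullet> x)))" by (rule sint_cong) (simp add: Lap_inner_inner)
  also have "\<dots> = 4 * pi * (2 * (a \<bullet> b)) - 6 * sint (\<lambda>x. (a \<bullet> x) * (b \<bullet> x))"
    by (subst sint_diff) (auto simp: sint_const sint_cmult intro!: continuous_intros)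
  finally show ?thesis by simp
qed

lemma nsq_inner: "nsq \<sigma> (\<lambda>x. a \<bullet> x) = 4 * pi / 3 * (a \<bullet> a)"
  unfolding nsq_sint power2_eq_square by (rule sint_inner_inner)

lemma dirichlet_inner: "dirichlet (\<lambda>x. a \<bullet> x) = 8 * pi / 3 * (a \<bullet> a)"
proof -
  have "dirichlet (\<lambda>x. a \<bullet> x) = - sint (\<lambda>x. (a \<bullet> x) * Lap (\<lambda>x. a \<bullet> x) x)" by (rule dirichlet_Green) simp
  also have "sint (\<lambda>x. (a \<bullet> x) * Lap (\<lambda>x. a \<bullet> x) x) = sint (\<lambda>x. (- 2) * ((a \<bullet> x) * (a \<bullet> x)))"
    by (rule sint_cong) (simp add: Lap_inner)
  finally show ?thesis by (simp only: sint_cmult sint_inner_inner)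
qed

text \<open>Orthogonal projection to the linear functions. \<open>kern 1\<close> is a polynomial of
  degree one, so the averages of the remainder at level 1 vanish and its gap is
  \<open>(1 + 1) * (1 + 2) = 6\<close>.\<close>

lemma linear_part:
  assumes f: "smooth_S2 f" and f0: "sint f = 0"
  obtains a h where "smooth_S2 h" "\<And>x. f x = a \<bullet> x + h x" "sint (\<lambda>x. (a \<bullet> x) * h x) = 0"
    "6 * nsq \<sigma> h \<le> dirichlet h" "dirichlet f = 8 * pi / 3 * (a \<bullet> a) + dirichlet h"
proof -
  \<comment> \<open>\<open>4 * pi / 3\<close> is the squared norm of a coordinate function.\<close>
  define a where "a = (3 / (4 * pi)) *\<^sub>R (\<chi> i. sint (\<lambda>x. f x * x $ i))"
  have cf: "continuous_on S2 f" by (rule smooth_S2_continuous[OF f])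
  have fb: "sint (\<lambda>x. f x * (b \<bullet> x)) = 4 * pi / 3 * (a \<bullet> b)" for b
  proof -
    have "sint (\<lambda>x. f x * (b \<bullet> x)) = sint (\<lambda>x. \<Sum>i\<in>UNIV. b $ i * (f x * x $ i))"
      by (rule sint_cong) (simp add: inner_vec_def sum_distrib_left mult_ac)
    also have "\<dots> = (\<Sum>i\<in>UNIV. b $ i * sint (\<lambda>x. f x * x $ i))"
      by (subst sint_sum) (auto simp: sint_cmult intro!: continuous_intros cf)
    also have "\<dots> = 4 * pi / 3 * (a \<bullet> b)"
      by (simp add: a_def inner_vec_def sum_distrib_left mult_ac)
    finally show ?thesis .
  qed
  define h where "h x = f x - a \<bullet> x" for x
  have h: "smooth_S2 h" unfolding h_def by (intro smooth_S2_diff f smooth_S2_inner)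
  have ch: "continuous_on S2 h" by (rule smooth_S2_continuous[OF h])
  have hb: "sint (\<lambda>x. (b \<bullet> x) * h x) = 0" for b
  proof -
    have "sint (\<lambda>x. (b \<bullet> x) * h x) = sint (\<lambda>x. f x * (b \<bullet> x) - (a \<bullet> x) * (b \<bullet> x))"
      by (rule sint_cong) (simp add: h_def algebra_simps)
    also have "\<dots> = 0"
      by (subst sint_diff) (auto simp: fb sint_inner_inner intro!: continuous_intros cf)
    finally show ?thesis .
  qed
  have h0: "sint h = 0"
    unfolding h_def by (subst sint_diff) (auto simp: f0 sint_inner intro!: continuous_intros cf)
  have "avg 1 h x = 0" for x
  proof -
    have "sint (\<lambda>y. kern 1 x y * h y) = sint (\<lambda>y. (1 / 2) * h y + (1 / 2) * ((x \<bullet> y) * h y))"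
      by (rule sint_cong) (simp add: kern_def field_simps)
    also have "\<dots> = (1 / 2) * sint h + (1 / 2) * sint (\<lambda>y. (x \<bullet> y) * h y)"
      by (subst sint_add) (auto simp only: sint_cmult intro!: continuous_intros ch)
    finally show ?thesis by (simp add: avg_def h0 hb)
  qed
  then have gap: "6 * nsq \<sigma> h \<le> dirichlet h"
    using spectral_gap[OF h, of 1] by (simp add: nsq_sint)
  have "dirichlet h = dirichlet f + dirichlet (\<lambda>x. a \<bullet> x) + 2 * sint (\<lambda>x. f x * Lap (\<lambda>x. a \<bullet> x) x)"
    unfolding h_def by (intro dirichlet_diff_expand f smooth_S2_inner)
  also have "sint (\<lambda>x. f x * Lap (\<lambda>x. a \<bullet> x) x) = sint (\<lambda>x. (- 2) * (f x * (a \<bullet> x)))"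
    by (rule sint_cong) (simp add: Lap_inner)
  also have "\<dots> = (- 2) * (4 * pi / 3 * (a \<bullet> a))" by (simp only: sint_cmult fb)
  finally have "dirichlet f = 8 * pi / 3 * (a \<bullet> a) + dirichlet h"
    by (simp add: dirichlet_inner)
  then show ?thesis using that[OF h _ hb gap] by (simp add: h_def)
qed

lemma dirichlet_mult_le:
  assumes f: "smooth_S2 f" and h: "smooth_S2 h"
    and K: "\<And>x. x \<in> S2 \<Longrightarrow> (f x)\<^sup>2 \<le> K" "\<And>x. x \<in> S2 \<Longrightarrow> grad_S2 f x \<bullet> grad_S2 f x \<le> K"
  shows "dirichlet (\<lambda>x. f x * h x) \<le> 2 * K * dirichlet h + 2 * K * nsq \<sigma> h"
proof -
  have "dirichlet (\<lambda>x. f x * h x) \<le> sint (\<lambda>x. 2 * K * (grad_S2 h x \<bullet> grad_S2 h x) + 2 * K * (h x)\<^sup>2)"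
    unfolding dirichlet_def
  proof (rule sint_mono)
    fix x assume x: "x \<in> S2"
    have "grad_S2 (\<lambda>x. f x * h x) x \<bullet> grad_S2 (\<lambda>x. f x * h x) x = (norm (f x *\<^sub>R grad_S2 h x + h x *\<^sub>R grad_S2 f x))\<^sup>2"
      by (simp add: grad_S2_mult[OF f h x] power2_norm_eq_inner)
    also have "\<dots> \<le> 2 * (norm (f x *\<^sub>R grad_S2 h x))\<^sup>2 + 2 * (norm (h x *\<^sub>R grad_S2 f x))\<^sup>2"
      by (rule norm_add_square_le)
    also have "\<dots> = 2 * ((f x)\<^sup>2 * (grad_S2 h x \<bullet> grad_S2 h x)) + 2 * ((grad_S2 f x \<bullet> grad_S2 f x) * (h x)\<^sup>2)"
      by (simp add: power_mult_distrib power2_norm_eq_inner[symmetric])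
    also have "\<dots> \<le> 2 * (K * (grad_S2 h x \<bullet> grad_S2 h x)) + 2 * (K * (h x)\<^sup>2)"
      using K[OF x] by (intro add_mono mult_left_mono mult_right_mono) auto
    finally show "grad_S2 (\<lambda>x. f x * h x) x \<bullet> grad_S2 (\<lambda>x. f x * h x) x
      \<le> 2 * K * (grad_S2 h x \<bullet> grad_S2 h x) + 2 * K * (h x)\<^sup>2" by simp
  qed (intro continuous_intros smooth_S2_continuous smooth_S2_grad_inner smooth_S2_mult f h)+
  also have "\<dots> = 2 * K * dirichlet h + 2 * K * nsq \<sigma> h"
    unfolding dirichlet_def nsq_sint sint_cmult[symmetric]
    by (rule sint_add) (intro continuous_intros smooth_S2_continuous smooth_S2_grad_inner h)+
  finally show ?thesis .
qed

lemma inner_S2_bounds: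
  assumes "x \<in> S2" shows "(a \<bullet> x)\<^sup>2 \<le> a \<bullet> a" "grad_S2 (\<lambda>x. a \<bullet> x) x \<bullet> grad_S2 (\<lambda>x. a \<bullet> x) x \<le> a \<bullet> a"
proof -
  show "(a \<bullet> x)\<^sup>2 \<le> a \<bullet> a" using Cauchy_Schwarz_ineq[of a x] assms by (simp add: dot_square_norm)
  show "grad_S2 (\<lambda>x. a \<bullet> x) x \<bullet> grad_S2 (\<lambda>x. a \<bullet> x) x \<le> a \<bullet> a"
    unfolding grad_S2_inner_inner[OF assms] by simp
qed

lemma nsq_mult_inner_le:
  assumes "continuous_on S2 h"
  shows "nsq \<sigma> (\<lambda>x. (a \<bullet> x) * h x) \<le> (a \<bullet> a) * nsq \<sigma> h"
proof -
  have "nsq \<sigma> (\<lambda>x. (a \<bullet> x) * h x) \<le> sint (\<lambda>x. (a \<bullet> a) * (h x)\<^sup>2)"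
    unfolding nsq_sint
    by (rule sint_mono)
       (auto intro!: continuous_intros assms mult_right_mono inner_S2_bounds simp: power_mult_distrib)
  then show ?thesis by (simp only: sint_cmult nsq_sint)
qed

text \<open>
  \<open>r = 1 / (4 \<pi>)\<close> normalises the area. Split \<open>f = w + h\<close> with \<open>w\<close> linear and \<open>h\<close> orthogonal to
  constants and linear functions, so that \<open>h\<close> sees the eigenvalue \<open>6\<close>: the terms in \<open>h\<close> have room
  to absorb \<open>\<epsilon>\<^sub>0 = 1 / 100\<close> and the cross term.
\<close>
lemma Rayleigh_lower_bound:
  assumes M: "finite_measure M" "sets M = sets borel_S2" and r: "r = 1 / (4 * pi)"
    and H1: "\<And>f. smooth_S2 f \<Longrightarrow> nsq M f \<le> r * nsq \<sigma> f + 1 / 100 * (dirichlet f + r * nsq \<sigma> f)"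
    and H2: "\<And>f. smooth_S2 f \<Longrightarrow> \<bar>(\<integral>x. f x \<partial>M) - r * sint f\<bar> \<le> \<eta> * sqrt (dirichlet f + r * nsq \<sigma> f)"
    and \<eta>: "\<eta> \<ge> 0"
    and H3: "\<And>a. nsq M (\<lambda>x. a \<bullet> x) \<le> r * nsq \<sigma> (\<lambda>x. a \<bullet> x) + \<delta> * (a \<bullet> a)"
    and f: "smooth_S2 f" and f0: "sint f = 0" and \<delta>: "\<delta> \<ge> 0"
  shows "8 * pi * nsq M f \<le> (1 + 3 * \<delta> + 384 * pi * \<eta>\<^sup>2) * dirichlet f"
proof -
  obtain a h where h: "smooth_S2 h" and fah: "\<And>x. f x = a \<bullet> x + h x" and ah: "sint (\<lambda>x. (a \<bullet> x) * h x) = 0"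
    and gap: "6 * nsq \<sigma> h \<le> dirichlet h" and Df: "dirichlet f = 8 * pi / 3 * (a \<bullet> a) + dirichlet h"
    by (rule linear_part[OF f f0]) (rule that)
  have ch: "continuous_on S2 h" by (rule smooth_S2_continuous[OF h])
  define A X where "A = norm a" and "X = sqrt (dirichlet h)"
  have A: "A \<ge> 0" "a \<bullet> a = A\<^sup>2" by (auto simp: A_def power2_norm_eq_inner)
  have X: "X \<ge> 0" "dirichlet h = X\<^sup>2" using dirichlet_nonneg[of h] by (auto simp: X_def)
  have N: "nsq \<sigma> h \<le> X\<^sup>2 / 6" using gap X by simp
  have r0: "r > 0" "r \<le> 1 / 12" using pi_gt3 by (auto simp: r field_simps)
  have "dirichlet (\<lambda>x. (a \<bullet> x) * h x) + r * nsq \<sigma> (\<lambda>x. (a \<bullet> x) * h x)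
    \<le> (2 * A\<^sup>2 * X\<^sup>2 + 2 * A\<^sup>2 * nsq \<sigma> h) + 1 / 12 * (A\<^sup>2 * nsq \<sigma> h)"
  proof (intro add_mono mult_mono)
    show "dirichlet (\<lambda>x. (a \<bullet> x) * h x) \<le> 2 * A\<^sup>2 * X\<^sup>2 + 2 * A\<^sup>2 * nsq \<sigma> h"
      using dirichlet_mult_le[OF smooth_S2_inner h inner_S2_bounds, of a] by (simp add: A X)
    show "nsq \<sigma> (\<lambda>x. (a \<bullet> x) * h x) \<le> A\<^sup>2 * nsq \<sigma> h"
      using nsq_mult_inner_le[OF ch, of a] by (simp add: A)
  qed (use r0 nsq_nonneg in auto)
  also have "\<dots> = 2 * A\<^sup>2 * X\<^sup>2 + 25 / 12 * A\<^sup>2 * nsq \<sigma> h" by (simp add: algebra_simps)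
  also have "\<dots> \<le> 2 * A\<^sup>2 * X\<^sup>2 + 25 / 12 * A\<^sup>2 * (X\<^sup>2 / 6)"
    using N by (intro add_left_mono mult_left_mono) auto
  \<comment> \<open>The coefficient is \<open>2 + 25 / 72\<close>; rounding up to 4 gives a perfect
    square.\<close>
  also have "\<dots> \<le> 4 * (A\<^sup>2 * X\<^sup>2)" by (simp add: algebra_simps)
  also have "\<dots> = (2 * A * X)\<^sup>2" by (simp add: power_mult_distrib)
  finally have "sqrt (dirichlet (\<lambda>x. (a \<bullet> x) * h x) + r * nsq \<sigma> (\<lambda>x. (a \<bullet> x) * h x)) \<le> 2 * A * X"
    using A X by (intro real_le_lsqrt) auto
  then have cross: "(\<integral>x. (a \<bullet> x) * h x \<partial>M) \<le> \<eta> * (2 * A * X)"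
    using H2[of "\<lambda>x. (a \<bullet> x) * h x"] mult_left_mono[OF _ \<eta>] h
    by (force simp: ah smooth_S2_mult abs_le_iff)
  have hM: "nsq M h \<le> r * nsq \<sigma> h + 1 / 100 * (X\<^sup>2 + r * nsq \<sigma> h)"
    using H1[OF h] by (simp add: X)
  have aM: "nsq M (\<lambda>x. a \<bullet> x) \<le> A\<^sup>2 / 3 + \<delta> * A\<^sup>2"
    using H3[of a] by (simp add: nsq_inner A r)
  have "nsq M f = nsq M (\<lambda>x. 1 * (a \<bullet> x) + 1 * h x)" by (simp add: nsq_def fah)
  also have "\<dots> = nsq M (\<lambda>x. a \<bullet> x) + 2 * (\<integral>x. (a \<bullet> x) * h x \<partial>M) + nsq M h"
    by (subst nsq_expand[OF M]) (auto intro!: continuous_intros ch)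
  finally have "8 * pi * nsq M f \<le> 8 * pi * (A\<^sup>2 / 3 + \<delta> * A\<^sup>2 + 2 * (\<eta> * (2 * A * X))
     + (r * nsq \<sigma> h + 1 / 100 * (X\<^sup>2 + r * nsq \<sigma> h)))"
    using cross hM aM by (intro mult_left_mono) auto
  also have "\<dots> = 8 * pi / 3 * A\<^sup>2 * (1 + 3 * \<delta>) + 32 * pi * \<eta> * A * X + (2 * nsq \<sigma> h * (101 / 100) + 8 * pi / 100 * X\<^sup>2)"
    by (simp add: r field_simps)
  \<comment> \<open>The energy \<open>X\<^sup>2\<close> of \<open>h\<close> is spent as a budget:
    one quarter on the cross term through Young's inequality, three quarters on the terms in
    \<open>h\<close>, into which \<open>101 / 300 + 8 * pi / 100\<close> fits. The price on the side
    of \<open>A\<close> is \<open>1024 * pi\<^sup>2 = 8 * pi / 3 * (384 * pi)\<close>, the origin of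
    the constant \<open>384 * pi\<close>.\<close>
  also have "\<dots> \<le> 8 * pi / 3 * A\<^sup>2 * (1 + 3 * \<delta>) + (X\<^sup>2 / 4 + 1024 * pi\<^sup>2 * \<eta>\<^sup>2 * A\<^sup>2) + 3 / 4 * X\<^sup>2"
  proof (intro add_mono order_refl)
    have "0 \<le> (X / 2 - 32 * pi * \<eta> * A)\<^sup>2" by simp
    then show "32 * pi * \<eta> * A * X \<le> X\<^sup>2 / 4 + 1024 * pi\<^sup>2 * \<eta>\<^sup>2 * A\<^sup>2"
      by (simp add: power2_eq_square algebra_simps)
    have "pi * X\<^sup>2 \<le> 4 * X\<^sup>2" using pi_less_4 by (intro mult_right_mono) auto
    then show "2 * nsq \<sigma> h * (101 / 100) + 8 * pi / 100 * X\<^sup>2 \<le> 3 / 4 * X\<^sup>2"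
    proof -
      have "8 * pi / 100 * X\<^sup>2 = 8 / 100 * (pi * X\<^sup>2)" by simp
      then show ?thesis using N zero_le_power2[of X] \<open>pi * X\<^sup>2 \<le> 4 * X\<^sup>2\<close> by linarith
    qed
  qed
  also have "\<dots> = 8 * pi / 3 * A\<^sup>2 * (1 + 3 * \<delta> + 384 * pi * \<eta>\<^sup>2) + X\<^sup>2"
    by (simp add: power2_eq_square algebra_simps)
  also have "\<dots> \<le> (1 + 3 * \<delta> + 384 * pi * \<eta>\<^sup>2) * dirichlet f"
  proof -
    have "0 \<le> (3 * \<delta> + 384 * pi * \<eta>\<^sup>2) * X\<^sup>2" using \<delta> by simp
    then show ?thesis unfolding Df A X by (simp add: algebra_simps)
  qed
  finally show ?thesis .
qed

text \<open>\<open>\<delta>\<close> measures the excess on squares of linear functions and is kept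
  apart from \<open>\<eta>\<close>: it is \<open>8 * \<eta>\<close> in the first bound, and 0 in the
  second bound and for the perturbed measure.\<close>

lemma lambda1_lower_bound:
  assumes M: "finite_measure M" "sets M = sets borel_S2" and r: "r = 1 / (4 * pi)"
    and ex: "two_dim_subspace M E0"
    and H1: "\<And>f. smooth_S2 f \<Longrightarrow> nsq M f \<le> r * nsq \<sigma> f + 1 / 100 * (dirichlet f + r * nsq \<sigma> f)"
    and H2: "\<And>f. smooth_S2 f \<Longrightarrow> \<bar>(\<integral>x. f x \<partial>M) - r * sint f\<bar> \<le> \<eta> * sqrt (dirichlet f + r * nsq \<sigma> f)"
    and \<eta>: "\<eta> \<ge> 0"
    and H3: "\<And>a. nsq M (\<lambda>x. a \<bullet> x) \<le> r * nsq \<sigma> (\<lambda>x. a \<bullet> x) + \<delta> * (a \<bullet> a)" and \<delta>: "\<delta> \<ge> 0"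
  shows "8 * pi / (1 + 3 * \<delta> + 384 * pi * \<eta>\<^sup>2) \<le> lambda1 r M"
proof (rule lambda1_ge[OF M _ ex])
  show "r > 0" by (simp add: r)
  fix f assume f: "smooth_S2 f" "sint f = 0"
  have "1 + 3 * \<delta> + 384 * pi * \<eta>\<^sup>2 > 0" using \<delta> by (simp add: add_pos_nonneg)
  then show "8 * pi / (1 + 3 * \<delta> + 384 * pi * \<eta>\<^sup>2) * nsq M f \<le> dirichlet f"
    using Rayleigh_lower_bound[OF M r H1 H2 \<eta> H3 f \<delta>] by (simp add: field_simps)
qed

section \<open>Admissible measures and the two lower bounds\<close>

lemma laplacian_S2_inner:
  assumes x: "x \<in> S2" and r: "r \<noteq> 0"
  shows "laplacian_S2 r (\<lambda>x. a \<bullet> x) x = - 2 / r * (a \<bullet> x)"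
proof -
  have "grad_S2 (\<lambda>y. grad_S2 (\<lambda>x. a \<bullet> x) y $ i) x $ i = - (a \<bullet> x) - a $ i * x $ i + 2 * (a \<bullet> x) * (x $ i * x $ i)" for i
  proof -
    have "grad_S2 (\<lambda>y. grad_S2 (\<lambda>x. a \<bullet> x) y $ i) x = grad_S2 (\<lambda>y. a $ i - (a \<bullet> y) * (axis i 1 \<bullet> y)) x"
      by (rule grad_S2_cong) (use x in \<open>auto simp: grad_S2_inner inner_axis'\<close>)
    also have "\<dots> = - ((a \<bullet> x) *\<^sub>R (axis i 1 - (axis i 1 \<bullet> x) *\<^sub>R x) + (axis i 1 \<bullet> x) *\<^sub>R (a - (a \<bullet> x) *\<^sub>R x))"
      using x grad_S2_inner[OF x, of "axis i 1"] grad_S2_inner[OF x, of a]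
      by (subst grad_S2_diff) (simp_all add: grad_S2_const grad_S2_mult smooth_S2_mult)
    finally have eq: "grad_S2 (\<lambda>y. grad_S2 (\<lambda>x. a \<bullet> x) y $ i) x
      = - ((a \<bullet> x) *\<^sub>R (axis i 1 - (axis i 1 \<bullet> x) *\<^sub>R x) + (axis i 1 \<bullet> x) *\<^sub>R (a - (a \<bullet> x) *\<^sub>R x))" .
    have "axis i (1::real) $ i = 1" by (simp add: axis_def)
    then show ?thesis unfolding eq by (simp add: inner_axis' algebra_simps)
  qed
  then have "laplacian_S2 r (\<lambda>x. a \<bullet> x) x = (\<Sum>i\<in>UNIV. - (a \<bullet> x) - a $ i * x $ i + 2 * (a \<bullet> x) * (x $ i * x $ i)) / r"
    by (simp add: laplacian_S2_def)
  also have "(\<Sum>i\<in>UNIV. - (a \<bullet> x) - a $ i * x $ i + 2 * (a \<bullet> x) * (x $ i * x $ i)) = - 3 * (a \<bullet> x) - a \<bullet> x + 2 * (a \<bullet> x) * (x \<bullet> x)"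
    by (simp add: sum.distrib sum_subtractf inner_vec_def[of a x] inner_vec_def[of x x] sum_distrib_left sum_negf)
  also have "x \<bullet> x = 1" using x by (simp add: norm_eq_1)
  finally show ?thesis by simp
qed

text \<open>The second bound tests its hypothesis on linear functions, so it suffices to place these
  in the eigenspace.\<close>

lemma inner_in_eigenspace: "(\<lambda>x. a \<bullet> x) \<in> eigenspace (1 / (4 * pi)) (8 * pi)"
  unfolding eigenspace_def by (auto simp: laplacian_S2_inner)

lemma integral_area_measure_smooth:
  "r \<ge> 0 \<Longrightarrow> continuous_on S2 f \<Longrightarrow> (\<integral>x. f x \<partial>area_measure r) = r * sint f"
  unfolding sint_def by (rule integral_area_measure) (auto intro: continuous_S2_measurable)

lemma measure_area_measure: "r \<ge> 0 \<Longrightarrow> measure (area_measure r) S2 = 4 * pi * r"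
proof -
  assume r: "r \<ge> 0"
  interpret finite_measure "area_measure r" by (rule finite_measure_area_measure)
  have "measure (area_measure r) S2 = (\<integral>x. 1 \<partial>area_measure r)" by simp
  also have "\<dots> = r * sint (\<lambda>x. 1)" by (rule integral_area_measure_smooth[OF r]) auto
  finally show ?thesis by (simp add: sint_const)
qed

text \<open>If the constants and each coordinate function were dependent, every coordinate would be
  constant almost everywhere, so the measure would sit at one point. Balance puts that point at the
  origin, off the sphere.\<close>

lemma balanced_two_dim:
  assumes M: "finite_measure M" "sets M = sets borel_S2" "emeasure M S2 \<noteq> 0" and bal: "balanced M"
  shows "\<exists>E. two_dim_subspace M E"
proof (rule ccontr)
  assume no: "\<not> ?thesis"
  interpret finite_measure M by fact
  have sp: "space M = S2" by (rule space_eq_S2[OF M(2)])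
  have "\<exists>c. AE x in M. x $ i = c" for i
  proof -
    have "\<exists>a b. (AE x in M. a * 1 + b * x $ i = 0) \<and> (a, b) \<noteq> (0, 0)"
    proof (rule ccontr)
      assume "\<not> (\<exists>a b. (AE x in M. a * 1 + b * x $ i = 0) \<and> (a, b) \<noteq> (0, 0))"
      then have "\<forall>a b. (AE x in M. a * 1 + b * x $ i = 0) \<longrightarrow> a = 0 \<and> b = 0" by blast
      then have "two_dim_subspace M {\<lambda>x. a * 1 + b * x $ i | a b. True}"
        unfolding two_dim_subspace_def
        by (intro exI[of _ "\<lambda>_. 1"] exI[of _ "\<lambda>x. x $ i"] conjI smooth_S2_const smooth_S2_component refl)
      then show False using no by blast
    qed
    then obtain a b where ab: "AE x in M. a * 1 + b * x $ i = 0" "(a, b) \<noteq> (0, 0)" by blast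
    have "b \<noteq> 0"
    proof
      assume b: "b = 0"
      then have "AE x in M. False" using ab by simp
      then have "emeasure M (space M) = 0" using emeasure_eq_0_AE[of "\<lambda>_. True" M] by simp
      then show False using M sp by simp
    qed
    have "AE x in M. x $ i = - a / b"
      using ab(1) by eventually_elim (use \<open>b \<noteq> 0\<close> in \<open>simp add: field_simps\<close>)
    then show ?thesis by blast
  qed
  then obtain c where c: "\<And>i. AE x in M. x $ i = c i" by metis
  define p where "p = (\<chi> i. c i)"
  have "AE x in M. x = p"
    using c[of 1] c[of 2] c[of 3] by eventually_elim (simp add: p_def vec_eq_iff forall_3)
  then have "(\<integral>x. x \<partial>M) = (\<integral>x. p \<partial>M)"
    using M(2) by (intro integral_cong_AE) (auto cong: measurable_cong_sets intro!: measurable_restrict_space1)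
  then have "measure M S2 *\<^sub>R p = 0" using bal by (simp add: balanced_def sp)
  moreover have mp: "measure M S2 \<noteq> 0" using M(3) by (auto simp: emeasure_eq_measure)
  ultimately have "p = 0" by simp
  have "AE x in M. x \<notin> space M"
    using \<open>AE x in M. x = p\<close> AE_space[of M]
  proof eventually_elim
    case (elim x)
    then show ?case using sp \<open>p = 0\<close> by auto
  qed
  then have "emeasure M (space M) = 0" using emeasure_eq_0_AE[of "\<lambda>x. x \<in> space M" M] by simp
  then show False using M sp by simp
qed

lemma integral_square_le:
  assumes M: "finite_measure M" "sets M = sets borel_S2" and f: "continuous_on S2 f"
  shows "(\<integral>x. f x \<partial>M)\<^sup>2 \<le> measure M S2 * nsq M (f :: _ \<Rightarrow> real)"
proof -
  interpret finite_measure M by fact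
  let ?m = "measure M S2" and ?I = "\<integral>x. f x \<partial>M"
  have sp: "space M = S2" by (rule space_eq_S2[OF M(2)])
  have one: "nsq M (\<lambda>x. 1 :: real) = ?m" by (simp add: nsq_def sp)
  have q: "0 \<le> a\<^sup>2 * nsq M f + 2 * a * b * ?I + b\<^sup>2 * ?m" for a b
    using nsq_expand[OF M f, of "\<lambda>_. 1" a b] nsq_nonneg[of M "\<lambda>x. a * f x + b * 1"] one by simp
  show ?thesis
  proof (cases "?m = 0")
    case True
    have "?I = 0"
    proof (rule ccontr)
      assume I: "?I \<noteq> 0"
      show False using q[of 1 "- (nsq M f + 1) / (2 * ?I)"] True I by (simp add: field_simps)
    qed
    then show ?thesis using True by simp
  next
    case False
    then have m: "?m > 0" using measure_nonneg[of M S2] by linarith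
    have "0 \<le> ?m * (?m * nsq M f - ?I\<^sup>2)"
      using q[of ?m "- ?I"] by (simp add: power2_eq_square algebra_simps)
    then show ?thesis using m by (simp add: zero_le_mult_iff)
  qed
qed

lemma W12_norm_eq_sqrt:
  "smooth_S2 f \<Longrightarrow> r > 0 \<Longrightarrow> W12_norm r f = sqrt (dirichlet f + r * nsq \<sigma> f)"
  using W12_norm_smooth[of f r] W12_norm_nonneg[of r f] by (simp add: nsq_sint real_sqrt_unique)

lemma smooth_nsq_area_measure:
  "smooth_S2 f \<Longrightarrow> r \<ge> 0 \<Longrightarrow> (\<integral>x. (f x)\<^sup>2 \<partial>area_measure r) = r * nsq \<sigma> f"
  by (simp add: integral_area_measure_smooth smooth_S2_continuous smooth_S2_power nsq_sint)

text \<open>Cauchy-Schwarz against the constant 1 supplies the finiteness that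
  \<open>Wm12_norm_diff_bound\<close> asks for.\<close>

lemma dual_bound:
  assumes M: "finite_measure M" "sets M = sets borel_S2" and r: "r > 0"
    and B: "B \<ge> 0" "\<And>f. smooth_S2 f \<Longrightarrow> nsq M f \<le> B * (dirichlet f + r * nsq \<sigma> f)"
  shows "\<exists>K. \<forall>f. smooth_S2 f \<longrightarrow> \<bar>(\<integral>x. f x \<partial>M) - (\<integral>x. f x \<partial>area_measure r)\<bar> \<le> K * W12_norm r f"
proof (intro exI allI impI)
  fix f assume f: "smooth_S2 f"
  have c: "continuous_on S2 f" by (rule smooth_S2_continuous[OF f])
  let ?W = "dirichlet f + r * nsq \<sigma> f"
  have W: "nsq (area_measure r) f \<le> ?W"
    using smooth_nsq_area_measure[OF f, of r] r dirichlet_nonneg[of f] by (simp add: nsq_real)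
  have "\<bar>\<integral>x. f x \<partial>M\<bar> \<le> sqrt (measure M S2 * B) * sqrt ?W"
    unfolding real_sqrt_mult[symmetric]
  proof (rule real_le_rsqrt)
    show "\<bar>\<integral>x. f x \<partial>M\<bar>\<^sup>2 \<le> measure M S2 * B * ?W"
      using order_trans[OF integral_square_le[OF M c] mult_left_mono[OF B(2)[OF f] measure_nonneg]]
      by (simp add: mult.assoc)
  qed
  moreover have "\<bar>\<integral>x. f x \<partial>area_measure r\<bar> \<le> sqrt (measure (area_measure r) S2) * sqrt ?W"
    unfolding real_sqrt_mult[symmetric]
  proof (rule real_le_rsqrt)
    show "\<bar>\<integral>x. f x \<partial>area_measure r\<bar>\<^sup>2 \<le> measure (area_measure r) S2 * ?W"
      using order_trans[OF integral_square_le[OF finite_measure_area_measure _ c] mult_left_mono[OF W measure_nonneg]]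
      by simp
  qed
  ultimately show "\<bar>(\<integral>x. f x \<partial>M) - (\<integral>x. f x \<partial>area_measure r)\<bar>
    \<le> (sqrt (measure M S2 * B) + sqrt (measure (area_measure r) S2)) * W12_norm r f"
    unfolding W12_norm_eq_sqrt[OF f r] distrib_right by linarith
qed

text \<open>The origin of \<open>\<delta> = 8 * \<eta>\<close>: the square of a linear function
  becomes a test function for the dual norm.\<close>

lemma W12_norm_inner_square:
  "sqrt (dirichlet (\<lambda>x. (a \<bullet> x) * (a \<bullet> x)) + 1 / (4 * pi) * nsq \<sigma> (\<lambda>x. (a \<bullet> x) * (a \<bullet> x))) \<le> 8 * (a \<bullet> a)"
proof (rule real_le_lsqrt)
  let ?A = "a \<bullet> a"
  have "dirichlet (\<lambda>x. (a \<bullet> x) * (a \<bullet> x)) \<le> 2 * ?A * (8 * pi / 3 * ?A) + 2 * ?A * (4 * pi / 3 * ?A)"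
    using dirichlet_mult_le[OF smooth_S2_inner smooth_S2_inner inner_S2_bounds, of a a]
    by (simp add: dirichlet_inner nsq_inner)
  moreover have "nsq \<sigma> (\<lambda>x. (a \<bullet> x) * (a \<bullet> x)) \<le> ?A * (4 * pi / 3 * ?A)"
    using nsq_mult_inner_le[of "\<lambda>x. a \<bullet> x" a] by (simp add: nsq_inner continuous_on_inner)
  then have "1 / (4 * pi) * nsq \<sigma> (\<lambda>x. (a \<bullet> x) * (a \<bullet> x)) \<le> 1 / (4 * pi) * (?A * (4 * pi / 3 * ?A))"
    by (intro mult_left_mono) auto
  ultimately have "dirichlet (\<lambda>x. (a \<bullet> x) * (a \<bullet> x)) + 1 / (4 * pi) * nsq \<sigma> (\<lambda>x. (a \<bullet> x) * (a \<bullet> x))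
    \<le> 8 * (pi * ?A\<^sup>2) + 1 / 3 * ?A\<^sup>2"
    by (simp add: power2_eq_square)
  also have "pi * ?A\<^sup>2 \<le> 4 * ?A\<^sup>2" using pi_less_4 by (intro mult_right_mono) auto
  finally have *: "dirichlet (\<lambda>x. (a \<bullet> x) * (a \<bullet> x)) + 1 / (4 * pi) * nsq \<sigma> (\<lambda>x. (a \<bullet> x) * (a \<bullet> x))
    \<le> 8 * (4 * ?A\<^sup>2) + 1 / 3 * ?A\<^sup>2" by simp
  have "(8 * ?A)\<^sup>2 = 64 * ?A\<^sup>2" by (simp add: power_mult_distrib)
  then show "dirichlet (\<lambda>x. (a \<bullet> x) * (a \<bullet> x)) + 1 / (4 * pi) * nsq \<sigma> (\<lambda>x. (a \<bullet> x) * (a \<bullet> x)) \<le> (8 * ?A)\<^sup>2"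
    using * zero_le_power2[of ?A] by linarith
qed simp

text \<open>The hypothesis speaks of the extension; on smooth functions, the competitors in
  \<open>lambda1\<close>, that is the identity almost everywhere.\<close>

lemma admissible_lambda1_lower_bound:
  assumes r: "r = 1 / (4 * pi)" and bal: "balanced \<mu>" and adm: "admissible r \<mu>"
    and eps: "\<forall>u\<in>W12. (\<integral>x. (ext_op r \<mu> u x)\<^sup>2 \<partial>\<mu>) - (\<integral>x. (u x)\<^sup>2 \<partial>area_measure r) \<le> 1 / 100 * (W12_norm r u)\<^sup>2"
  defines "\<eta> \<equiv> Wm12_norm_diff r \<mu> (area_measure r)"
  shows "lambda1 r \<mu> \<ge> 8 * pi / (1 + 384 * pi * (\<eta> + \<eta>\<^sup>2))"
    and "(\<forall>w\<in>eigenspace r (8 * pi). (\<integral>x. (w x)\<^sup>2 \<partial>\<mu>) - (\<integral>x. (w x)\<^sup>2 \<partial>area_measure r) = 0) \<Longrightarrow>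
      lambda1 r \<mu> \<ge> 8 * pi / (1 + 384 * pi * \<eta>\<^sup>2)"
proof -
  have r0: "r > 0" by (simp add: r)
  have M: "finite_measure \<mu>" "sets \<mu> = sets borel_S2" "emeasure \<mu> S2 \<noteq> 0"
    using adm by (auto simp: admissible_def)
  have T: "compact_extension r \<mu> (ext_op r \<mu>)"
  proof -
    have "\<exists>T. compact_extension r \<mu> T" using adm by (simp add: admissible_def)
    then show ?thesis unfolding ext_op_def by (rule someI_ex)
  qed
  have H1: "nsq \<mu> f \<le> r * nsq \<sigma> f + 1 / 100 * (dirichlet f + r * nsq \<sigma> f)" if f: "smooth_S2 f" for f
  proof -
    have "AE x in \<mu>. ext_op r \<mu> f x = f x" "ext_op r \<mu> f \<in> L2 \<mu>"
      using T f smooth_W12[OF f] unfolding compact_extension_def by blast+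
    then have "(\<integral>x. (ext_op r \<mu> f x)\<^sup>2 \<partial>\<mu>) = nsq \<mu> f"
      unfolding nsq_real
      by (intro integral_cong_AE) (auto simp: L2_real intro!: borel_measurable_power continuous_S2_measurable M smooth_S2_continuous f)
    then show ?thesis
      using bspec[OF eps smooth_W12[OF f]] W12_norm_smooth[OF f r0] smooth_nsq_area_measure[OF f, of r] r0
      by (simp add: nsq_sint field_simps)
  qed
  have "nsq \<mu> f \<le> 2 * (dirichlet f + r * nsq \<sigma> f)" if f: "smooth_S2 f" for f
  proof -
    have "N \<le> 2 * (D + x)" if "N \<le> x + 1 / 100 * (D + x)" "0 \<le> D" "0 \<le> x" for N D x :: real
      using that by (simp add: field_simps)
    from this[OF H1[OF f] dirichlet_nonneg[of f] mult_nonneg_nonneg[OF less_imp_le[OF r0] nsq_nonneg[of \<sigma> f]]]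
    show ?thesis .
  qed
  then obtain K where K: "\<And>f. smooth_S2 f \<Longrightarrow> \<bar>(\<integral>x. f x \<partial>\<mu>) - (\<integral>x. f x \<partial>area_measure r)\<bar> \<le> K * W12_norm r f"
    using dual_bound[OF M(1,2) r0, of 2] by auto
  have \<eta>: "\<eta> \<ge> 0" unfolding \<eta>_def by (rule Wm12_norm_diff_bound(1)[OF r0 K])
  have H2: "\<bar>(\<integral>x. f x \<partial>\<mu>) - r * sint f\<bar> \<le> \<eta> * sqrt (dirichlet f + r * nsq \<sigma> f)" if f: "smooth_S2 f" for f
    using Wm12_norm_diff_bound(2)[OF r0 K f] integral_area_measure_smooth[OF _ smooth_S2_continuous[OF f], of r] r0
    by (simp add: \<eta>_def W12_norm_eq_sqrt[OF f r0])
  obtain E0 where E0: "two_dim_subspace \<mu> E0" using balanced_two_dim[OF M bal] by blast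
  have H3: "nsq \<mu> (\<lambda>x. a \<bullet> x) \<le> r * nsq \<sigma> (\<lambda>x. a \<bullet> x) + 8 * \<eta> * (a \<bullet> a)" for a
  proof -
    have "nsq \<mu> (\<lambda>x. a \<bullet> x) - r * nsq \<sigma> (\<lambda>x. a \<bullet> x)
      \<le> \<eta> * sqrt (dirichlet (\<lambda>x. (a \<bullet> x) * (a \<bullet> x)) + r * nsq \<sigma> (\<lambda>x. (a \<bullet> x) * (a \<bullet> x)))"
      using H2[OF smooth_S2_mult[OF smooth_S2_inner smooth_S2_inner], of a a]
      by (simp add: nsq_real sint_def power2_eq_square)
    also have "\<dots> \<le> \<eta> * (8 * (a \<bullet> a))"
      unfolding r by (intro mult_left_mono W12_norm_inner_square \<eta>)
    finally show ?thesis by simp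
  qed
  \<comment> \<open>\<open>3 * \<delta> = 24 * \<eta>\<close> is absorbed in
    \<open>384 * pi * \<eta>\<close>, so that one constant serves both bounds.\<close>
  have "8 * pi / (1 + 384 * pi * (\<eta> + \<eta>\<^sup>2)) \<le> 8 * pi / (1 + 3 * (8 * \<eta>) + 384 * pi * \<eta>\<^sup>2)"
  proof (intro divide_left_mono mult_pos_pos)
    have "24 * \<eta> \<le> 384 * pi * \<eta>" using pi_gt3 \<eta> by (intro mult_right_mono) auto
    then show "1 + 3 * (8 * \<eta>) + 384 * pi * \<eta>\<^sup>2 \<le> 1 + 384 * pi * (\<eta> + \<eta>\<^sup>2)"
      by (simp add: algebra_simps)
  qed (use \<eta> in \<open>auto intro!: add_pos_nonneg\<close>)
  also have "\<dots> \<le> lambda1 r \<mu>"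
    by (rule lambda1_lower_bound[OF M(1,2) r E0 H1 H2 \<eta> H3]) (use \<eta> in auto)
  finally show "lambda1 r \<mu> \<ge> 8 * pi / (1 + 384 * pi * (\<eta> + \<eta>\<^sup>2))" .
  assume eig: "\<forall>w\<in>eigenspace r (8 * pi). (\<integral>x. (w x)\<^sup>2 \<partial>\<mu>) - (\<integral>x. (w x)\<^sup>2 \<partial>area_measure r) = 0"
  have H3': "nsq \<mu> (\<lambda>x. a \<bullet> x) \<le> r * nsq \<sigma> (\<lambda>x. a \<bullet> x) + 0 * (a \<bullet> a)" for a
    using bspec[OF eig inner_in_eigenspace[of a, folded r]] smooth_nsq_area_measure[OF smooth_S2_inner, of r a] r0
    by (simp add: nsq_real)
  show "lambda1 r \<mu> \<ge> 8 * pi / (1 + 384 * pi * \<eta>\<^sup>2)"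
    using lambda1_lower_bound[OF M(1,2) r E0 H1 H2 \<eta> H3'] by simp
qed

section \<open>Conformal invariance of the Dirichlet energy\<close>

text \<open>Reduced to the vector-valued \<open>has_absolute_integral_change_of_variables\<close> by
  passing through \<open>real^1\<close>.\<close>

lemma change_of_variables_real:
  fixes f :: "real^3 \<Rightarrow> real" and g :: "real^3 \<Rightarrow> real^3"
  assumes S: "S \<in> sets lebesgue" and der: "\<And>x. x \<in> S \<Longrightarrow> (g has_derivative g' x) (at x within S)"
    and inj: "inj_on g S" and f: "f absolutely_integrable_on (g ` S)"
  shows "integral S (\<lambda>x. \<bar>det (matrix (g' x))\<bar> * f (g x)) = integral (g ` S) f"
proof -
  let ?v = "vec :: real \<Rightarrow> real^1"
  have bl: "bounded_linear ?v"
    by (intro linear_conv_bounded_linear[THEN iffD1] linearI) (simp_all add: vec_eq_iff)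
  have vf: "(\<lambda>x. ?v (f x)) absolutely_integrable_on (g ` S)"
    using absolutely_integrable_linear[OF f bl] by (simp add: comp_def)
  have nth: "integral T (\<lambda>x. h x) = integral T (\<lambda>x. ?v (h x)) $ 1" if "(\<lambda>x. ?v (h x)) integrable_on T" for h T
    using integral_component_eq_cart[OF that, of 1] by simp
  have "(\<lambda>x. \<bar>det (matrix (g' x))\<bar> *\<^sub>R ?v (f (g x))) absolutely_integrable_on S \<and>
    integral S (\<lambda>x. \<bar>det (matrix (g' x))\<bar> *\<^sub>R ?v (f (g x))) = integral (g ` S) (\<lambda>x. ?v (f x))"
    by (rule has_absolute_integral_change_of_variables[OF S der inj, THEN iffD2]) (use vf in auto)
  moreover have "(\<lambda>x. \<bar>det (matrix (g' x))\<bar> *\<^sub>R ?v (f (g x))) = (\<lambda>x. ?v (\<bar>det (matrix (g' x))\<bar> * f (g x)))"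
    by (simp add: vec_eq_iff fun_eq_iff)
  ultimately have *: "(\<lambda>x. ?v (\<bar>det (matrix (g' x))\<bar> * f (g x))) absolutely_integrable_on S"
    "integral S (\<lambda>x. ?v (\<bar>det (matrix (g' x))\<bar> * f (g x))) = integral (g ` S) (\<lambda>x. ?v (f x))"
    by simp_all
  show ?thesis
    using nth[OF set_lebesgue_integral_eq_integral(1)[OF *(1)]] nth[OF set_lebesgue_integral_eq_integral(1)[OF vf]] *(2)
    by simp
qed

section \<open>Radial extension from the sphere to the ball\<close>

abbreviation pball :: "(real^3) set" where "pball \<equiv> ball 0 1 - {0}"

text \<open>Integrating the extension that is constant along rays turns a change of variables on the
  sphere into one for Lebesgue measure. The origin is left out because \<open>sgn\<close> jumps
  there.\<close>

definition bint :: "(real^3 \<Rightarrow> real) \<Rightarrow> real"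
  where "bint \<phi> = integral pball (\<lambda>x. \<phi> (sgn x))"

lemma sgn_S2: "x \<noteq> 0 \<Longrightarrow> sgn x \<in> S2"
  by (simp add: norm_sgn)

lemma continuous_on_sgn_pball: "continuous_on pball (sgn :: real^3 \<Rightarrow> real^3)"
  unfolding sgn_div_norm by (intro continuous_intros) auto

lemma absolutely_integrable_pball:
  assumes "continuous_on S2 \<phi>"
  shows "(\<lambda>x. \<phi> (sgn x) :: real) absolutely_integrable_on pball"
proof -
  obtain M where M: "M > 0" "\<And>x. x \<in> S2 \<Longrightarrow> \<bar>\<phi> x\<bar> \<le> M" using continuous_S2_bounded[OF assms] by metis
  have c: "continuous_on pball (\<lambda>x. \<phi> (sgn x))"
    by (rule continuous_on_compose2[OF assms continuous_on_sgn_pball]) (auto simp: norm_sgn split: if_splits)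
  have m: "(\<lambda>x. indicator pball x *\<^sub>R \<phi> (sgn x)) \<in> borel_measurable lborel"
    using borel_measurable_continuous_on_indicator[OF _ c] by simp
  have "integrable lborel (\<lambda>x. M * indicat_real pball x)"
    using emeasure_bounded_finite[OF bounded_subset[OF bounded_ball Diff_subset], of 0 1 "{0}"]
    by (intro integrable_mult_right integrable_real_indicator) auto
  then have "integrable lborel (\<lambda>x. indicator pball x *\<^sub>R \<phi> (sgn x))"
    by (rule Bochner_Integration.integrable_bound[OF _ m])
       (use M sgn_S2 in \<open>auto intro!: AE_I2 simp: indicator_def\<close>)
  then show ?thesis
    unfolding set_integrable_def using m by (subst integrable_completion) auto
qed

lemma integrable_pball: "continuous_on S2 \<phi> \<Longrightarrow> (\<lambda>x. \<phi> (sgn x) :: real) integrable_on pball"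
  using absolutely_integrable_pball set_lebesgue_integral_eq_integral(1) by blast

lemma bint_sum:
  "(\<And>i. i \<in> I \<Longrightarrow> continuous_on S2 (f i)) \<Longrightarrow> finite I \<Longrightarrow> bint (\<lambda>x. \<Sum>i\<in>I. f i x) = (\<Sum>i\<in>I. bint (f i))"
  unfolding bint_def by (intro integral_sum integrable_pball)

lemma bint_cmult: "bint (\<lambda>x. c * f x) = c * bint f"
  unfolding bint_def by simp

lemma bint_cong: "(\<And>x. x \<in> S2 \<Longrightarrow> f x = g x) \<Longrightarrow> bint f = bint g"
  unfolding bint_def by (intro integral_cong) (auto simp: norm_sgn)

lemma bint_mono:
  "continuous_on S2 f \<Longrightarrow> continuous_on S2 g \<Longrightarrow> (\<And>x. x \<in> S2 \<Longrightarrow> f x \<le> g x) \<Longrightarrow> bint f \<le> bint g"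
  unfolding bint_def by (intro integral_le integrable_pball) (auto simp: norm_sgn)

lemma pball_lebesgue: "pball \<in> sets lebesgue"
  by (auto intro!: sets_completionI_sets)

lemma bint_rotation:
  assumes R: "orthogonal_transformation R" and f: "continuous_on S2 f"
  shows "bint (\<lambda>x. f (R x)) = bint f"
proof -
  have lin: "linear R" using R by (rule orthogonal_transformation_linear)
  have nR: "norm (R x) = norm x" for x using R by (simp add: orthogonal_transformation_norm)
  have inj: "inj R" using R by (rule orthogonal_transformation_inj)
  have "surj R" using R by (rule orthogonal_transformation_surj)
  have im: "R ` pball = pball"
  proof -
    have "R ` ball 0 1 = ball (R 0) 1" by (rule image_orthogonal_transformation_ball[OF R])
    then show ?thesis using image_set_diff[OF inj, of "ball 0 1" "{0}"] linear_0[OF lin] by simp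
  qed
  have "integral pball (\<lambda>x. \<bar>det (matrix R)\<bar> * f (sgn (R x))) = integral (R ` pball) (\<lambda>x. f (sgn x))"
  proof (rule change_of_variables_real[OF pball_lebesgue])
    show "(R has_derivative R) (at x within pball)" for x
      using lin linear_conv_bounded_linear bounded_linear_imp_has_derivative by blast
    show "inj_on R pball" using inj inj_on_subset by blast
    show "(\<lambda>x. f (sgn x)) absolutely_integrable_on R ` pball"
      unfolding im by (rule absolutely_integrable_pball[OF f])
  qed
  moreover have "sgn (R x) = R (sgn x)" for x
    by (simp add: sgn_div_norm nR linear_scale[OF lin])
  ultimately show ?thesis using orthogonal_transformation_det[OF R] by (simp add: bint_def im)
qed

text \<open>
  The kernels \<open>kern n\<close> have the same integral at every point for both integrals, hence both
  integrals are determined up to a factor: the area measure is the radial projection of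
  Lebesgue measure up to a constant.
\<close>
lemma bint_eq_sint:
  obtains \<kappa> where "\<And>f. continuous_on S2 f \<Longrightarrow> bint f = \<kappa> * sint f" "\<kappa> > 0"
proof -
  define p where "p = (axis 1 1 :: real^3)"
  have p: "p \<in> S2" by (simp add: p_def)
  define C where "C n = bint (kern n p)" for n
  have C: "bint (kern n x) = C n" if x: "x \<in> S2" for n x
  proof -
    obtain R where R: "orthogonal_transformation R" "R p = x"
      using orthogonal_transformation_exists_1[of p x] p x by auto
    have "kern n x (R y) = kern n p y" for y
      using R by (auto simp: kern_def orthogonal_transformation_def)
    then have "C n = bint (\<lambda>y. kern n x (R y))" by (simp add: C_def)
    also have "\<dots> = bint (kern n x)" by (rule bint_rotation[OF R(1) continuous_kern])
    finally show ?thesis by simp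
  qed
  define V where "V = bint (\<lambda>x. 1)"
  let ?F = "\<lambda>n k. feat n ! k"
  \<comment> \<open>The kernel has finite rank, so exchanging the two integrals amounts to
    exchanging each of them with a finite sum.\<close>
  have dual: "sint (\<lambda>x. f x * bint (kern n x)) = bint (\<lambda>y. sint (\<lambda>x. kern n y x * f x))"
    if f: "continuous_on S2 f" for f n
  proof -
    have b: "bint (kern n x) = (\<Sum>k<length (feat n). ?F n k x * bint (?F n k))" for x
    proof -
      have "bint (kern n x) = bint (\<lambda>y. \<Sum>k<length (feat n). ?F n k x * ?F n k y)"
        by (rule bint_cong) (rule kern_feat)
      also have "\<dots> = (\<Sum>k<length (feat n). ?F n k x * bint (?F n k))"
        by (subst bint_sum) (auto simp: bint_cmult intro!: continuous_intros feat_cont)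
      finally show ?thesis .
    qed
    have s: "sint (\<lambda>x. kern n y x * f x) = (\<Sum>k<length (feat n). ?F n k y * sint (\<lambda>x. ?F n k x * f x))" for y
    proof -
      have "sint (\<lambda>x. kern n y x * f x) = sint (\<lambda>x. \<Sum>k<length (feat n). ?F n k y * (?F n k x * f x))"
        by (rule sint_cong) (simp add: kern_feat sum_distrib_left sum_distrib_right mult_ac)
      then show ?thesis
        by (subst (asm) sint_sum) (auto simp: sint_cmult intro!: continuous_intros feat_cont f)
    qed
    have "sint (\<lambda>x. f x * bint (kern n x)) = sint (\<lambda>x. \<Sum>k<length (feat n). bint (?F n k) * (?F n k x * f x))"
      by (rule sint_cong) (simp add: b sum_distrib_left mult_ac)
    also have "\<dots> = (\<Sum>k<length (feat n). bint (?F n k) * sint (\<lambda>x. ?F n k x * f x))"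
      by (subst sint_sum) (auto simp: sint_cmult intro!: continuous_intros feat_cont f)
    also have "\<dots> = (\<Sum>k<length (feat n). sint (\<lambda>x. ?F n k x * f x) * bint (?F n k))"
      by (simp only: mult.commute[of "bint _"])
    also have "\<dots> = bint (\<lambda>y. \<Sum>k<length (feat n). sint (\<lambda>x. ?F n k x * f x) * ?F n k y)"
      by (subst bint_sum) (auto simp: bint_cmult intro!: continuous_intros feat_cont)
    also have "\<dots> = bint (\<lambda>y. sint (\<lambda>x. kern n y x * f x))"
      by (rule bint_cong) (simp only: s mult.commute[of "sint _"])
    finally show ?thesis .
  qed
  have CV: "(real n + 1) * C n = V" for n
  proof -
    have "4 * pi * C n = sint (\<lambda>x. 1 * bint (kern n x))"
      using sint_cong[of "\<lambda>x. 1 * bint (kern n x)" "\<lambda>x. C n"] C by (simp add: sint_const)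
    also have "\<dots> = bint (\<lambda>y. sint (\<lambda>x. kern n y x * 1))" by (rule dual) simp
    also have "\<dots> = bint (\<lambda>y. 4 * pi / (real n + 1) * 1)" by (rule bint_cong) (simp add: sint_kern)
    also have "\<dots> = 4 * pi / (real n + 1) * V" unfolding bint_cmult V_def ..
    finally have "(4 * pi) * ((real n + 1) * C n) = (4 * pi) * V" by (simp add: field_simps)
    then show ?thesis by (subst (asm) mult_cancel_left) auto
  qed
  have "bint f = V / (4 * pi) * sint f" if f: "continuous_on S2 f" for f
  proof -
    have av: "bint (avg n f) = V / (4 * pi) * sint f" for n
    proof -
      have "bint (avg n f) = (real n + 1) / (4 * pi) * bint (\<lambda>y. sint (\<lambda>x. kern n y x * f x))"
        unfolding avg_def bint_cmult ..
      also have "\<dots> = (real n + 1) / (4 * pi) * sint (\<lambda>x. f x * bint (kern n x))" by (simp only: dual[OF f])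
      also have "sint (\<lambda>x. f x * bint (kern n x)) = sint (\<lambda>x. C n * f x)"
        by (rule sint_cong) (simp add: C)
      also have "(real n + 1) / (4 * pi) * \<dots> = V / (4 * pi) * sint f"
        unfolding CV[of n, symmetric] sint_cmult by simp
      finally show ?thesis .
    qed
    have V0: "V \<ge> 0" using bint_mono[of "\<lambda>_. 0" "\<lambda>_. 1"] by (simp add: V_def bint_def)
    \<comment> \<open>Uniform approximation by averages, for which \<open>av\<close> is the claim,
      leaves an error of at most \<open>e\<close> times the total mass \<open>V\<close>.\<close>
    have le: "\<bar>bint f - V / (4 * pi) * sint f\<bar> \<le> e * V" if e: "e > 0" for e
    proof -
      obtain n where n: "\<And>x. x \<in> S2 \<Longrightarrow> \<bar>avg n f x - f x\<bar> < e"
        using eventually_happens'[OF sequentially_bot avg_tendsto[OF f e]] by blast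
      have "bint f - bint (avg n f) = bint (\<lambda>x. f x - avg n f x)"
        unfolding bint_def by (intro integral_diff[symmetric] integrable_pball f continuous_avg)
      moreover have "bint (\<lambda>x. f x - avg n f x) \<le> bint (\<lambda>x. e * 1)" "bint (\<lambda>x. (- e) * 1) \<le> bint (\<lambda>x. f x - avg n f x)"
        by (rule bint_mono; use n in \<open>force intro!: continuous_intros f continuous_avg simp: abs_less_iff\<close>)+
      ultimately show ?thesis unfolding bint_cmult V_def[symmetric] av by simp
    qed
    show ?thesis
    proof (rule ccontr)
      assume ne: "bint f \<noteq> V / (4 * pi) * sint f"
      define d where "d = \<bar>bint f - V / (4 * pi) * sint f\<bar>"
      have d: "d > 0" using ne by (simp add: d_def)
      have "d \<le> d / (2 * (V + 1)) * V" unfolding d_def by (rule le) (use d V0 in \<open>auto simp: d_def\<close>)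
      also have "\<dots> < d"
      proof -
        have "0 < V * d + d * 2" using d V0 by (intro add_nonneg_pos mult_nonneg_nonneg) auto
        then show ?thesis using V0 by (simp add: field_simps)
      qed
      finally show False by simp
    qed
  qed
  moreover have "V > 0"
  proof -
    have "pball \<in> lmeasurable" by (intro fmeasurable_Diff lmeasurable_ball) simp
    then have "V = measure lebesgue pball" by (simp only: V_def bint_def lmeasure_integral)
    also have "\<dots> = measure lebesgue (ball (0 :: real^3) 1)"
      by (rule measure_negligible_symdiff[OF lmeasurable_ball]) (rule negligible_subset[of "{0}"], auto)
    also have "\<dots> > 0" by (simp add: measure_completion content_ball_pos)
    finally show ?thesis .
  qed
  ultimately show ?thesis using that[of "V / (4 * pi)"] by simp
qed

text \<open>A derivative within the sphere is not unique in the normal direction. On tangent vectors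
  every choice agrees with the gradient.\<close>

lemma tangent_derivative:
  fixes f :: "real^3 \<Rightarrow> real"
  assumes L: "(f has_derivative L) (at x within S2)" and x: "x \<in> S2" and v: "v \<bullet> x = 0"
  shows "L v = grad_S2 f x \<bullet> v"
proof -
  have lin: "linear L" using L by (rule has_derivative_linear)
  define d where "d = adjoint L 1"
  have Ld: "L = (\<lambda>u. d \<bullet> u)"
    using adjoint_works[OF lin, of _ 1] by (auto simp: d_def inner_commute)
  have "grad_S2 f x = d - (d \<bullet> x) *\<^sub>R x"
    by (rule grad_S2_eqI[OF has_derivative_within_S2_proj[OF L[unfolded Ld] x] _ x])
       (use x in \<open>simp add: inner_diff_left dot_square_norm\<close>)
  then show ?thesis using v by (simp add: Ld inner_diff_left inner_commute[of x v])
qed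

text \<open>
  The differential of a conformal map at a point \<open>x\<close>, extended by \<open>x \<mapsto> \<Phi> x\<close> to a linear map
  \<open>A x\<close> of the ambient space: it is the differential of \<open>y \<mapsto> |y| \<Phi> (y / |y|)\<close>.
\<close>
locale conformal_S2 =
  fixes \<Phi> :: "real^3 \<Rightarrow> real^3" and D :: "real^3 \<Rightarrow> real^3 \<Rightarrow> real^3" and c :: "real^3 \<Rightarrow> real"
  assumes bij: "bij_betw \<Phi> S2 S2" and smooth: "smooth_S2 (\<lambda>x. \<Phi> x $ i)"
    and der: "x \<in> S2 \<Longrightarrow> (\<Phi> has_derivative D x) (at x within S2)"
    and c_pos: "x \<in> S2 \<Longrightarrow> c x > 0"
    and conf: "x \<in> S2 \<Longrightarrow> v \<bullet> x = 0 \<Longrightarrow> w \<bullet> x = 0 \<Longrightarrow> D x v \<bullet> D x w = c x * (v \<bullet> w)"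
begin

lemma range: "x \<in> S2 \<Longrightarrow> \<Phi> x \<in> S2"
  using bij by (auto simp: bij_betw_def simp del: mem_sphere_0)

lemma continuous: "continuous_on S2 \<Phi>"
  unfolding continuous_on_eq_continuous_within by (rule ballI, rule has_derivative_continuous[OF der])

lemma continuous_compose: "continuous_on S2 f \<Longrightarrow> continuous_on S2 (\<lambda>x. f (\<Phi> x) :: real)"
  by (rule continuous_on_compose2[OF _ continuous]) (use range in auto)

definition A :: "real^3 \<Rightarrow> real^3 \<Rightarrow> real^3"
  where "A x v = (x \<bullet> v) *\<^sub>R \<Phi> x + D x (v - (x \<bullet> v) *\<^sub>R x)"

lemma linear_D: "x \<in> S2 \<Longrightarrow> linear (D x)"
  using der has_derivative_linear by blast

lemma linear_A: "x \<in> S2 \<Longrightarrow> linear (A x)"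
proof (rule linearI)
  assume x: "x \<in> S2"
  note l = linear_D[OF x]
  show "A x (u + v) = A x u + A x v" for u v
    unfolding A_def by (simp add: inner_add_right algebra_simps linear_add[OF l] linear_diff[OF l] linear_scale[OF l])
  show "A x (a *\<^sub>R v) = a *\<^sub>R A x v" for a v
    unfolding A_def by (simp add: algebra_simps linear_diff[OF l] linear_scale[OF l])
qed

lemma D_tangent:
  assumes x: "x \<in> S2" and v: "v \<bullet> x = 0"
  shows "\<Phi> x \<bullet> D x v = 0"
proof -
  have "((\<lambda>y. \<Phi> y \<bullet> \<Phi> y) has_derivative (\<lambda>v. \<Phi> x \<bullet> D x v + D x v \<bullet> \<Phi> x)) (at x within S2)"
    by (rule has_derivative_inner[OF der[OF x] der[OF x]])
  from tangent_derivative[OF this x v]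
  have "2 * (\<Phi> x \<bullet> D x v) = grad_S2 (\<lambda>y. \<Phi> y \<bullet> \<Phi> y) x \<bullet> v" by (simp add: inner_commute)
  also have "grad_S2 (\<lambda>y. \<Phi> y \<bullet> \<Phi> y) x = grad_S2 (\<lambda>y. 1) x"
    by (rule grad_S2_cong) (use range x in \<open>auto simp: dot_square_norm\<close>)
  finally show ?thesis by (simp add: grad_S2_const[OF x])
qed

lemma A_inner:
  assumes x: "x \<in> S2"
  shows "A x v \<bullet> A x w = c x * (v \<bullet> w) + (1 - c x) * (x \<bullet> v) * (x \<bullet> w)"
proof -
  have xx: "x \<bullet> x = 1" "\<Phi> x \<bullet> \<Phi> x = 1" using x range[OF x] by (simp_all add: norm_eq_1)
  have t: "(u - (x \<bullet> u) *\<^sub>R x) \<bullet> x = 0" for u using xx by (simp add: inner_diff_left inner_diff_right inner_commute)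
  have "A x v \<bullet> A x w = (x \<bullet> v) * (x \<bullet> w) + c x * ((v - (x \<bullet> v) *\<^sub>R x) \<bullet> (w - (x \<bullet> w) *\<^sub>R x))"
    unfolding A_def inner_add_left inner_add_right
    using xx D_tangent[OF x t] conf[OF x t t] by (simp add: inner_commute[of "D x _" "\<Phi> x"])
  also have "(v - (x \<bullet> v) *\<^sub>R x) \<bullet> (w - (x \<bullet> w) *\<^sub>R x) = v \<bullet> w - (x \<bullet> v) * (x \<bullet> w)"
    using xx by (simp add: inner_diff_left inner_diff_right inner_commute)
  finally show ?thesis by (simp add: algebra_simps)
qed

text \<open>By \<open>A_inner\<close> the Gram matrix is \<open>c x\<close> on the tangent plane and
  1 on the normal, so its determinant is \<open>(c x)\<^sup>2\<close>.\<close>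

lemma det_A:
  assumes x: "x \<in> S2"
  shows "\<bar>det (matrix (A x))\<bar> = c x"
proof -
  define m where "m = matrix (A x)"
  have mA: "m *v v = A x v" for v
    unfolding m_def by (rule matrix_works[OF linear_matrix_vector_mul_eq[THEN iffD2, OF linear_A[OF x]]])
  have col: "(transpose m ** m) $ i $ j = (if i = j then c x else 0) + (1 - c x) * x $ i * x $ j" for i j
  proof -
    have "(transpose m ** m) $ i $ j = (m *v axis i 1) \<bullet> (m *v axis j 1)"
      by (simp add: matrix_matrix_mult_def transpose_def inner_vec_def matrix_vector_mult_basis column_def)
    also have "\<dots> = c x * ((axis i 1 :: real^3) \<bullet> axis j 1) + (1 - c x) * (x \<bullet> axis i 1) * (x \<bullet> axis j 1)"
      unfolding mA by (rule A_inner[OF x])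
    also have "(axis i 1 :: real^3) \<bullet> axis j 1 = (if i = j then 1 else 0)" by (simp add: inner_axis_axis)
    finally show ?thesis by (simp add: inner_axis)
  qed
  have xx: "x$1 * x$1 + x$2 * x$2 + x$3 * x$3 = 1"
    using x by (simp add: norm_eq_1 inner_vec_def sum_3)
  have "(det m)\<^sup>2 = det (transpose m ** m)" by (simp add: det_mul power2_eq_square)
  also have "\<dots> = (c x)\<^sup>2 * (c x + (1 - c x) * (x$1 * x$1 + x$2 * x$2 + x$3 * x$3))"
    unfolding det_3 col by (simp add: power2_eq_square) algebra
  also have "\<dots> = (c x)\<^sup>2" unfolding xx by simp
  finally have "\<bar>det m\<bar> = \<bar>c x\<bar>" by (simp only: power2_eq_iff abs_eq_iff)
  then show ?thesis using c_pos[OF x] by (simp add: m_def)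
qed

definition F :: "real^3 \<Rightarrow> real^3"
  where "F y = norm y *\<^sub>R \<Phi> (sgn y)"

text \<open>\<open>F\<close> is homogeneous of degree one: the \<open>1 / norm y\<close> from the
  derivative of \<open>sgn\<close> cancels, and the derivative depends on the direction of
  \<open>y\<close> alone.\<close>

lemma F_derivative:
  assumes y: "y \<in> pball"
  shows "(F has_derivative A (sgn y)) (at y within pball)"
proof -
  let ?x = "sgn y"
  have y0: "y \<noteq> 0" and x: "?x \<in> S2" using y by (auto simp: norm_sgn)
  have yx: "y = norm y *\<^sub>R ?x" using y0 by (simp add: sgn_div_norm)
  have dn: "(norm has_derivative (\<lambda>h. ?x \<bullet> h)) (at y within pball)"
  proof -
    have eq: "(\<lambda>h. ?x \<bullet> h) = (\<lambda>h. h \<bullet> ?x)" by (rule ext) (rule inner_commute)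
    show ?thesis unfolding eq by (rule has_derivative_at_withinI[OF has_derivative_norm[OF y0]])
  qed
  have ds: "(sgn has_derivative (\<lambda>v. (v - (?x \<bullet> v) *\<^sub>R ?x) /\<^sub>R norm y)) (at y within pball)"
  proof -
    have "((\<lambda>z. inverse (norm z) *\<^sub>R z) has_derivative
        (\<lambda>v. inverse (norm y) *\<^sub>R v + (- (inverse (norm y) * (?x \<bullet> v) * inverse (norm y))) *\<^sub>R y)) (at y within pball)"
      by (rule has_derivative_scaleR[OF Deriv.has_derivative_inverse[OF _ dn] has_derivative_ident]) (use y0 in simp)
    moreover have "(\<lambda>v. inverse (norm y) *\<^sub>R v + (- (inverse (norm y) * (?x \<bullet> v) * inverse (norm y))) *\<^sub>R y)
        = (\<lambda>v. (v - (?x \<bullet> v) *\<^sub>R ?x) /\<^sub>R norm y)"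
      by (rule ext) (simp add: sgn_div_norm scaleR_diff_right mult_ac)
    moreover have "sgn = (\<lambda>z :: real^3. inverse (norm z) *\<^sub>R z)"
      by (rule ext) (rule sgn_div_norm)
    ultimately show ?thesis by simp
  qed
  have dP: "((\<lambda>z. \<Phi> (sgn z)) has_derivative (\<lambda>v. D ?x ((v - (?x \<bullet> v) *\<^sub>R ?x) /\<^sub>R norm y))) (at y within pball)"
    by (rule has_derivative_in_compose[OF ds])
       (rule has_derivative_subset[OF der[OF x]], auto simp: norm_sgn split: if_splits)
  have "(F has_derivative (\<lambda>v. norm y *\<^sub>R D ?x ((v - (?x \<bullet> v) *\<^sub>R ?x) /\<^sub>R norm y) + (?x \<bullet> v) *\<^sub>R \<Phi> ?x)) (at y within pball)"
    unfolding F_def by (rule has_derivative_scaleR[OF dn dP])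
  moreover have "(\<lambda>v. norm y *\<^sub>R D ?x ((v - (?x \<bullet> v) *\<^sub>R ?x) /\<^sub>R norm y) + (?x \<bullet> v) *\<^sub>R \<Phi> ?x) = A ?x"
    using y0 by (simp add: A_def fun_eq_iff linear_scale[OF linear_D[OF x]])
  ultimately show ?thesis by simp
qed

lemma sgn_F: "y \<in> pball \<Longrightarrow> sgn (F y) = \<Phi> (sgn y)" and norm_F: "y \<in> pball \<Longrightarrow> norm (F y) = norm y"
proof -
  assume y: "y \<in> pball"
  then have n: "norm (\<Phi> (sgn y)) = 1" using range[of "sgn y"] by (simp add: norm_sgn)
  then show "norm (F y) = norm y" by (simp add: F_def)
  show "sgn (F y) = \<Phi> (sgn y)" using y n by (simp add: F_def sgn_scaleR sgn_div_norm)
qed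

lemma F_inj: "inj_on F pball"
proof (rule inj_onI)
  fix y z assume yz: "y \<in> pball" "z \<in> pball" "F y = F z"
  then have "\<Phi> (sgn y) = \<Phi> (sgn z)" "norm y = norm z" using sgn_F norm_F by metis+
  moreover have "sgn y \<in> S2" "sgn z \<in> S2" using yz by (auto simp: norm_sgn)
  ultimately have "sgn y = sgn z" using bij by (simp add: bij_betw_def inj_on_def)
  then show "y = z" using \<open>norm y = norm z\<close> yz by (auto simp: sgn_div_norm)
qed

lemma F_image: "F ` pball = pball"
proof
  show "F ` pball \<subseteq> pball"
  proof
    fix z assume "z \<in> F ` pball"
    then obtain y where y: "y \<in> pball" "z = F y" by blast
    then have "norm z = norm y" using norm_F by simp
    then show "z \<in> pball" using y(1) by auto
  qed
  show "pball \<subseteq> F ` pball"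
  proof
    fix z assume z: "z \<in> pball"
    then have "sgn z \<in> \<Phi> ` S2" using bij by (simp add: bij_betw_def norm_sgn)
    then obtain x where x: "x \<in> S2" "\<Phi> x = sgn z" by (metis imageE)
    have "norm z *\<^sub>R x \<in> pball" using z x(1) by auto
    moreover have "F (norm z *\<^sub>R x) = z"
      using z x by (simp add: F_def sgn_scaleR) (simp add: sgn_div_norm)
    ultimately show "z \<in> F ` pball" by (metis imageI)
  qed
qed

text \<open>\<open>c\<close> is a bare pointwise factor without known continuity, so the transformed
  integrand enters as a function \<open>g\<close> that is continuous for other reasons.\<close>

lemma change_of_variables:
  assumes f: "continuous_on S2 f" and g: "continuous_on S2 g"
    and gf: "\<And>x. x \<in> S2 \<Longrightarrow> g x = c x * f (\<Phi> x)"
  shows "sint g = sint f"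
proof -
  obtain \<kappa> where \<kappa>: "\<And>f. continuous_on S2 f \<Longrightarrow> bint f = \<kappa> * sint f" "\<kappa> > 0"
    using bint_eq_sint by blast
  have "integral pball (\<lambda>y. \<bar>det (matrix (A (sgn y)))\<bar> * f (sgn (F y))) = integral (F ` pball) (\<lambda>y. f (sgn y))"
    by (rule change_of_variables_real[OF pball_lebesgue F_derivative F_inj])
       (simp_all only: F_image absolutely_integrable_pball[OF f])
  moreover have "integral pball (\<lambda>y. \<bar>det (matrix (A (sgn y)))\<bar> * f (sgn (F y))) = bint g"
    unfolding bint_def
  proof (rule integral_cong)
    fix y assume y: "y \<in> pball"
    then have x: "sgn y \<in> S2" by (auto simp: norm_sgn)
    show "\<bar>det (matrix (A (sgn y)))\<bar> * f (sgn (F y)) = g (sgn y)"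
      by (simp add: det_A[OF x] gf[OF x] sgn_F[OF y])
  qed
  ultimately have "bint g = bint f" by (simp add: F_image bint_def)
  then show ?thesis using \<kappa>(1)[OF f] \<kappa>(1)[OF g] \<kappa>(2) by simp
qed

text \<open>By the chain rule the gradient \<open>g\<close> of the composition is the adjoint of
  \<open>A x\<close> applied to the gradient \<open>w\<close>. As \<open>A x\<close> is onto and
  multiplies tangential inner products by \<open>c x\<close>, this amounts to
  \<open>A x g = c x *\<^sub>R w\<close>, from which the lengths are read off.\<close>

lemma grad_compose:
  assumes p: "smooth_S2 p" and p\<Phi>: "smooth_S2 (\<lambda>x. p (\<Phi> x))" and x: "x \<in> S2"
  shows "grad_S2 (\<lambda>x. p (\<Phi> x)) x \<bullet> grad_S2 (\<lambda>x. p (\<Phi> x)) x = c x * (grad_S2 p (\<Phi> x) \<bullet> grad_S2 p (\<Phi> x))"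
proof -
  define w where "w = grad_S2 p (\<Phi> x)"
  define g where "g = grad_S2 (\<lambda>x. p (\<Phi> x)) x"
  have y: "\<Phi> x \<in> S2" by (rule range[OF x])
  have xx: "x \<bullet> x = 1" using x by (simp add: norm_eq_1)
  have w0: "w \<bullet> \<Phi> x = 0" unfolding w_def by (rule smooth_S2_grad(2)[OF p y])
  have g0: "g \<bullet> x = 0" unfolding g_def by (rule smooth_S2_grad(2)[OF p\<Phi> x])
  have dc: "((\<lambda>x. p (\<Phi> x)) has_derivative (\<lambda>v. w \<bullet> D x v)) (at x within S2)"
    unfolding w_def
    by (rule has_derivative_in_compose[OF der[OF x]])
       (rule has_derivative_subset[OF smooth_S2_grad(1)[OF p y]], use range in auto)
  have gv: "g \<bullet> v = w \<bullet> A x v" for v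
  proof -
    define t where "t = v - (x \<bullet> v) *\<^sub>R x"
    have t: "t \<bullet> x = 0" using xx by (simp add: t_def inner_diff_left inner_diff_right inner_commute)
    have "g \<bullet> v = g \<bullet> t" using g0 by (simp add: t_def inner_diff_right)
    also have "\<dots> = w \<bullet> D x t" unfolding g_def using tangent_derivative[OF dc x t] by simp
    also have "\<dots> = w \<bullet> A x v" using w0 by (simp add: A_def t_def inner_add_right)
    finally show ?thesis .
  qed
  have "A x g \<bullet> A x v = (c x *\<^sub>R w) \<bullet> A x v" for v
    unfolding A_inner[OF x] using g0 gv[of v] by (simp add: inner_commute)
  moreover have "surj (A x)"
  proof (rule linear_inj_imp_surj[OF linear_A[OF x]])
    show "inj (A x)"
    proof (subst linear_injective_0[OF linear_A[OF x]], intro allI impI)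
      fix v assume "A x v = 0"
      then have "0 = c x * (v \<bullet> v - (x \<bullet> v)\<^sup>2) + (x \<bullet> v)\<^sup>2"
        using A_inner[OF x, of v v] by (simp add: power2_eq_square algebra_simps)
      moreover have "v \<bullet> v - (x \<bullet> v)\<^sup>2 \<ge> 0"
        using Cauchy_Schwarz_ineq[of x v] xx by simp
      then have "c x * (v \<bullet> v - (x \<bullet> v)\<^sup>2) \<ge> 0" using c_pos[OF x] by simp
      ultimately have z: "c x * (v \<bullet> v - (x \<bullet> v)\<^sup>2) = 0" "(x \<bullet> v)\<^sup>2 = 0"
        using zero_le_power2[of "x \<bullet> v"] by linarith+
      then show "v = 0" using c_pos[OF x] by simp
    qed
  qed
  then obtain v where "A x v = A x g - c x *\<^sub>R w" by (metis surj_def)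
  ultimately have "(A x g - c x *\<^sub>R w) \<bullet> (A x g - c x *\<^sub>R w) = 0"
    by (metis inner_diff_left right_minus_eq)
  then have Ag: "A x g = c x *\<^sub>R w" by simp
  have "c x * (g \<bullet> g) = A x g \<bullet> A x g" unfolding A_inner[OF x] using g0 by (simp add: inner_commute)
  also have "\<dots> = c x * (c x * (w \<bullet> w))" by (simp add: Ag)
  finally show ?thesis using c_pos[OF x] by (simp add: g_def w_def)
qed

lemma dirichlet_compose:
  assumes p: "smooth_S2 p" and p\<Phi>: "smooth_S2 (\<lambda>x. p (\<Phi> x))"
  shows "dirichlet (\<lambda>x. p (\<Phi> x)) = dirichlet p"
  unfolding dirichlet_def
  by (rule change_of_variables) (auto intro!: smooth_S2_continuous p p\<Phi> simp: grad_compose[OF p p\<Phi>])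

text \<open>Half the energy density of the components of \<open>\<Phi>\<close> equals
  \<open>c\<close>, since \<open>\<Phi>\<close> has unit length on the sphere. So \<open>c\<close>
  is continuous there and has a positive minimum. The constant depends on \<open>\<Phi>\<close>; it
  serves to make the dual norm of the image measure finite.\<close>

lemma sint_compose_le:
  obtains K where "\<And>f. continuous_on S2 f \<Longrightarrow> (\<And>x. x \<in> S2 \<Longrightarrow> 0 \<le> f x) \<Longrightarrow> sint (\<lambda>x. f (\<Phi> x)) \<le> K * sint f" "K > 0"
proof -
  define C where "C x = (\<Sum>i\<in>UNIV. grad_S2 (\<lambda>x. \<Phi> x $ i) x \<bullet> grad_S2 (\<lambda>x. \<Phi> x $ i) x) / 2" for x
  have Cc: "C x = c x" if x: "x \<in> S2" for x
  proof -
    have "grad_S2 (\<lambda>x. \<Phi> x $ i) x \<bullet> grad_S2 (\<lambda>x. \<Phi> x $ i) x = c x * (1 - \<Phi> x $ i * \<Phi> x $ i)" for i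
    proof -
      have *: "(\<lambda>x. \<Phi> x $ i) = (\<lambda>x. axis i 1 \<bullet> \<Phi> x)" by (simp add: inner_axis')
      show ?thesis
        unfolding *
        by (subst grad_compose[OF smooth_S2_inner _ x], use smooth[of i] * in simp)
           (simp add: grad_S2_inner_inner[OF range[OF x]] inner_axis' inner_axis_axis)
    qed
    then have "C x = (\<Sum>i\<in>UNIV. c x * (1 - \<Phi> x $ i * \<Phi> x $ i)) / 2"
      by (simp only: C_def)
    also have "\<dots> = c x * (3 - \<Phi> x \<bullet> \<Phi> x) / 2"
      by (simp add: inner_vec_def sum_3 algebra_simps)
    also have "\<Phi> x \<bullet> \<Phi> x = 1" using range[OF x] by (simp add: norm_eq_1)
    finally show ?thesis by simp
  qed
  have contC: "continuous_on S2 C"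
    unfolding C_def by (intro continuous_intros smooth_S2_continuous smooth_S2_grad_inner smooth) auto
  have "S2 \<noteq> ({} :: (real^3) set)" by (simp add: sphere_eq_empty)
  then obtain x0 where x0: "x0 \<in> S2" "\<And>x. x \<in> S2 \<Longrightarrow> C x0 \<le> C x"
    using continuous_attains_inf[OF compact_sphere _ contC] by blast
  have c0: "C x0 > 0" using c_pos[OF x0(1)] Cc[OF x0(1)] by simp
  have "sint (\<lambda>x. f (\<Phi> x)) \<le> 1 / C x0 * sint f"
    if f: "continuous_on S2 f" and pos: "\<And>x. x \<in> S2 \<Longrightarrow> 0 \<le> f x" for f
  proof -
    have "sint (\<lambda>x. f (\<Phi> x)) \<le> sint (\<lambda>x. 1 / C x0 * (C x * f (\<Phi> x)))"
    proof (rule sint_mono)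
      fix x assume x: "x \<in> S2"
      have "C x0 * f (\<Phi> x) \<le> C x * f (\<Phi> x)" using x0(2)[OF x] pos[OF range[OF x]] by (rule mult_right_mono)
      then show "f (\<Phi> x) \<le> 1 / C x0 * (C x * f (\<Phi> x))" using c0 by (simp add: field_simps)
    qed (intro continuous_intros contC continuous_compose f)+
    also have "\<dots> = 1 / C x0 * sint (\<lambda>x. C x * f (\<Phi> x))" by (rule sint_cmult)
    also have "sint (\<lambda>x. C x * f (\<Phi> x)) = sint f"
      by (rule change_of_variables[OF f]) (auto intro!: continuous_intros contC continuous_compose f simp: Cc)
    finally show ?thesis .
  qed
  note * = this
  show ?thesis
  proof (rule that[of "1 / C x0"])
    show "1 / C x0 > 0" using c0 by simp
  qed (rule *)
qed

lemma measurable: "\<Phi> \<in> borel_S2 \<rightarrow>\<^sub>M borel_S2"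
  by (rule measurable_restrict_space2)
     (use range borel_measurable_continuous_on_restrict[OF continuous] in \<open>auto simp: space_restrict_space\<close>)

end

lemma conformal_automorphismE:
  assumes "conformal_automorphism \<Phi>"
  obtains D c where "conformal_S2 \<Phi> D c"
proof -
  have "\<forall>x\<in>S2. \<exists>D c. (\<Phi> has_derivative D) (at x within S2) \<and> c > 0 \<and>
       (\<forall>v w. v \<bullet> x = 0 \<and> w \<bullet> x = 0 \<longrightarrow> D v \<bullet> D w = c * (v \<bullet> w))"
    using assms unfolding conformal_automorphism_def by blast
  from bchoice[OF this] obtain D where "\<forall>x\<in>S2. \<exists>c. (\<Phi> has_derivative D x) (at x within S2) \<and> c > 0 \<and>
       (\<forall>v w. v \<bullet> x = 0 \<and> w \<bullet> x = 0 \<longrightarrow> D x v \<bullet> D x w = c * (v \<bullet> w))" ..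
  from bchoice[OF this] obtain c where "\<forall>x\<in>S2. (\<Phi> has_derivative D x) (at x within S2) \<and> c x > 0 \<and>
       (\<forall>v w. v \<bullet> x = 0 \<and> w \<bullet> x = 0 \<longrightarrow> D x v \<bullet> D x w = c x * (v \<bullet> w))" ..
  then have "conformal_S2 \<Phi> D c"
    using assms unfolding conformal_automorphism_def by unfold_locales blast+
  then show ?thesis using that by blast
qed

section \<open>Spherical harmonics of degree at most two\<close>

lemma Lap_diff:
  assumes "smooth_S2 f" "smooth_S2 g" "x \<in> S2"
  shows "Lap (\<lambda>x. f x - g x) x = Lap f x - Lap g x"
  using Lap_add[OF assms(1) smooth_S2_cmult[OF assms(2)] assms(3), of "-1"] Lap_cmult[OF assms(2,3), of "-1"]
  by simp

lemma sint_eigen_orthogonal: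
  assumes f: "smooth_S2 f" and g: "smooth_S2 g"
    and Lf: "\<And>x. x \<in> S2 \<Longrightarrow> Lap f x = - l * f x" and Lg: "\<And>x. x \<in> S2 \<Longrightarrow> Lap g x = - m * g x" and ne: "l \<noteq> m"
  shows "sint (\<lambda>x. f x * g x) = 0"
proof -
  have "sint (\<lambda>x. Lap f x * g x) = sint (\<lambda>x. - l * (f x * g x))" by (rule sint_cong) (simp add: Lf)
  moreover have "sint (\<lambda>x. f x * Lap g x) = sint (\<lambda>x. - m * (f x * g x))" by (rule sint_cong) (simp add: Lg)
  ultimately have "- l * sint (\<lambda>x. f x * g x) = - m * sint (\<lambda>x. f x * g x)"
    using sint_Lap_sym[OF f g] by (simp only: sint_cmult)
  then show ?thesis using ne by simp
qed

text \<open>The eigenvalue of degree four is \<open>4 * 5 = 20\<close>. Each of the six further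
  terms of the Laplacian contracts one pair of vectors, and \<open>sint_inner_inner\<close>
  evaluates what remains.\<close>

lemma sint_quartic:
  "sint (\<lambda>x. ((a \<bullet> x) * (b \<bullet> x)) * ((c \<bullet> x) * (d \<bullet> x)))
    = 4 * pi / 15 * ((a \<bullet> b) * (c \<bullet> d) + (a \<bullet> c) * (b \<bullet> d) + (a \<bullet> d) * (b \<bullet> c))"
    (is "sint ?P = _")
proof -
  let ?q = "\<lambda>a b x. (a \<bullet> x) * (b \<bullet> x) :: real"
  have s: "smooth_S2 (?q a b)" for a b by (intro smooth_S2_mult smooth_S2_inner)
  have L: "Lap ?P x = - 20 * ?P x + 2 * ((c \<bullet> d) * ?q a b x + (a \<bullet> b) * ?q c d x + (b \<bullet> d) * ?q a c x
      + (b \<bullet> c) * ?q a d x + (a \<bullet> d) * ?q b c x + (a \<bullet> c) * ?q b d x)" if x: "x \<in> S2" for x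
  proof -
    have g: "grad_S2 (?q a b) x = (a \<bullet> x) *\<^sub>R grad_S2 (\<lambda>x. b \<bullet> x) x + (b \<bullet> x) *\<^sub>R grad_S2 (\<lambda>x. a \<bullet> x) x" for a b
      by (rule grad_S2_mult) (use x in auto)
    show ?thesis
      by (subst Lap_mult[OF s s x], unfold Lap_inner_inner[OF x] g)
         (simp only: inner_add_left inner_add_right inner_scaleR_left inner_scaleR_right grad_S2_inner_inner[OF x],
          simp add: algebra_simps)
  qed
  have c: "continuous_on S2 (?q a b)" for a b by (intro continuous_intros)
  have cP: "continuous_on S2 ?P" by (intro continuous_intros)
  have "0 = sint (Lap ?P)" by (rule sint_Lap[symmetric]) (intro smooth_S2_mult smooth_S2_inner)
  also have "\<dots> = sint (\<lambda>x. - 20 * ?P x + 2 * ((c \<bullet> d) * ?q a b x + (a \<bullet> b) * ?q c d x + (b \<bullet> d) * ?q a c x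
      + (b \<bullet> c) * ?q a d x + (a \<bullet> d) * ?q b c x + (a \<bullet> c) * ?q b d x))"
    by (rule sint_cong) (rule L)
  also have "\<dots> = - 20 * sint ?P + 2 * ((c \<bullet> d) * sint (?q a b) + (a \<bullet> b) * sint (?q c d) + (b \<bullet> d) * sint (?q a c)
      + (b \<bullet> c) * sint (?q a d) + (a \<bullet> d) * sint (?q b c) + (a \<bullet> c) * sint (?q b d))"
    by (simp only: sint_add sint_cmult continuous_on_add continuous_on_mult continuous_on_const c cP)
  finally show ?thesis unfolding sint_inner_inner by (simp add: field_simps)
qed

lemma sint_quartic_minus:
  "sint (\<lambda>x. ((a \<bullet> x) * (b \<bullet> x)) * (3 * ((c \<bullet> x) * (c \<bullet> x)) - 1))
    = 4 * pi / 5 * ((a \<bullet> b) * (c \<bullet> c) + 2 * ((a \<bullet> c) * (b \<bullet> c))) - 4 * pi / 3 * (a \<bullet> b)"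
proof -
  have "sint (\<lambda>x. ((a \<bullet> x) * (b \<bullet> x)) * (3 * ((c \<bullet> x) * (c \<bullet> x)) - 1))
    = sint (\<lambda>x. 3 * (((a \<bullet> x) * (b \<bullet> x)) * ((c \<bullet> x) * (c \<bullet> x))) - (a \<bullet> x) * (b \<bullet> x))"
    by (rule sint_cong) (simp add: algebra_simps)
  also have "\<dots> = 3 * sint (\<lambda>x. ((a \<bullet> x) * (b \<bullet> x)) * ((c \<bullet> x) * (c \<bullet> x))) - sint (\<lambda>x. (a \<bullet> x) * (b \<bullet> x))"
    by (subst sint_diff) (auto simp only: sint_cmult intro!: continuous_intros)
  finally show ?thesis unfolding sint_quartic sint_inner_inner by (simp add: algebra_simps)
qed

abbreviation ax :: "3 \<Rightarrow> real^3" where "ax i \<equiv> axis i 1"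

text \<open>An unnormalised orthogonal basis of the harmonics of degree 0 (index 0), 1 (indices 1 to
  3) and 2 (indices 4 to 8). They are written with products of linear functions so that
  \<open>sint_quartic\<close> applies; index 8 is the zonal harmonic about the third axis, which is
  also the axis of \<open>psi\<close>.\<close>

definition sharm :: "nat \<Rightarrow> real^3 \<Rightarrow> real"
  where "sharm k x = [1, ax 1 \<bullet> x, ax 2 \<bullet> x, ax 3 \<bullet> x,
    (ax 1 \<bullet> x) * (ax 2 \<bullet> x), (ax 1 \<bullet> x) * (ax 3 \<bullet> x), (ax 2 \<bullet> x) * (ax 3 \<bullet> x),
    ((ax 1 - ax 2) \<bullet> x) * ((ax 1 + ax 2) \<bullet> x), 3 * ((ax 3 \<bullet> x) * (ax 3 \<bullet> x)) - 1] ! k"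

definition sharm_ev :: "nat \<Rightarrow> real"
  where "sharm_ev k = (if k = 0 then 0 else if k \<le> 3 then 2 else 6)"

lemma sharm_simps:
  "sharm 0 = (\<lambda>x. 1)" "sharm 1 = (\<lambda>x. ax 1 \<bullet> x)" "sharm 2 = (\<lambda>x. ax 2 \<bullet> x)" "sharm 3 = (\<lambda>x. ax 3 \<bullet> x)"
  "sharm 4 = (\<lambda>x. (ax 1 \<bullet> x) * (ax 2 \<bullet> x))" "sharm 5 = (\<lambda>x. (ax 1 \<bullet> x) * (ax 3 \<bullet> x))"
  "sharm 6 = (\<lambda>x. (ax 2 \<bullet> x) * (ax 3 \<bullet> x))"
  "sharm 7 = (\<lambda>x. ((ax 1 - ax 2) \<bullet> x) * ((ax 1 + ax 2) \<bullet> x))"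
  "sharm 8 = (\<lambda>x. 3 * ((ax 3 \<bullet> x) * (ax 3 \<bullet> x)) - 1)"
  by (simp_all add: sharm_def fun_eq_iff)

lemma less_9_cases:
  assumes "k < (9::nat)"
  obtains "k = 0" | "k = 1" | "k = 2" | "k = 3" | "k = 4" | "k = 5" | "k = 6" | "k = 7" | "k = 8"
  using assms by linarith

lemma sharm_smooth: "k < 9 \<Longrightarrow> smooth_S2 (sharm k)"
  by (erule less_9_cases; simp only: sharm_simps;
      intro smooth_S2_mult smooth_S2_diff smooth_S2_const smooth_S2_inner)

lemma ax_inner: "ax i \<bullet> ax j = (if i = j then 1 else 0)"
  by (simp add: inner_axis_axis)

lemma sharm_Lap:
  assumes "k < 9" and x: "x \<in> S2"
  shows "Lap (sharm k) x = - sharm_ev k * sharm k x"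
proof -
  have q: "Lap (\<lambda>x. (a \<bullet> x) * (b \<bullet> x)) x = - 6 * ((a \<bullet> x) * (b \<bullet> x))" if "a \<bullet> b = 0" for a b
    using Lap_inner_inner[OF x, of a b] that by simp
  have 8: "Lap (\<lambda>x. 3 * ((ax 3 \<bullet> x) * (ax 3 \<bullet> x)) - 1) x = - 6 * (3 * ((ax 3 \<bullet> x) * (ax 3 \<bullet> x)) - 1)"
  proof -
    have "Lap (\<lambda>x. 3 * ((ax 3 \<bullet> x) * (ax 3 \<bullet> x)) - 1) x = Lap (\<lambda>x. 3 * ((ax 3 \<bullet> x) * (ax 3 \<bullet> x))) x - Lap (\<lambda>x. 1) x"
      by (rule Lap_diff[OF _ _ x]) (intro smooth_S2_mult smooth_S2_const smooth_S2_inner)+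
    also have "Lap (\<lambda>x. 3 * ((ax 3 \<bullet> x) * (ax 3 \<bullet> x))) x = 3 * Lap (\<lambda>x. (ax 3 \<bullet> x) * (ax 3 \<bullet> x)) x"
      by (rule Lap_cmult[OF _ x]) (intro smooth_S2_mult smooth_S2_inner)
    finally show ?thesis by (simp only: Lap_inner_inner[OF x] Lap_const[OF x] ax_inner) simp
  qed
  have o: "ax 1 \<bullet> ax 2 = 0" "ax 1 \<bullet> ax 3 = 0" "ax 2 \<bullet> ax 3 = 0" "(ax 1 - ax 2) \<bullet> (ax 1 + ax 2) = 0"
    by (simp_all add: ax_inner inner_diff_left inner_add_right)
  show ?thesis
    using assms(1)
    by (rule less_9_cases)
       (simp_all only: sharm_simps sharm_ev_def Lap_const[OF x] Lap_inner[OF x]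
         q[OF o(1)] q[OF o(2)] q[OF o(3)] q[OF o(4)] 8, simp_all)
qed

text \<open>Different degrees are orthogonal by symmetry of the Laplacian; within one degree the
  integrals are computed.\<close>

lemma sharm_orthogonal:
  assumes j: "j < 9" and k: "k < 9" and jk: "j \<noteq> k"
  shows "sint (\<lambda>x. sharm j x * sharm k x) = 0"
proof (cases "sharm_ev j = sharm_ev k")
  case False
  then show ?thesis
    by (intro sint_eigen_orthogonal[of _ _ "sharm_ev j" "sharm_ev k"] sharm_smooth sharm_Lap j k)
next
  case True
  have c: "sint (\<lambda>x. sharm j x * sharm k x) = sint (\<lambda>x. sharm k x * sharm j x)" by (simp add: mult.commute)
  have *: "sint (\<lambda>x. sharm j x * sharm k x) = 0" if "j < k" "k < 9" "sharm_ev j = sharm_ev k" for j k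
  proof -
    have 1: "(j = 1 \<and> k = 2) \<or> (j = 1 \<and> k = 3) \<or> (j = 2 \<and> k = 3) \<or> (j = 4 \<and> k = 5) \<or> (j = 4 \<and> k = 6) \<or> (j = 4 \<and> k = 7)
      \<or> (j = 5 \<and> k = 6) \<or> (j = 5 \<and> k = 7) \<or> (j = 6 \<and> k = 7) \<or> (j = 4 \<and> k = 8) \<or> (j = 5 \<and> k = 8) \<or> (j = 6 \<and> k = 8) \<or> (j = 7 \<and> k = 8)"
    proof -
      have "j < 9" using that by simp
      from this that(2) that(1,3) show ?thesis
        by (elim less_9_cases) (simp_all add: sharm_ev_def)
    qed
    show ?thesis
      using 1
      by (elim disjE conjE; simp only: sharm_simps sint_inner_inner sint_quartic sint_quartic_minus;
          simp add: inner_diff_left inner_add_left inner_diff_right inner_add_right ax_inner)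
  qed
  show ?thesis
    using *[of j k] *[of k j] True j k jk c by (cases "j < k") (auto simp: not_less)
qed

definition sharm_N :: "nat \<Rightarrow> real"
  where "sharm_N k = sint (\<lambda>x. sharm k x * sharm k x)"

lemma sharm_N_8: "sharm_N 8 = 16 * pi / 5"
proof -
  let ?q = "\<lambda>x. (ax 3 \<bullet> x) * (ax 3 \<bullet> x)"
  have "sharm_N 8 = sint (\<lambda>x. 3 * (?q x * (3 * ?q x - 1)) - (3 * ?q x - 1))"
    unfolding sharm_N_def sharm_simps by (rule sint_cong) (simp add: algebra_simps)
  also have "\<dots> = 3 * sint (\<lambda>x. ?q x * (3 * ?q x - 1)) - (3 * sint ?q - 4 * pi)"
    by (simp add: sint_diff sint_cmult sint_const continuous_intros)
  finally show ?thesis by (simp only: sint_quartic_minus sint_inner_inner ax_inner) simp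
qed

lemma sharm_N_pos: "k < 9 \<Longrightarrow> sharm_N k \<ge> 4 * pi / 15"
  by (erule less_9_cases; (simp only: sharm_N_8)?; (simp only: sharm_N_def sharm_simps sint_inner_inner sint_quartic)?;
      simp add: sint_const inner_diff_left inner_add_left inner_diff_right inner_add_right ax_inner)

definition sharm_sum :: "(nat \<Rightarrow> real) \<Rightarrow> real^3 \<Rightarrow> real"
  where "sharm_sum a x = (\<Sum>k<9. a k * sharm k x)"

lemma sharm_sum_smooth: "smooth_S2 (sharm_sum a)"
  unfolding sharm_sum_def by (intro smooth_S2_sum smooth_S2_cmult sharm_smooth) simp

lemma sharm_sum_compose_smooth:
  assumes "\<And>i. smooth_S2 (\<lambda>x. \<Phi> x $ i)"
  shows "smooth_S2 (\<lambda>x. sharm_sum a (\<Phi> x))"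
proof -
  have i: "smooth_S2 (\<lambda>x. b \<bullet> \<Phi> x)" for b
    unfolding inner_vec_def inner_real_def by (intro smooth_S2_sum smooth_S2_mult smooth_S2_const assms)
  have "smooth_S2 (\<lambda>x. sharm k (\<Phi> x))" if "k < 9" for k
    using that
    by (rule less_9_cases; simp only: sharm_simps; intro smooth_S2_mult smooth_S2_diff smooth_S2_const i)
  then show ?thesis unfolding sharm_sum_def by (intro smooth_S2_sum smooth_S2_cmult) simp
qed

lemma sint_sharm_sum:
  "sint (\<lambda>x. sharm_sum a x * sharm_sum b x) = (\<Sum>k<9. a k * b k * sharm_N k)"
proof -
  have c: "k < 9 \<Longrightarrow> continuous_on S2 (sharm k)" for k using sharm_smooth smooth_S2_continuous by blast
  have "sint (\<lambda>x. sharm_sum a x * sharm_sum b x) = sint (\<lambda>x. \<Sum>j<9. \<Sum>k<9. (a j * b k) * (sharm j x * sharm k x))"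
    unfolding sharm_sum_def sum_product by (simp add: mult_ac)
  also have "\<dots> = (\<Sum>j<9. \<Sum>k<9. (a j * b k) * sint (\<lambda>x. sharm j x * sharm k x))"
  proof (subst sint_sum)
    show "continuous_on S2 (\<lambda>x. \<Sum>k<9. a j * b k * (sharm j x * sharm k x))" if "j \<in> {..<9}" for j
      using that by (intro continuous_intros c) auto
    show "(\<Sum>j<9. sint (\<lambda>x. \<Sum>k<9. a j * b k * (sharm j x * sharm k x)))
      = (\<Sum>j<9. \<Sum>k<9. (a j * b k) * sint (\<lambda>x. sharm j x * sharm k x))"
    proof (rule sum.cong[OF refl])
      fix j :: nat assume "j \<in> {..<9}"
      then show "sint (\<lambda>x. \<Sum>k<9. a j * b k * (sharm j x * sharm k x)) = (\<Sum>k<9. (a j * b k) * sint (\<lambda>x. sharm j x * sharm k x))"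
        unfolding sint_cmult[symmetric] by (intro sint_sum continuous_intros c) auto
    qed
  qed
  also have "\<dots> = (\<Sum>j<9. \<Sum>k<9. if k = j then a j * b k * sharm_N k else 0)"
    by (intro sum.cong refl) (auto simp: sharm_orthogonal sharm_N_def)
  also have "\<dots> = (\<Sum>k<9. a k * b k * sharm_N k)" by (simp add: sum.delta')
  finally show ?thesis .
qed

lemma sharm_sum_Lap: "x \<in> S2 \<Longrightarrow> Lap (sharm_sum a) x = - sharm_sum (\<lambda>k. a k * sharm_ev k) x"
proof -
  assume x: "x \<in> S2"
  have "Lap (\<lambda>x. \<Sum>k<n. a k * sharm k x) x = (\<Sum>k<n. a k * Lap (sharm k) x)" if "n \<le> 9" for n
    using that
  proof (induction n)
    case (Suc n)
    have "Lap (\<lambda>x. \<Sum>k<Suc n. a k * sharm k x) x = Lap (\<lambda>x. \<Sum>k<n. a k * sharm k x) x + Lap (\<lambda>x. a n * sharm n x) x"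
      unfolding sum.lessThan_Suc using Suc.prems
      by (intro Lap_add smooth_S2_sum smooth_S2_cmult sharm_smooth x) auto
    also have "Lap (\<lambda>x. a n * sharm n x) x = a n * Lap (sharm n) x"
      using Suc.prems by (intro Lap_cmult sharm_smooth x) auto
    finally show ?case using Suc by simp
  qed (simp add: Lap_const[OF x])
  from this[of 9] have "Lap (sharm_sum a) x = (\<Sum>k<9. a k * Lap (sharm k) x)"
    by (simp add: sharm_sum_def[abs_def])
  also have "\<dots> = (\<Sum>k<9. - (a k * sharm_ev k * sharm k x))"
    by (intro sum.cong refl) (simp add: sharm_Lap[OF _ x])
  finally show ?thesis by (simp add: sharm_sum_def sum_negf)
qed

lemma nsq_sharm_sum: "nsq \<sigma> (sharm_sum a) = (\<Sum>k<9. (a k)\<^sup>2 * sharm_N k)"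
  using sint_sharm_sum[of a a] by (simp add: nsq_sint power2_eq_square)

text \<open>All nine eigenvalues are at most 6, and orthogonality makes both sides diagonal in the
  coefficients.\<close>

lemma dirichlet_sharm_sum_le: "dirichlet (sharm_sum a) \<le> 6 * nsq \<sigma> (sharm_sum a)"
proof -
  have "dirichlet (sharm_sum a) = - sint (\<lambda>x. (-1) * (sharm_sum a x * sharm_sum (\<lambda>k. a k * sharm_ev k) x))"
    unfolding dirichlet_Green[OF sharm_sum_smooth] by (intro arg_cong[of _ _ uminus] sint_cong) (simp add: sharm_sum_Lap)
  also have "\<dots> = (\<Sum>k<9. a k * (a k * sharm_ev k) * sharm_N k)"
    by (simp add: sint_minus sint_sharm_sum)
  also have "\<dots> \<le> (\<Sum>k<9. 6 * ((a k)\<^sup>2 * sharm_N k))"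
  proof (rule sum_mono)
    fix k :: nat assume "k \<in> {..<9}"
    then have "sharm_N k \<ge> 0" using sharm_N_pos[of k] pi_gt_zero by (auto intro: order_trans[of 0 "4 * pi / 15"])
    moreover have "sharm_ev k \<le> 6" by (simp add: sharm_ev_def)
    ultimately have "sharm_ev k * ((a k)\<^sup>2 * sharm_N k) \<le> 6 * ((a k)\<^sup>2 * sharm_N k)"
      by (intro mult_right_mono) auto
    then show "a k * (a k * sharm_ev k) * sharm_N k \<le> 6 * ((a k)\<^sup>2 * sharm_N k)"
      by (simp add: power2_eq_square mult_ac)
  qed
  finally show ?thesis by (simp add: nsq_sharm_sum sum_distrib_left)
qed

text \<open>On a space of finite dimension all norms are equivalent, so one constant serves all
  coefficients. This makes the final estimate uniform in \<open>\<Phi>\<close>, because the test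
  function \<open>sharm_sum a\<close> depends on \<open>\<Phi>\<close> through \<open>a\<close>
  alone.\<close>

lemma sharm_sum_square_W12:
  obtains C where "C > 0" "\<And>a. sqrt (dirichlet (\<lambda>x. sharm_sum a x * sharm_sum a x) + nsq \<sigma> (\<lambda>x. sharm_sum a x * sharm_sum a x))
    \<le> C * nsq \<sigma> (sharm_sum a)"
proof -
  have "\<exists>B. \<forall>x\<in>S2. (sharm k x)\<^sup>2 \<le> B \<and> grad_S2 (sharm k) x \<bullet> grad_S2 (sharm k) x \<le> B" if k: "k < 9" for k
  proof -
    have c: "continuous_on S2 (\<lambda>x. (sharm k x)\<^sup>2)" "continuous_on S2 (\<lambda>x. grad_S2 (sharm k) x \<bullet> grad_S2 (sharm k) x)"
      using sharm_smooth[OF k] by (auto intro!: smooth_S2_continuous)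
    obtain B1 where B1: "\<And>x. x \<in> S2 \<Longrightarrow> \<bar>(sharm k x)\<^sup>2\<bar> \<le> B1" using continuous_S2_bounded[OF c(1)] by blast
    obtain B2 where B2: "\<And>x. x \<in> S2 \<Longrightarrow> \<bar>grad_S2 (sharm k) x \<bullet> grad_S2 (sharm k) x\<bar> \<le> B2" using continuous_S2_bounded[OF c(2)] by blast
    have "(sharm k x)\<^sup>2 \<le> max B1 B2 \<and> grad_S2 (sharm k) x \<bullet> grad_S2 (sharm k) x \<le> max B1 B2" if "x \<in> S2" for x
      using B1[OF that] B2[OF that] by auto
    then show ?thesis by blast
  qed
  then have "\<forall>k\<in>{..<9}. \<exists>B. \<forall>x\<in>S2. (sharm k x)\<^sup>2 \<le> B \<and> grad_S2 (sharm k) x \<bullet> grad_S2 (sharm k) x \<le> B" by simp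
  from bchoice[OF this] obtain b where b': "\<forall>k\<in>{..<9}. \<forall>x\<in>S2. (sharm k x)\<^sup>2 \<le> b k \<and> grad_S2 (sharm k) x \<bullet> grad_S2 (sharm k) x \<le> b k" ..
  have b: "(sharm k x)\<^sup>2 \<le> b k" "grad_S2 (sharm k) x \<bullet> grad_S2 (sharm k) x \<le> b k" if "k < 9" "x \<in> S2" for k x
    using b' that by auto
  define B where "B = 1 + (\<Sum>k<9. \<bar>b k\<bar>)"
  have bB: "b k \<le> B" if "k < 9" for k
    using member_le_sum[of k "{..<9}" "\<lambda>k. \<bar>b k\<bar>"] that by (simp add: B_def)
  have B: "B > 0" by (simp add: B_def add_pos_nonneg sum_nonneg)
  define S where "S a = (\<Sum>k<9. (a k)\<^sup>2)" for a :: "nat \<Rightarrow> real"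
  have SN: "S a \<le> 15 / (4 * pi) * nsq \<sigma> (sharm_sum a)" for a
  proof -
    have "4 * pi / 15 * S a \<le> nsq \<sigma> (sharm_sum a)"
      unfolding nsq_sharm_sum S_def sum_distrib_left
    proof (rule sum_mono)
      fix k :: nat assume "k \<in> {..<9}"
      then have "(a k)\<^sup>2 * (4 * pi / 15) \<le> (a k)\<^sup>2 * sharm_N k" by (intro mult_left_mono sharm_N_pos) auto
      then show "4 * pi / 15 * (a k)\<^sup>2 \<le> (a k)\<^sup>2 * sharm_N k" by (simp add: mult_ac)
    qed
    then show ?thesis by (simp add: field_simps)
  qed
  define K where "K a = 9 * B * S a" for a
  have K1: "(sharm_sum a x)\<^sup>2 \<le> K a" if x: "x \<in> S2" for a x
  proof -
    have "(sharm_sum a x)\<^sup>2 \<le> (\<Sum>k<9. (a k * sharm k x)\<^sup>2) * real (card {..<9::nat})"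
      unfolding sharm_sum_def by (rule sum_squared_le_sum_of_squares)
    also have "(\<Sum>k<9. (a k * sharm k x)\<^sup>2) \<le> (\<Sum>k<9. (a k)\<^sup>2 * B)"
      unfolding power_mult_distrib using b(1)[OF _ x] bB by (intro sum_mono mult_left_mono) (auto intro: order_trans)
    finally show ?thesis by (simp add: K_def S_def sum_distrib_left mult_ac)
  qed
  have gs: "grad_S2 (sharm_sum a) x = (\<Sum>k<9. a k *\<^sub>R grad_S2 (sharm k) x)" if x: "x \<in> S2" for a x
  proof -
    have "grad_S2 (\<lambda>x. \<Sum>k<n. a k * sharm k x) x = (\<Sum>k<n. a k *\<^sub>R grad_S2 (sharm k) x)" if "n \<le> 9" for n
      using that
    proof (induction n)
      case (Suc n)
      have "grad_S2 (\<lambda>x. \<Sum>k<Suc n. a k * sharm k x) x = grad_S2 (\<lambda>x. \<Sum>k<n. a k * sharm k x) x + grad_S2 (\<lambda>x. a n * sharm n x) x"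
        unfolding sum.lessThan_Suc using Suc.prems
        by (intro grad_S2_add smooth_S2_sum smooth_S2_cmult sharm_smooth x) auto
      also have "grad_S2 (\<lambda>x. a n * sharm n x) x = a n *\<^sub>R grad_S2 (sharm n) x"
        using Suc.prems by (subst grad_S2_mult) (auto intro: sharm_smooth simp: grad_S2_const[OF x] x[simplified])
      finally show ?case using Suc by simp
    qed (simp add: grad_S2_const[OF x])
    from this[of 9] show ?thesis by (simp add: sharm_sum_def[abs_def])
  qed
  have K2: "grad_S2 (sharm_sum a) x \<bullet> grad_S2 (sharm_sum a) x \<le> K a" if x: "x \<in> S2" for a x
  proof -
    have "norm (grad_S2 (sharm_sum a) x) \<le> (\<Sum>k<9. \<bar>a k\<bar> * norm (grad_S2 (sharm k) x))"
      unfolding gs[OF x] by (rule order_trans[OF norm_sum]) simp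
    then have "(norm (grad_S2 (sharm_sum a) x))\<^sup>2 \<le> (\<Sum>k<9. \<bar>a k\<bar> * norm (grad_S2 (sharm k) x))\<^sup>2"
      by (rule power_mono) simp
    also have "\<dots> \<le> (\<Sum>k<9. (\<bar>a k\<bar> * norm (grad_S2 (sharm k) x))\<^sup>2) * real (card {..<9::nat})"
      by (rule sum_squared_le_sum_of_squares)
    also have "(\<Sum>k<9. (\<bar>a k\<bar> * norm (grad_S2 (sharm k) x))\<^sup>2) \<le> (\<Sum>k<9. (a k)\<^sup>2 * B)"
      unfolding power_mult_distrib power2_abs power2_norm_eq_inner using b(2)[OF _ x] bB
      by (intro sum_mono mult_left_mono) (auto intro: order_trans)
    finally show ?thesis by (simp add: power2_norm_eq_inner K_def S_def sum_distrib_left mult_ac)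
  qed
  define C where "C = sqrt (15 * 9 * B * 15 / (4 * pi))"
  have main: "sqrt (dirichlet (\<lambda>x. sharm_sum a x * sharm_sum a x) + nsq \<sigma> (\<lambda>x. sharm_sum a x * sharm_sum a x)) \<le> C * nsq \<sigma> (sharm_sum a)" for a
  proof (rule real_le_lsqrt)
    let ?n = "nsq \<sigma> (sharm_sum a)"
    have K0: "K a \<ge> 0" using B by (simp add: K_def S_def sum_nonneg)
    have n0: "?n \<ge> 0" by (rule nsq_nonneg)
    have "dirichlet (\<lambda>x. sharm_sum a x * sharm_sum a x) \<le> 2 * K a * dirichlet (sharm_sum a) + 2 * K a * ?n"
      by (rule dirichlet_mult_le[OF sharm_sum_smooth sharm_sum_smooth K1 K2])
    also have "\<dots> \<le> 2 * K a * (6 * ?n) + 2 * K a * ?n"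
      by (intro add_right_mono mult_left_mono dirichlet_sharm_sum_le) (use K0 in simp)
    finally have 1: "dirichlet (\<lambda>x. sharm_sum a x * sharm_sum a x) \<le> 14 * (K a * ?n)" by simp
    have "nsq \<sigma> (\<lambda>x. sharm_sum a x * sharm_sum a x) \<le> sint (\<lambda>x. K a * (sharm_sum a x)\<^sup>2)"
      unfolding nsq_sint
    proof (rule sint_mono)
      fix x assume x: "x \<in> S2"
      show "(sharm_sum a x * sharm_sum a x)\<^sup>2 \<le> K a * (sharm_sum a x)\<^sup>2"
        unfolding power_mult_distrib by (intro mult_right_mono K1 x) simp
    qed (intro continuous_intros smooth_S2_continuous sharm_sum_smooth)+
    then have 2: "nsq \<sigma> (\<lambda>x. sharm_sum a x * sharm_sum a x) \<le> K a * ?n"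
      by (simp only: sint_cmult nsq_sint)
    have "K a * ?n \<le> 9 * B * (15 / (4 * pi) * ?n) * ?n"
      unfolding K_def using B n0 by (intro mult_right_mono mult_left_mono SN) auto
    then have "15 * (K a * ?n) \<le> (C * ?n)\<^sup>2"
      using B by (simp add: C_def power_mult_distrib power2_eq_square field_simps)
    then show "dirichlet (\<lambda>x. sharm_sum a x * sharm_sum a x) + nsq \<sigma> (\<lambda>x. sharm_sum a x * sharm_sum a x) \<le> (C * ?n)\<^sup>2"
      using 1 2 by linarith
  qed (use B nsq_nonneg in \<open>auto simp: C_def intro!: mult_nonneg_nonneg\<close>)
  have "C > 0" using B by (simp add: C_def)
  then show ?thesis using that main by blast
qed

lemma sum_less_9: "(\<Sum>k<9. f k) = f 0 + f 1 + f 2 + f 3 + f 4 + f 5 + f 6 + f 7 + (f (8::nat) :: real)"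
  by (simp add: eval_nat_numeral)

text \<open>Through this expansion a function orthogonal to the nine harmonics has zero averages at
  level 2, and its gap is \<open>3 * 4 = 12\<close>.\<close>

lemma kern_2_sharm:
  assumes y: "y \<in> S2"
  shows "kern 2 x y = (\<Sum>k<9. [(3 + x \<bullet> x) / 12, x$1 / 2, x$2 / 2, x$3 / 2, x$1 * x$2 / 2, x$1 * x$3 / 2, x$2 * x$3 / 2,
    (x$1 * x$1 - x$2 * x$2) / 8, (2 * x$3 * x$3 - x$1 * x$1 - x$2 * x$2) / 24] ! k * sharm k y)"
proof -
  have yy: "y$1 * y$1 + y$2 * y$2 + y$3 * y$3 = 1"
    using y by (simp add: norm_eq_1 inner_vec_def sum_3)
  \<comment> \<open>As polynomials in \<open>y\<close> the two sides of the claim differ by a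
    multiple of \<open>y \<bullet> y - 1\<close>, which vanishes on the sphere.\<close>
  have "kern 2 x y = (\<Sum>k<9. [(3 + x \<bullet> x) / 12, x$1 / 2, x$2 / 2, x$3 / 2, x$1 * x$2 / 2, x$1 * x$3 / 2, x$2 * x$3 / 2,
    (x$1 * x$1 - x$2 * x$2) / 8, (2 * x$3 * x$3 - x$1 * x$1 - x$2 * x$2) / 24] ! k * sharm k y)
    + (x$1 * x$1 + x$2 * x$2) / 8 * (y$1 * y$1 + y$2 * y$2 + y$3 * y$3 - 1)"
    by (simp add: sum_less_9 sharm_def kern_def inner_axis' inner_diff_left inner_add_left)
       (simp add: inner_vec_def sum_3 power2_eq_square field_simps)
  then show ?thesis unfolding yy by simp
qed

section \<open>Homogeneous linear systems\<close>

lemma sum_skip: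
  "p \<le> n \<Longrightarrow> (\<Sum>k<Suc n. f k) = f p + (\<Sum>k<n. f (if k < p then k else Suc k) :: real)"
proof (induction n)
  case (Suc n)
  show ?case
  proof (cases "p = Suc n")
    case True
    then show ?thesis by simp
  next
    case False
    then have "p \<le> n" using Suc.prems by simp
    with Suc.IH show ?thesis by simp
  qed
qed simp

text \<open>Gaussian elimination by induction: if the last equation has a nonzero coefficient at
  \<open>p\<close>, it is solved for unknown \<open>p\<close>, which is then removed from the
  others; if not, the equation is dropped and the last unknown set to zero.\<close>

lemma homogeneous_system:
  fixes M :: "nat \<Rightarrow> nat \<Rightarrow> real"
  shows "\<exists>c. (\<exists>k<Suc n. c k \<noteq> 0) \<and> (\<forall>j<n. (\<Sum>k<Suc n. c k * M j k) = 0)"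
proof (induction n arbitrary: M)
  case 0
  show ?case by (rule exI[of _ "\<lambda>_. 1"]) simp
next
  case (Suc n)
  show ?case
  proof (cases "\<exists>p<Suc (Suc n). M n p \<noteq> 0")
    case False
    obtain c where c: "\<exists>k<Suc n. c k \<noteq> 0" "\<And>j. j < n \<Longrightarrow> (\<Sum>k<Suc n. c k * M j k) = 0"
      using Suc.IH[of M] by blast
    define c' where "c' = c(Suc n := 0)"
    have "(\<Sum>k<Suc (Suc n). c' k * M j k) = 0" if "j < Suc n" for j
    proof (cases "j = n")
      case True
      then show ?thesis using False by (intro sum.neutral) auto
    next
      case False
      then have "(\<Sum>k<Suc n. c' k * M j k) = (\<Sum>k<Suc n. c k * M j k)"
        by (intro sum.cong) (auto simp: c'_def)
      then show ?thesis using c(2)[of j] False that by (simp add: c'_def)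
    qed
    moreover have "\<exists>k<Suc (Suc n). c' k \<noteq> 0"
    proof -
      obtain k where "k < Suc n" "c k \<noteq> 0" using c(1) by blast
      then show ?thesis by (intro exI[of _ k]) (auto simp: c'_def)
    qed
    ultimately show ?thesis by blast
  next
    case True
    then obtain p where p: "p < Suc (Suc n)" "M n p \<noteq> 0" by blast
    \<comment> \<open>\<open>s\<close> enumerates the unknowns other than \<open>p\<close>.\<close>
    define s where "s k = (if k < p then k else Suc k)" for k
    obtain d where d: "\<exists>k<Suc n. d k \<noteq> 0"
      "\<And>j. j < n \<Longrightarrow> (\<Sum>k<Suc n. d k * (M j (s k) - M j p / M n p * M n (s k))) = 0"
      using Suc.IH[of "\<lambda>j k. M j (s k) - M j p / M n p * M n (s k)"] by blast
    define q where "q = (\<Sum>k<Suc n. d k * M n (s k))"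
    define c where "c k = (if k < p then d k else if k = p then - q / M n p else d (k - 1))" for k
    have cs: "c (s k) = d k" for k by (simp add: c_def s_def)
    have sum: "(\<Sum>k<Suc (Suc n). c k * M j k) = - q / M n p * M j p + (\<Sum>k<Suc n. d k * M j (s k))" for j
      using sum_skip[of p "Suc n" "\<lambda>k. c k * M j k"] p(1) cs unfolding s_def[symmetric] by (simp add: c_def)
    have "(\<Sum>k<Suc (Suc n). c k * M j k) = 0" if "j < Suc n" for j
    proof (cases "j = n")
      case True
      then show ?thesis unfolding sum using p(2) by (simp add: q_def)
    next
      case False
      then have "j < n" using that by simp
      from d(2)[OF this] have "(\<Sum>k<Suc n. d k * M j (s k)) - M j p / M n p * q = 0"
        unfolding q_def sum_distrib_left sum_subtractf[symmetric] by (simp only: algebra_simps)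
      then show ?thesis unfolding sum by simp
    qed
    moreover have "\<exists>k<Suc (Suc n). c k \<noteq> 0"
    proof -
      obtain k where k: "k < Suc n" "d k \<noteq> 0" using d(1) by blast
      have "c (s k) \<noteq> 0" unfolding cs by (rule k(2))
      moreover have "s k < Suc (Suc n)" using k by (simp add: s_def)
      ultimately show ?thesis by blast
    qed
    ultimately show ?thesis by blast
  qed
qed

section \<open>Perturbing the round measure by a harmonic of degree four\<close>

text \<open>
  A negative multiple of the Legendre polynomial of degree four: the sign makes the integral
  of \<open>psi\<close> against the square of \<open>sharm 8\<close> negative, the factor gives \<open>\<bar>psi\<bar> \<le> 1\<close>.
\<close>
definition psi :: "real^3 \<Rightarrow> real"
  where "psi x = - (35 * (ax 3 \<bullet> x) ^ 4 - 30 * (ax 3 \<bullet> x) ^ 2 + 3) / 100"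

lemma psi_smooth: "smooth_S2 psi"
  unfolding psi_def
  by (intro smooth_S2_divide smooth_S2_uminus smooth_S2_add smooth_S2_diff smooth_S2_cmult smooth_S2_power
      smooth_S2_inner smooth_S2_const)

lemma psi_continuous: "continuous_on S2 psi"
  by (rule smooth_S2_continuous[OF psi_smooth])

lemma psi_bound: assumes "x \<in> S2" shows "\<bar>psi x\<bar> \<le> 1"
proof -
  define s where "s = (ax 3 \<bullet> x)\<^sup>2"
  have s: "0 \<le> s" "s \<le> 1" using inner_S2_bounds(1)[OF assms, of "ax 3"] by (auto simp: s_def ax_inner)
  have e: "psi x = 3 / 10 * s - 7 / 20 * s\<^sup>2 - 3 / 100"
    by (simp add: psi_def s_def field_simps flip: power_mult)
  have q: "s\<^sup>2 \<le> 1" "s\<^sup>2 \<ge> 0" using s by (auto simp: power_le_one)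
  have "psi x \<le> 1" using e q s by linarith
  moreover have "- 1 \<le> psi x" using e q s by linarith
  ultimately show ?thesis by (simp add: abs_le_iff)
qed

lemma Lap_ax_power:
  assumes x: "x \<in> S2"
  shows "Lap (\<lambda>x. (ax 3 \<bullet> x) ^ Suc (Suc n)) x
    = (real n + 2) * (real n + 1) * (ax 3 \<bullet> x) ^ n - (real n + 2) * (real n + 3) * (ax 3 \<bullet> x) ^ Suc (Suc n)"
  by (subst Lap_power_Suc[OF smooth_S2_inner x])
     (simp add: Lap_inner[OF x] grad_S2_inner_inner[OF x] ax_inner algebra_simps)

lemma psi_Lap: assumes x: "x \<in> S2" shows "Lap psi x = - 20 * psi x"
proof -
  let ?s = "\<lambda>x. ax 3 \<bullet> x"
  have s: "smooth_S2 (\<lambda>x. ?s x ^ n)" for n by (intro smooth_S2_power smooth_S2_inner)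
  have p: "psi = (\<lambda>x. (- 7 / 20) * ?s x ^ 4 + ((3 / 10) * ?s x ^ 2 + (- 3 / 100)))"
    by (simp add: psi_def fun_eq_iff field_simps)
  have "Lap psi x = (- 7 / 20) * Lap (\<lambda>x. ?s x ^ 4) x + ((3 / 10) * Lap (\<lambda>x. ?s x ^ 2) x + 0)"
    unfolding p using s x
    by (simp only: Lap_add Lap_cmult Lap_const smooth_S2_add smooth_S2_cmult smooth_S2_const)
  also have "Lap (\<lambda>x. ?s x ^ 4) x = 12 * ?s x ^ 2 - 20 * ?s x ^ 4"
    using Lap_ax_power[OF x, of 2] by (simp add: eval_nat_numeral)
  also have "Lap (\<lambda>x. ?s x ^ 2) x = 2 - 6 * ?s x ^ 2"
    using Lap_ax_power[OF x, of 0] by (simp add: eval_nat_numeral)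
  finally show ?thesis by (simp add: p field_simps)
qed

lemma sint_ax_power: "sint (\<lambda>x. (ax 3 \<bullet> x) ^ (2 * n)) = 4 * pi / (2 * real n + 1)"
proof (induction n)
  case (Suc n)
  let ?s = "\<lambda>x. ax 3 \<bullet> x"
  define m where "m = 2 * n"
  have "0 = sint (Lap (\<lambda>x. ?s x ^ Suc (Suc m)))" by (rule sint_Lap[symmetric]) (intro smooth_S2_power smooth_S2_inner)
  also have "\<dots> = sint (\<lambda>x. (real m + 2) * (real m + 1) * ?s x ^ m - (real m + 2) * (real m + 3) * ?s x ^ Suc (Suc m))"
    by (rule sint_cong) (rule Lap_ax_power)
  also have "\<dots> = (real m + 2) * (real m + 1) * sint (\<lambda>x. ?s x ^ m) - (real m + 2) * (real m + 3) * sint (\<lambda>x. ?s x ^ Suc (Suc m))"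
    by (subst sint_diff) (auto simp only: sint_cmult intro!: continuous_intros)
  finally have "(real m + 2) * ((real m + 3) * sint (\<lambda>x. ?s x ^ Suc (Suc m))) = (real m + 2) * ((real m + 1) * sint (\<lambda>x. ?s x ^ m))"
    by simp
  then have "(real m + 3) * sint (\<lambda>x. ?s x ^ Suc (Suc m)) = (real m + 1) * sint (\<lambda>x. ?s x ^ m)"
    by (subst (asm) mult_cancel_left) auto
  also have "\<dots> = 4 * pi" using Suc by (simp add: m_def)
  finally have "(2 * real n + 3) * sint (\<lambda>x. ?s x ^ (2 * Suc n)) = 4 * pi" by (simp add: m_def)
  then show ?case by (simp add: field_simps)
qed (simp add: sint_const)

lemma sint_psi: "sint psi = 0"
  using sint_eigen_orthogonal[where l=20 and m=0, OF psi_smooth smooth_S2_const[of 1]] by (simp add: psi_Lap Lap_const)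

lemma sint_psi_inner: "sint (\<lambda>x. psi x * (a \<bullet> x)) = 0"
  by (rule sint_eigen_orthogonal[where l=20 and m=2, OF psi_smooth smooth_S2_inner]) (simp_all add: psi_Lap Lap_inner)

text \<open>The square of a linear function is an eigenfunction up to a constant, which
  \<open>sint_psi\<close> removes. Moving the Laplacian across then equates \<open>- 20\<close> and
  \<open>- 6\<close> times the same integral.\<close>

lemma sint_psi_inner_inner: "sint (\<lambda>x. psi x * ((a \<bullet> x) * (a \<bullet> x))) = 0"
proof -
  let ?q = "\<lambda>x. (a \<bullet> x) * (a \<bullet> x)"
  have sq: "smooth_S2 ?q" by (intro smooth_S2_mult smooth_S2_inner)
  have c: "continuous_on S2 (\<lambda>x. psi x * ?q x)" by (intro continuous_intros psi_continuous)
  have "sint (\<lambda>x. - 20 * (psi x * ?q x)) = sint (\<lambda>x. Lap psi x * ?q x)"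
    by (rule sint_cong) (simp add: psi_Lap)
  also have "\<dots> = sint (\<lambda>x. psi x * Lap ?q x)" by (rule sint_Lap_sym[OF psi_smooth sq])
  also have "\<dots> = sint (\<lambda>x. 2 * (a \<bullet> a) * psi x - 6 * (psi x * ?q x))"
    by (rule sint_cong) (simp add: Lap_inner_inner algebra_simps)
  also have "\<dots> = 2 * (a \<bullet> a) * sint psi - 6 * sint (\<lambda>x. psi x * ?q x)"
    by (subst sint_diff) (auto simp only: sint_cmult intro!: continuous_intros psi_continuous c)
  finally show ?thesis by (simp add: sint_cmult sint_psi sint_minus)
qed

text \<open>The integrand is an even polynomial in the third coordinate, so
  \<open>sint_ax_power\<close> evaluates it. The value \<open>4 / 175\<close> sets the margin of the
  whole sharpness argument.\<close>

lemma sint_psi_sharm: "sint (\<lambda>x. psi x * (sharm 8 x)\<^sup>2) = - (4 / 175) * sharm_N 8"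
proof -
  let ?s = "\<lambda>x. ax 3 \<bullet> x"
  let ?m = "\<lambda>n x. ?s x ^ (2 * n)"
  have "sint (\<lambda>x. psi x * (sharm 8 x)\<^sup>2)
    = sint (\<lambda>x. (- 1 / 100) * (315 * ?m 4 x + (- 480 * ?m 3 x + (242 * ?m 2 x + (- 48 * ?m 1 x + 3 * ?m 0 x)))))"
    by (rule sint_cong) (simp only: psi_def sharm_simps, simp add: eval_nat_numeral field_simps)
  also have "\<dots> = (- 1 / 100) * (315 * sint (?m 4) + (- 480 * sint (?m 3) + (242 * sint (?m 2) + (- 48 * sint (?m 1) + 3 * sint (?m 0)))))"
    by (simp only: sint_add sint_cmult continuous_intros)
  finally show ?thesis unfolding sint_ax_power sharm_N_8 by (simp add: field_simps)
qed

lemma sint_one_plus_psi: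
  assumes "continuous_on S2 f"
  shows "sint (\<lambda>x. (1 + t * psi x) * f x) = sint f + t * sint (\<lambda>x. psi x * f x)"
proof -
  have "sint (\<lambda>x. (1 + t * psi x) * f x) = sint (\<lambda>x. f x + t * (psi x * f x))"
    by (rule sint_cong) (simp add: algebra_simps)
  then show ?thesis by (simp add: sint_add sint_cmult continuous_intros psi_continuous assms)
qed

lemma sint_psi_Cauchy_Schwarz:
  assumes f: "continuous_on S2 f" and h: "continuous_on S2 h"
  shows "(sint (\<lambda>x. psi x * (f x * h x)))\<^sup>2 \<le> sint (\<lambda>x. (f x)\<^sup>2) * sint (\<lambda>x. (h x)\<^sup>2)"
proof -
  have "(sint (\<lambda>x. (psi x * f x) * h x))\<^sup>2 \<le> sint (\<lambda>x. (psi x * f x)\<^sup>2) * sint (\<lambda>x. (h x)\<^sup>2)"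
    by (intro sint_Cauchy_Schwarz continuous_intros psi_continuous f h)
  also have "sint (\<lambda>x. (psi x * f x)\<^sup>2) \<le> sint (\<lambda>x. (f x)\<^sup>2)"
  proof (rule sint_mono)
    fix x assume "x \<in> S2"
    then have "(psi x)\<^sup>2 \<le> 1" using psi_bound abs_square_le_1 by blast
    then show "(psi x * f x)\<^sup>2 \<le> (f x)\<^sup>2" by (simp add: power_mult_distrib mult_left_le_one_le)
  qed (intro continuous_intros psi_continuous f)+
  finally show ?thesis by (simp add: mult.assoc mult_right_mono sint_nonneg)
qed

text \<open>
  A function orthogonal to all harmonics of degree at most two except \<open>sharm 8\<close>, on which the
  weight \<open>1 + t psi\<close> is small on average, has a Rayleigh quotient above \<open>6\<close> by a margin of order \<open>t\<close>.
\<close>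
lemma orthogonal_Rayleigh_gap:
  assumes f: "smooth_S2 f" and orth: "\<And>k. k < 8 \<Longrightarrow> sint (\<lambda>x. f x * sharm k x) = 0"
    and t: "0 < t" "t \<le> 1 / 350"
  shows "6 * sint (\<lambda>x. (1 + t * psi x) * (f x)\<^sup>2) \<le> (1 - 2 / 175 * t) * dirichlet f"
proof -
  define N where "N = sharm_N 8"
  have N: "N > 0" by (simp add: N_def sharm_N_8)
  let ?Y = "sharm 8"
  have Y: "smooth_S2 ?Y" by (rule sharm_smooth) simp
  define \<alpha> where "\<alpha> = sint (\<lambda>x. f x * ?Y x) / N"
  define h where "h x = f x - \<alpha> * ?Y x" for x
  have h: "smooth_S2 h" unfolding h_def by (intro smooth_S2_diff f smooth_S2_cmult Y)
  have c: "continuous_on S2 f" "continuous_on S2 h" "continuous_on S2 ?Y" "k < 9 \<Longrightarrow> continuous_on S2 (sharm k)" for k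
    using f h Y sharm_smooth smooth_S2_continuous by blast+
  have hk: "sint (\<lambda>x. sharm k x * h x) = 0" if k: "k < 9" for k
  proof -
    have "sint (\<lambda>x. sharm k x * h x) = sint (\<lambda>x. f x * sharm k x - \<alpha> * (?Y x * sharm k x))"
      by (rule sint_cong) (simp add: h_def algebra_simps)
    also have "\<dots> = sint (\<lambda>x. f x * sharm k x) - \<alpha> * sint (\<lambda>x. ?Y x * sharm k x)"
      by (subst sint_diff) (auto simp only: sint_cmult intro!: continuous_intros c k)
    also have "\<dots> = 0"
    proof (cases "k = 8")
      case True
      then show ?thesis using N by (simp add: \<alpha>_def N_def sharm_N_def)
    next
      case False
      then show ?thesis using orth[of k] sharm_orthogonal[of 8 k] k by simp
    qed
    finally show ?thesis .
  qed
  have "avg 2 h x = 0" for x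
  proof -
    have "\<exists>b. \<forall>y\<in>S2. kern 2 x y = (\<Sum>k<9. b k * sharm k y)"
      by (rule exI, rule ballI, rule kern_2_sharm)
    then obtain b where b: "\<And>y. y \<in> S2 \<Longrightarrow> kern 2 x y = (\<Sum>k<9. b k * sharm k y)" by blast
    have "sint (\<lambda>y. kern 2 x y * h y) = sint (\<lambda>y. \<Sum>k<9. b k * (sharm k y * h y))"
      by (rule sint_cong) (simp add: b sum_distrib_left sum_distrib_right mult_ac)
    also have "\<dots> = (\<Sum>k<9. b k * sint (\<lambda>y. sharm k y * h y))"
      by (subst sint_sum) (auto simp: sint_cmult intro!: continuous_intros c)
    finally show ?thesis by (simp add: avg_def hk)
  qed
  \<comment> \<open>12 is twice 6, and this factor of two is the room for all errors on
    \<open>h\<close>.\<close>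
  then have gap: "12 * sint (\<lambda>x. (h x)\<^sup>2) \<le> dirichlet h"
    using spectral_gap[OF h, of 2] by simp
  have LY: "Lap ?Y x = - 6 * ?Y x" if "x \<in> S2" for x
    using sharm_Lap[of 8 x] that by (simp add: sharm_ev_def)
  have DY: "dirichlet ?Y = 6 * N"
  proof -
    have "dirichlet ?Y = - sint (\<lambda>x. - 6 * (?Y x * ?Y x))"
      unfolding dirichlet_Green[OF Y] by (intro arg_cong[of _ _ uminus] sint_cong) (simp add: LY)
    then show ?thesis by (simp add: sint_cmult sint_minus N_def sharm_N_def)
  qed
  have "dirichlet h = dirichlet f + dirichlet (\<lambda>x. \<alpha> * ?Y x) + 2 * sint (\<lambda>x. f x * Lap (\<lambda>x. \<alpha> * ?Y x) x)"
    unfolding h_def by (intro dirichlet_diff_expand f smooth_S2_cmult Y)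
  also have "dirichlet (\<lambda>x. \<alpha> * ?Y x) = \<alpha>\<^sup>2 * (6 * N)" by (simp only: dirichlet_cmult[OF Y] DY)
  also have "sint (\<lambda>x. f x * Lap (\<lambda>x. \<alpha> * ?Y x) x) = sint (\<lambda>x. (- 6 * \<alpha>) * (f x * ?Y x))"
    by (rule sint_cong) (simp add: Lap_cmult[OF Y] LY)
  also have "\<dots> = (- 6 * \<alpha>) * (\<alpha> * N)" unfolding sint_cmult using N by (simp add: \<alpha>_def)
  finally have Df: "dirichlet f = 6 * (\<alpha>\<^sup>2 * N) + dirichlet h" by (simp add: power2_eq_square)
  define H where "H = sint (\<lambda>x. (h x)\<^sup>2)"
  have H: "H \<ge> 0" unfolding H_def by (rule sint_nonneg) simp
  define P where "P = sint (\<lambda>x. psi x * (?Y x * h x))"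
  have f2: "sint (\<lambda>x. w x * (f x)\<^sup>2) = \<alpha>\<^sup>2 * sint (\<lambda>x. w x * (?Y x)\<^sup>2) + 2 * \<alpha> * sint (\<lambda>x. w x * (?Y x * h x)) + sint (\<lambda>x. w x * (h x)\<^sup>2)"
    if w: "continuous_on S2 w" for w
  proof -
    have "sint (\<lambda>x. w x * (f x)\<^sup>2) = sint (\<lambda>x. \<alpha>\<^sup>2 * (w x * (?Y x)\<^sup>2) + (2 * \<alpha> * (w x * (?Y x * h x)) + w x * (h x)\<^sup>2))"
      by (rule sint_cong) (simp add: h_def power2_eq_square algebra_simps)
    also have "\<dots> = \<alpha>\<^sup>2 * sint (\<lambda>x. w x * (?Y x)\<^sup>2) + (2 * \<alpha> * sint (\<lambda>x. w x * (?Y x * h x)) + sint (\<lambda>x. w x * (h x)\<^sup>2))"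
      by (simp only: sint_add sint_cmult continuous_intros c w)
    finally show ?thesis by simp
  qed
  have f2_1: "sint (\<lambda>x. (f x)\<^sup>2) = \<alpha>\<^sup>2 * N + H"
    using f2[of "\<lambda>_. 1"] hk[of 8] by (simp add: N_def sharm_N_def H_def power2_eq_square)
  have f2_psi: "sint (\<lambda>x. psi x * (f x)\<^sup>2) \<le> - (4 / 175) * (\<alpha>\<^sup>2 * N) + 2 * \<alpha> * P + H"
  proof -
    have "sint (\<lambda>x. psi x * (h x)\<^sup>2) \<le> H"
      unfolding H_def
    proof (rule sint_mono)
      fix x assume "x \<in> S2"
      then have "psi x * (h x)\<^sup>2 \<le> 1 * (h x)\<^sup>2" using psi_bound[of x] by (intro mult_right_mono) auto
      then show "psi x * (h x)\<^sup>2 \<le> (h x)\<^sup>2" by simp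
    qed (intro continuous_intros psi_continuous c)+
    then show ?thesis using f2[OF psi_continuous] by (simp add: sint_psi_sharm P_def N_def)
  qed
  have "P\<^sup>2 \<le> N * H"
    using sint_psi_Cauchy_Schwarz[OF c(3,2)] by (simp add: P_def N_def H_def sharm_N_def power2_eq_square)
  \<comment> \<open>Young's inequality, weighted such that the share of
    \<open>\<alpha>\<^sup>2 * N\<close> is of second order in \<open>t\<close>, below the first
    order gain from \<open>psi\<close>.\<close>
  have cross: "2 * t * \<alpha> * P \<le> 4 * t\<^sup>2 * (\<alpha>\<^sup>2 * N) + H / 4"
  proof -
    have "(\<alpha> * P)\<^sup>2 \<le> (\<alpha>\<^sup>2 * N) * H"
      using mult_left_mono[OF \<open>P\<^sup>2 \<le> N * H\<close>, of "\<alpha>\<^sup>2"] by (simp add: power_mult_distrib mult_ac)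
    then have "(2 * t * (\<alpha> * P))\<^sup>2 \<le> 4 * t\<^sup>2 * ((\<alpha>\<^sup>2 * N) * H)"
      by (simp add: power_mult_distrib mult_left_mono)
    also have "\<dots> \<le> (4 * t\<^sup>2 * (\<alpha>\<^sup>2 * N) + H / 4)\<^sup>2"
      using zero_le_power2[of "4 * t\<^sup>2 * (\<alpha>\<^sup>2 * N) - H / 4"] by (simp add: power2_eq_square algebra_simps)
    finally have "2 * t * (\<alpha> * P) \<le> 4 * t\<^sup>2 * (\<alpha>\<^sup>2 * N) + H / 4"
      by (rule power2_le_imp_le) (use N H in simp)
    then show ?thesis by simp
  qed
  define A where "A = \<alpha>\<^sup>2 * N"
  have A: "A \<ge> 0" using N by (simp add: A_def)
  have "sint (\<lambda>x. (1 + t * psi x) * (f x)\<^sup>2) = sint (\<lambda>x. (f x)\<^sup>2) + t * sint (\<lambda>x. psi x * (f x)\<^sup>2)"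
    by (rule sint_one_plus_psi) (intro continuous_intros c)
  also have "\<dots> \<le> (A + H) + t * (- (4 / 175) * A + 2 * \<alpha> * P + H)"
    unfolding f2_1 A_def using f2_psi t by (intro add_left_mono mult_left_mono) auto
  also have "\<dots> \<le> A * (1 - 4 / 175 * t + 4 * t\<^sup>2) + H * (5 / 4 + t)"
    using cross by (simp add: A_def algebra_simps)
  \<comment> \<open>Half of the gain \<open>4 / 175 * t\<close> pays for the error
    \<open>4 * t\<^sup>2\<close>; the bound \<open>1 / 350\<close> on \<open>t\<close> is exactly
    what this takes.\<close>
  also have "\<dots> \<le> A * (1 - 2 / 175 * t) + H * (2 * (1 - 2 / 175 * t))"
  proof (intro add_mono mult_left_mono A H)
    have "4 * t\<^sup>2 \<le> 4 * (1 / 350 * t)" unfolding power2_eq_square using t by (intro mult_left_mono mult_right_mono) auto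
    then show "1 - 4 / 175 * t + 4 * t\<^sup>2 \<le> 1 - 2 / 175 * t" by simp
    show "5 / 4 + t \<le> 2 * (1 - 2 / 175 * t)" using t by simp
  qed
  finally have "6 * sint (\<lambda>x. (1 + t * psi x) * (f x)\<^sup>2) \<le> 6 * (A * (1 - 2 / 175 * t) + H * (2 * (1 - 2 / 175 * t)))"
    by (rule mult_left_mono) simp
  also have "\<dots> = (1 - 2 / 175 * t) * (6 * A + 12 * H)"
    by (simp add: algebra_simps)
  also have "\<dots> \<le> (1 - 2 / 175 * t) * dirichlet f"
    using gap t unfolding Df A_def H_def by (intro mult_left_mono) auto
  finally show ?thesis .
qed

section \<open>Weighted area measures\<close>

definition dens :: "(real^3 \<Rightarrow> real) \<Rightarrow> (real^3) measure"
  where "dens w = density \<sigma> (\<lambda>x. ennreal (w x))"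

definition pos_weight :: "(real^3 \<Rightarrow> real) \<Rightarrow> bool"
  where "pos_weight w \<longleftrightarrow> continuous_on S2 w \<and> (\<forall>x\<in>S2. 0 < w x)"

lemma sets_dens: "sets (dens w) = sets borel_S2"
  by (simp add: dens_def)

lemma admissible_dens:
  "r > 0 \<Longrightarrow> pos_weight w \<Longrightarrow> admissible r (dens w)"
  unfolding dens_def pos_weight_def by (auto intro: admissible_density)

lemma finite_dens: "pos_weight w \<Longrightarrow> finite_measure (dens w)"
  using admissible_dens[of 1 w] by (simp add: admissible_def)

lemma integral_dens:
  assumes w: "pos_weight w" and f: "continuous_on S2 f"
  shows "(\<integral>x. f x \<partial>dens w) = sint (\<lambda>x. w x * (f x :: real))"
proof -
  have "AE x in \<sigma>. 0 \<le> w x" by (rule AE_I2) (use w in \<open>auto simp: pos_weight_def less_imp_le\<close>)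
  then show ?thesis
    using w f unfolding dens_def sint_def pos_weight_def
    by (subst integral_density) (auto intro: continuous_S2_measurable)
qed

lemma nsq_dens:
  assumes w: "pos_weight w" and f: "continuous_on S2 f"
  shows "nsq (dens w) f = sint (\<lambda>x. w x * (f x)\<^sup>2)"
  unfolding nsq_real by (rule integral_dens[OF w]) (intro continuous_intros f)

lemma AE_dens:
  assumes w: "pos_weight w"
  shows "(AE x in dens w. P x) \<longleftrightarrow> (AE x in \<sigma>. P x)"
proof -
  have m: "w \<in> borel_measurable \<sigma>" 
    by (rule continuous_S2_measurable) (use w in \<open>auto simp: pos_weight_def\<close>)
  have "(AE x in dens w. P x) \<longleftrightarrow> (AE x in \<sigma>. 0 < ennreal (w x) \<longrightarrow> P x)"
    unfolding dens_def by (rule AE_density) (use m in measurable)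
  also have "\<dots> \<longleftrightarrow> (AE x in \<sigma>. P x)"
    by (rule AE_cong) (use w in \<open>simp add: pos_weight_def\<close>)
  finally show ?thesis .
qed

lemma nsq_const_linear: "nsq \<sigma> (\<lambda>x. a * 1 + b * (ax 3 \<bullet> x)) = 4 * pi * (a\<^sup>2 + b\<^sup>2 / 3)"
proof -
  have "nsq \<sigma> (\<lambda>x. a * 1 + b * (ax 3 \<bullet> x)) = a\<^sup>2 * nsq \<sigma> (\<lambda>x. 1 :: real) + 2 * a * b * (\<integral>x. 1 * (ax 3 \<bullet> x) \<partial>\<sigma>) + b\<^sup>2 * nsq \<sigma> (\<lambda>x. ax 3 \<bullet> x)"
    by (rule nsq_expand[of \<sigma> "\<lambda>_. 1" "\<lambda>x. ax 3 \<bullet> x" a b]) (auto intro: finite_measure_area_measure continuous_intros)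
  also have "(\<integral>x. 1 * (ax 3 \<bullet> x) \<partial>\<sigma>) = 0" using sint_inner[of "ax 3"] by (simp add: sint_def)
  also have "nsq \<sigma> (\<lambda>x. 1 :: real) = 4 * pi" using sint_const[of 1] by (simp add: nsq_real sint_def)
  finally show ?thesis by (simp add: nsq_inner ax_inner algebra_simps)
qed

lemma two_dim_dens:
  assumes w: "pos_weight w"
  shows "two_dim_subspace (dens w) {\<lambda>x. a * 1 + b * (ax 3 \<bullet> x) | a b. True}"
proof -
  have "a = 0 \<and> b = 0" if "AE x in \<sigma>. a * 1 + b * (ax 3 \<bullet> x) = 0" for a b
  proof -
    have c: "continuous_on S2 (\<lambda>x. (a * 1 + b * (ax 3 \<bullet> x))\<^sup>2)" by (intro continuous_intros)
    have "nsq \<sigma> (\<lambda>x. a * 1 + b * (ax 3 \<bullet> x)) = (\<integral>x. 0 \<partial>\<sigma>)"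
      unfolding nsq_real
      by (rule integral_cong_AE) (use that c in \<open>auto intro: continuous_S2_measurable\<close>)
    then have "a\<^sup>2 + b\<^sup>2 / 3 = 0" unfolding nsq_const_linear by simp
    then show ?thesis using zero_le_power2[of a] zero_le_power2[of b] by (auto simp: add_nonneg_eq_0_iff)
  qed
  then have "\<forall>a b. (AE x in \<sigma>. a * 1 + b * (ax 3 \<bullet> x) = 0) \<longrightarrow> a = 0 \<and> b = 0" by blast
  note * = this
  show ?thesis
    unfolding two_dim_subspace_def AE_dens[OF w]
    by (rule exI[of _ "\<lambda>_. 1"], rule exI[of _ "\<lambda>x. ax 3 \<bullet> x"])
       (intro conjI smooth_S2_const smooth_S2_inner refl *)
qed

section \<open>The perturbed measure and its distance from the area\<close>

lemma perturbed_weight: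
  assumes t: "0 < t" "t \<le> 1 / 350" and s: "s > 0"
  shows "pos_weight (\<lambda>x. s * (1 + t * psi x))"
  unfolding pos_weight_def
proof (intro conjI ballI)
  show "continuous_on S2 (\<lambda>x. s * (1 + t * psi x))" by (intro continuous_intros psi_continuous)
  fix x :: "real^3" assume "x \<in> S2"
  then have "\<bar>t * psi x\<bar> \<le> 1 / 350 * 1"
    unfolding abs_mult using t psi_bound by (intro mult_mono) auto
  then show "0 < s * (1 + t * psi x)" using s by (intro mult_pos_pos) auto
qed

lemma sint_perturbed:
  assumes f: "continuous_on S2 f"
  shows "sint (\<lambda>x. s * (1 + t * psi x) * f x) = s * (sint f + t * sint (\<lambda>x. psi x * f x))"
  using sint_cmult[of s "\<lambda>x. (1 + t * psi x) * f x"] by (simp add: sint_one_plus_psi[OF f] mult.assoc)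

lemma sint_psi_square_le:
  assumes "continuous_on S2 f"
  shows "\<bar>sint (\<lambda>x. psi x * (f x)\<^sup>2)\<bar> \<le> nsq \<sigma> f"
  unfolding nsq_sint
proof (rule sint_abs_le)
  fix x assume "x \<in> S2"
  then have "\<bar>psi x\<bar> * (f x)\<^sup>2 \<le> 1 * (f x)\<^sup>2" using psi_bound[of x] by (intro mult_right_mono) auto
  then show "\<bar>psi x * (f x)\<^sup>2\<bar> \<le> (f x)\<^sup>2" by (simp add: abs_mult)
qed (intro continuous_intros psi_continuous assms)+

text \<open>\<open>psi\<close> is orthogonal to squares of linear functions, so
  \<open>lambda1_lower_bound\<close> applies with \<open>\<delta> = 0\<close> and
  \<open>\<eta> = t\<close>, and the loss is quadratic in \<open>t\<close>. On the span of 1 and the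
  third coordinate the perturbation leaves all quotients unchanged, which gives the upper
  bound.\<close>

lemma perturbed_lambda1:
  assumes t: "0 < t" "t \<le> 1 / 350" and r: "r = 1 / (4 * pi)"
  defines "M \<equiv> dens (\<lambda>x. r * (1 + t * psi x))"
  shows "8 * pi / (1 + 384 * pi * t\<^sup>2) \<le> lambda1 r M" "lambda1 r M \<le> 8 * pi"
proof -
  have r0: "r > 0" by (simp add: r)
  note w = perturbed_weight[OF t r0]
  have fin: "finite_measure M" unfolding M_def by (rule finite_dens[OF w])
  have sets: "sets M = sets borel_S2" unfolding M_def by (rule sets_dens)
  have E: "two_dim_subspace M {\<lambda>x. a * 1 + b * (ax 3 \<bullet> x) | a b. True}"
    unfolding M_def by (rule two_dim_dens[OF w])
  have N: "nsq M f = r * (nsq \<sigma> f + t * sint (\<lambda>x. psi x * (f x)\<^sup>2))" if f: "continuous_on S2 f" for f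
    unfolding M_def nsq_dens[OF w f] nsq_sint by (rule sint_perturbed) (intro continuous_intros f)
  have "8 * pi / (1 + 3 * 0 + 384 * pi * t\<^sup>2) \<le> lambda1 r M"
  proof (rule lambda1_lower_bound[OF fin sets r E])
    fix f assume f: "smooth_S2 f"
    have c: "continuous_on S2 f" by (rule smooth_S2_continuous[OF f])
    have "t * sint (\<lambda>x. psi x * (f x)\<^sup>2) \<le> 1 / 100 * nsq \<sigma> f"
    proof -
      have "sint (\<lambda>x. psi x * (f x)\<^sup>2) \<le> nsq \<sigma> f" using sint_psi_square_le[OF c] by linarith
      then have "t * sint (\<lambda>x. psi x * (f x)\<^sup>2) \<le> t * nsq \<sigma> f" using t by (intro mult_left_mono) auto
      also have "\<dots> \<le> 1 / 100 * nsq \<sigma> f" using t nsq_nonneg by (intro mult_right_mono) auto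
      finally show ?thesis .
    qed
    then have "r * (nsq \<sigma> f + t * sint (\<lambda>x. psi x * (f x)\<^sup>2)) \<le> r * (nsq \<sigma> f + 1 / 100 * nsq \<sigma> f)"
      using r0 by (intro mult_left_mono add_left_mono) auto
    then show "nsq M f \<le> r * nsq \<sigma> f + 1 / 100 * (dirichlet f + r * nsq \<sigma> f)"
      unfolding N[OF c] using dirichlet_nonneg[of f] by (simp add: algebra_simps)
    have "(\<integral>x. f x \<partial>M) - r * sint f = r * (t * sint (\<lambda>x. psi x * f x))"
      unfolding M_def integral_dens[OF w c] sint_perturbed[OF c] by (simp add: algebra_simps)
    also have "\<bar>\<dots>\<bar> \<le> t * sqrt (r * nsq \<sigma> f)"
    proof -
      have "(r * sint (\<lambda>x. psi x * f x))\<^sup>2 \<le> r * nsq \<sigma> f"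
      proof -
        \<comment> \<open>Cauchy-Schwarz against the constant 1, whose squared norm
          \<open>4 * pi\<close> is \<open>1 / r\<close>.\<close>
        have "(sint (\<lambda>x. psi x * (1 * f x)))\<^sup>2 \<le> sint (\<lambda>x. 1\<^sup>2) * sint (\<lambda>x. (f x)\<^sup>2)"
          by (rule sint_psi_Cauchy_Schwarz) (auto intro: c)
        then have "r\<^sup>2 * (sint (\<lambda>x. psi x * f x))\<^sup>2 \<le> r\<^sup>2 * (4 * pi * nsq \<sigma> f)"
          by (intro mult_left_mono) (simp_all add: sint_const nsq_sint)
        also have "\<dots> = r * nsq \<sigma> f" by (simp add: r power2_eq_square)
        finally show ?thesis by (simp add: power_mult_distrib)
      qed
      then have "\<bar>r * sint (\<lambda>x. psi x * f x)\<bar> \<le> sqrt (r * nsq \<sigma> f)"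
        by (intro real_le_rsqrt) simp
      then have "t * \<bar>r * sint (\<lambda>x. psi x * f x)\<bar> \<le> t * sqrt (r * nsq \<sigma> f)"
        using t by (intro mult_left_mono) auto
      then show ?thesis using t by (simp add: abs_mult mult_ac)
    qed
    also have "\<dots> \<le> t * sqrt (dirichlet f + r * nsq \<sigma> f)"
      using t dirichlet_nonneg[of f] by (intro mult_left_mono real_sqrt_le_mono) auto
    finally show "\<bar>(\<integral>x. f x \<partial>M) - r * sint f\<bar> \<le> t * sqrt (dirichlet f + r * nsq \<sigma> f)" .
  next
    fix a
    have "sint (\<lambda>x. psi x * (a \<bullet> x)\<^sup>2) = 0" using sint_psi_inner_inner[of a] by (simp add: power2_eq_square)
    then show "nsq M (\<lambda>x. a \<bullet> x) \<le> r * nsq \<sigma> (\<lambda>x. a \<bullet> x) + 0 * (a \<bullet> a)"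
      by (subst N) (auto intro: continuous_intros)
  qed (use t in auto)
  then show "8 * pi / (1 + 384 * pi * t\<^sup>2) \<le> lambda1 r M" by simp
  show "lambda1 r M \<le> 8 * pi"
  proof (rule lambda1_le[OF fin sets r0 E])
    fix f assume fE: "f \<in> {\<lambda>x. a * 1 + b * (ax 3 \<bullet> x) | a b. True} - {\<lambda>x. 0}"
    then obtain a b where f: "f = (\<lambda>x. a * 1 + b * (ax 3 \<bullet> x))" by blast
    have sf: "smooth_S2 f" unfolding f by (intro smooth_S2_add smooth_S2_cmult smooth_S2_const smooth_S2_inner)
    have "a \<noteq> 0 \<or> b \<noteq> 0"
    proof (rule ccontr)
      assume "\<not> (a \<noteq> 0 \<or> b \<noteq> 0)"
      then have "f = (\<lambda>x. 0)" by (simp add: f)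
      then show False using fE by blast
    qed
    then have ab: "a\<^sup>2 + b\<^sup>2 / 3 > 0"
    proof
      assume "a \<noteq> 0"
      then show ?thesis by (intro add_pos_nonneg) auto
    next
      assume "b \<noteq> 0"
      then show ?thesis by (intro add_nonneg_pos) auto
    qed
    have p: "sint (\<lambda>x. psi x * (f x)\<^sup>2) = 0"
    proof -
      have "sint (\<lambda>x. psi x * (f x)\<^sup>2) = sint (\<lambda>x. a\<^sup>2 * psi x + (2 * a * b * (psi x * (ax 3 \<bullet> x)) + b\<^sup>2 * (psi x * ((ax 3 \<bullet> x) * (ax 3 \<bullet> x)))))"
        by (rule sint_cong) (simp add: f power2_eq_square algebra_simps)
      also have "\<dots> = a\<^sup>2 * sint psi + (2 * a * b * sint (\<lambda>x. psi x * (ax 3 \<bullet> x)) + b\<^sup>2 * sint (\<lambda>x. psi x * ((ax 3 \<bullet> x) * (ax 3 \<bullet> x))))"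
        by (simp only: sint_add sint_cmult continuous_intros psi_continuous)
      finally show ?thesis by (simp add: sint_psi sint_psi_inner sint_psi_inner_inner)
    qed
    have n: "nsq M f = a\<^sup>2 + b\<^sup>2 / 3"
      using N[OF smooth_S2_continuous[OF sf]] p by (simp add: f nsq_const_linear[simplified] r)
    have "dirichlet f = dirichlet (\<lambda>x. b * (ax 3 \<bullet> x))"
      unfolding dirichlet_def
    proof (rule sint_cong)
      fix x assume x: "x \<in> S2"
      have "grad_S2 f x = grad_S2 (\<lambda>x. a * 1) x + grad_S2 (\<lambda>x. b * (ax 3 \<bullet> x)) x"
        unfolding f by (rule grad_S2_add[OF _ _ x]) (intro smooth_S2_cmult smooth_S2_const smooth_S2_inner)+
      then show "grad_S2 f x \<bullet> grad_S2 f x = grad_S2 (\<lambda>x. b * (ax 3 \<bullet> x)) x \<bullet> grad_S2 (\<lambda>x. b * (ax 3 \<bullet> x)) x"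
        by (simp add: grad_S2_const[OF x])
    qed
    also have "\<dots> = 8 * pi * (b\<^sup>2 / 3)"
      unfolding dirichlet_cmult[OF smooth_S2_inner] dirichlet_inner by (simp add: ax_inner)
    also have "\<dots> \<le> 8 * pi * (a\<^sup>2 + b\<^sup>2 / 3)" by (intro mult_left_mono) auto
    finally show "rayleigh r M f \<le> 8 * pi"
      unfolding rayleigh_smooth[OF sf r0] n using ab by (simp add: pos_divide_le_eq)
  qed
qed

text \<open>The square of a suitable \<open>sharm_sum a\<close> is the test function for the dual
  norm: its integral is \<open>n\<close> for the area and at most
  \<open>(1 - 2 / 175 * t) * n\<close> for the image measure, while its Sobolev norm is at most
  \<open>C * n\<close>. Division by \<open>n\<close> leaves a bound whose \<open>C\<close> depends
  on none of \<open>t\<close>, \<open>s\<close> and \<open>\<Phi>\<close>.\<close>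

lemma distance_lower_bound:
  obtains C where "C > 0"
    "\<And>t s \<Phi>. 0 < t \<Longrightarrow> t \<le> 1 / 350 \<Longrightarrow> 0 < s \<Longrightarrow> s \<le> 1 \<Longrightarrow> conformal_automorphism \<Phi> \<Longrightarrow>
      2 / 175 * t \<le> C * Wm12_norm_diff 1 (distr (dens (\<lambda>x. s * (1 + t * psi x))) borel_S2 \<Phi>) \<sigma>"
proof -
  obtain C where C: "C > 0" "\<And>a. sqrt (dirichlet (\<lambda>x. sharm_sum a x * sharm_sum a x) + nsq \<sigma> (\<lambda>x. sharm_sum a x * sharm_sum a x))
    \<le> C * nsq \<sigma> (sharm_sum a)"
    using sharm_sum_square_W12 by blast
  have main: "2 / 175 * t \<le> C * Wm12_norm_diff 1 (distr (dens (\<lambda>x. s * (1 + t * psi x))) borel_S2 \<Phi>) \<sigma>"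
    if t: "0 < t" "t \<le> 1 / 350" and s: "0 < s" "s \<le> 1" and \<Phi>: "conformal_automorphism \<Phi>" for t s \<Phi>
  proof -
    obtain D c where "conformal_S2 \<Phi> D c" using conformal_automorphismE[OF \<Phi>] by blast
    then interpret conformal_S2 \<Phi> D c .
    define M where "M = dens (\<lambda>x. s * (1 + t * psi x))"
    define \<nu> where "\<nu> = distr M borel_S2 \<Phi>"
    note w = perturbed_weight[OF t s(1)]
    have finM: "finite_measure M" unfolding M_def by (rule finite_dens[OF w])
    have meas: "\<Phi> \<in> M \<rightarrow>\<^sub>M borel_S2"
      using measurable by (simp add: M_def sets_dens cong: measurable_cong_sets)
    have fin: "finite_measure \<nu>" unfolding \<nu>_def by (rule finite_measure.finite_measure_distr[OF finM meas])
    have sets: "sets \<nu> = sets borel_S2" by (simp add: \<nu>_def)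
    have int: "(\<integral>x. f x \<partial>\<nu>) = s * sint (\<lambda>x. (1 + t * psi x) * f (\<Phi> x))" if f: "continuous_on S2 f" for f
    proof -
      have "(\<integral>x. f x \<partial>\<nu>) = (\<integral>x. f (\<Phi> x) \<partial>M)"
        unfolding \<nu>_def by (rule integral_distr[OF meas]) (rule continuous_S2_measurable[OF refl f])
      also have "\<dots> = sint (\<lambda>x. s * (1 + t * psi x) * f (\<Phi> x))"
        unfolding M_def by (rule integral_dens[OF w]) (rule continuous_compose[OF f])
      finally show ?thesis using sint_cmult[of s "\<lambda>x. (1 + t * psi x) * f (\<Phi> x)"] by (simp add: mult.assoc)
    qed
    obtain K where K: "\<And>f. continuous_on S2 f \<Longrightarrow> (\<And>x. x \<in> S2 \<Longrightarrow> 0 \<le> f x) \<Longrightarrow> sint (\<lambda>x. f (\<Phi> x)) \<le> K * sint f" "K > 0"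
      using sint_compose_le by blast
    \<comment> \<open>A crude bound with a constant that depends on \<open>\<Phi>\<close>: it makes
      the \<open>Sup\<close> in the dual norm finite and does not enter the estimate.\<close>
    have "nsq \<nu> f \<le> 2 * K * (dirichlet f + 1 * nsq \<sigma> f)" if f: "smooth_S2 f" for f
    proof -
      have c: "continuous_on S2 (\<lambda>x. (f x)\<^sup>2)" by (intro continuous_intros smooth_S2_continuous f)
      have "nsq \<nu> f = s * sint (\<lambda>x. (1 + t * psi x) * (f (\<Phi> x))\<^sup>2)" unfolding nsq_real by (rule int[OF c])
      also have "\<dots> \<le> 1 * sint (\<lambda>x. 2 * (f (\<Phi> x))\<^sup>2)"
      proof (rule mult_mono)
        show "sint (\<lambda>x. (1 + t * psi x) * (f (\<Phi> x))\<^sup>2) \<le> sint (\<lambda>x. 2 * (f (\<Phi> x))\<^sup>2)"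
        proof (rule sint_mono)
          fix x assume x: "x \<in> S2"
          have "t * psi x \<le> t * 1" using t psi_bound[OF x] by (intro mult_left_mono) auto
          then have "t * psi x \<le> 1" using t by linarith
          then show "(1 + t * psi x) * (f (\<Phi> x))\<^sup>2 \<le> 2 * (f (\<Phi> x))\<^sup>2" by (intro mult_right_mono) auto
        qed (intro continuous_intros psi_continuous continuous_compose smooth_S2_continuous f)+
        show "0 \<le> sint (\<lambda>x. (1 + t * psi x) * (f (\<Phi> x))\<^sup>2)"
          by (rule sint_nonneg) (use w s in \<open>auto simp: pos_weight_def zero_less_mult_iff less_imp_le\<close>)
      qed (use s in auto)
      also have "\<dots> = 2 * sint (\<lambda>x. (f (\<Phi> x))\<^sup>2)" by (simp add: sint_cmult)
      also have "\<dots> \<le> 2 * (K * sint (\<lambda>x. (f x)\<^sup>2))" using K(1)[OF c] by simp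
      also have "\<dots> \<le> 2 * K * (dirichlet f + 1 * nsq \<sigma> f)"
        using K(2) dirichlet_nonneg[of f] by (simp add: nsq_sint distrib_left)
      finally show ?thesis .
    qed
    then have "\<exists>K. \<forall>f. smooth_S2 f \<longrightarrow> \<bar>(\<integral>x. f x \<partial>\<nu>) - (\<integral>x. f x \<partial>\<sigma>)\<bar> \<le> K * W12_norm 1 f"
      using K(2) by (intro dual_bound[OF fin sets, of 1 "2 * K"]) auto
    then obtain K' where K': "\<And>f. smooth_S2 f \<Longrightarrow> \<bar>(\<integral>x. f x \<partial>\<nu>) - (\<integral>x. f x \<partial>\<sigma>)\<bar> \<le> K' * W12_norm 1 f"
      by blast
    define \<eta> where "\<eta> = Wm12_norm_diff 1 \<nu> \<sigma>"
    have \<eta>: "0 \<le> \<eta>" "\<And>f. smooth_S2 f \<Longrightarrow> \<bar>(\<integral>x. f x \<partial>\<nu>) - (\<integral>x. f x \<partial>\<sigma>)\<bar> \<le> \<eta> * W12_norm 1 f"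
      unfolding \<eta>_def using Wm12_norm_diff_bound[OF _ K'] by simp_all
    \<comment> \<open>Nine coefficients against eight conditions: a combination of the pulled back
      harmonics that is orthogonal to all harmonics of index below 8.\<close>
    have "\<exists>a. (\<exists>k<Suc 8. a k \<noteq> 0) \<and> (\<forall>j<8. (\<Sum>k<Suc 8. a k * sint (\<lambda>x. sharm k (\<Phi> x) * sharm j x)) = 0)"
      by (rule homogeneous_system)
    then obtain a where a: "\<exists>k<9. a k \<noteq> 0" "\<And>j. j < 8 \<Longrightarrow> (\<Sum>k<9. a k * sint (\<lambda>x. sharm k (\<Phi> x) * sharm j x)) = 0"
      by auto
    let ?g = "sharm_sum a"
    define f where "f x = ?g (\<Phi> x)" for x
    have f: "smooth_S2 f" unfolding f_def by (rule sharm_sum_compose_smooth[OF smooth])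
    have ch: "k < 9 \<Longrightarrow> continuous_on S2 (sharm k)" for k using sharm_smooth smooth_S2_continuous by blast
    have orth: "sint (\<lambda>x. f x * sharm j x) = 0" if j: "j < 8" for j
    proof -
      have "sint (\<lambda>x. f x * sharm j x) = sint (\<lambda>x. \<Sum>k<9. a k * (sharm k (\<Phi> x) * sharm j x))"
        by (simp add: f_def sharm_sum_def sum_distrib_right mult.assoc)
      also have "\<dots> = (\<Sum>k<9. a k * sint (\<lambda>x. sharm k (\<Phi> x) * sharm j x))"
        unfolding sint_cmult[symmetric] by (rule sint_sum) (use j in \<open>auto intro!: continuous_intros continuous_compose ch\<close>)
      finally show ?thesis using a(2)[OF j] by simp
    qed
    define n where "n = nsq \<sigma> ?g"
    have n: "n > 0"
    proof -
      obtain k where k: "k < 9" "a k \<noteq> 0" using a(1) by blast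
      have pos: "0 < sharm_N j" if "j < 9" for j
        using sharm_N_pos[OF that] pi_gt_zero by linarith
      have "0 < (a k)\<^sup>2 * sharm_N k" using k pos by simp
      also have "\<dots> \<le> n"
        unfolding n_def nsq_sharm_sum using pos k by (intro member_le_sum) (auto simp: less_imp_le)
      finally show ?thesis .
    qed
    have "6 * sint (\<lambda>x. (1 + t * psi x) * (f x)\<^sup>2) \<le> (1 - 2 / 175 * t) * dirichlet f"
      by (rule orthogonal_Rayleigh_gap[OF f orth t])
    also have "dirichlet f = dirichlet ?g"
      unfolding f_def by (rule dirichlet_compose[OF sharm_sum_smooth f[unfolded f_def]])
    also have "(1 - 2 / 175 * t) * dirichlet ?g \<le> (1 - 2 / 175 * t) * (6 * n)"
      unfolding n_def using t by (intro mult_left_mono dirichlet_sharm_sum_le) auto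
    finally have up: "sint (\<lambda>x. (1 + t * psi x) * (f x)\<^sup>2) \<le> (1 - 2 / 175 * t) * n" by simp
    have g2: "smooth_S2 (\<lambda>x. ?g x * ?g x)" by (intro smooth_S2_mult sharm_sum_smooth)
    have "(\<integral>x. ?g x * ?g x \<partial>\<nu>) = s * sint (\<lambda>x. (1 + t * psi x) * (f x)\<^sup>2)"
      using int[OF smooth_S2_continuous[OF g2]] by (simp add: f_def power2_eq_square)
    \<comment> \<open>A factor \<open>s \<le> 1\<close> lowers the integral for the image measure,
      which works in favour of the bound.\<close>
    also have "\<dots> \<le> 1 * sint (\<lambda>x. (1 + t * psi x) * (f x)\<^sup>2)"
    proof (rule mult_right_mono[OF s(2)])
      show "0 \<le> sint (\<lambda>x. (1 + t * psi x) * (f x)\<^sup>2)"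
        by (rule sint_nonneg) (use w s in \<open>auto simp: pos_weight_def zero_less_mult_iff less_imp_le\<close>)
    qed
    also have "\<dots> \<le> (1 - 2 / 175 * t) * n" using up by simp
    finally have 1: "(\<integral>x. ?g x * ?g x \<partial>\<nu>) \<le> (1 - 2 / 175 * t) * n" .
    have 2: "(\<integral>x. ?g x * ?g x \<partial>\<sigma>) = n" by (simp add: n_def nsq_real power2_eq_square)
    have "W12_norm 1 (\<lambda>x. ?g x * ?g x) \<le> C * n"
      using C(2)[of a] W12_norm_eq_sqrt[OF g2, of 1] by (simp add: n_def)
    then have "\<eta> * W12_norm 1 (\<lambda>x. ?g x * ?g x) \<le> \<eta> * (C * n)" using \<eta>(1) by (rule mult_left_mono)
    then have "n - (1 - 2 / 175 * t) * n \<le> \<eta> * (C * n)"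
      using \<eta>(2)[OF g2] 1 2 by linarith
    then have "(2 / 175 * t) * n \<le> (C * \<eta>) * n" by (simp add: algebra_simps)
    then show ?thesis using n unfolding \<eta>_def \<nu>_def M_def by (rule mult_right_le_imp_le)
  qed
  show ?thesis using that[OF C(1)] main by blast
qed

text \<open>As \<open>t\<close> tends to zero the deficit is at most of order
  \<open>t\<^sup>2\<close>, while the distance from the area is at least of order \<open>t\<close>;
  an exponent below 2 contradicts this for small \<open>t\<close>.\<close>

lemma stability_exponent_sharp:
  assumes r: "r = 1 / (4 * pi)" and p: "0 < p" "p < 2" and c': "0 < c'"
    and stab: "\<forall>\<mu>. admissible r \<mu> \<and> lambda1 r \<mu> = 2 \<longrightarrow>
       (\<exists>\<Phi>. conformal_automorphism \<Phi> \<and>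
          8 * pi - lambda1_bar r \<mu> \<ge> c' * Wm12_norm_diff 1 (distr \<mu> borel_S2 \<Phi>) \<sigma> powr p)"
  shows False
proof -
  have r0: "r > 0" by (simp add: r)
  obtain C where C: "C > 0" and dist: "\<And>t s \<Phi>. 0 < t \<Longrightarrow> t \<le> 1 / 350 \<Longrightarrow> 0 < s \<Longrightarrow> s \<le> 1 \<Longrightarrow> conformal_automorphism \<Phi> \<Longrightarrow>
      2 / 175 * t \<le> C * Wm12_norm_diff 1 (distr (dens (\<lambda>x. s * (1 + t * psi x))) borel_S2 \<Phi>) \<sigma>"
    using distance_lower_bound by blast
  define B where "B = 2 / (175 * C)"
  have B: "B > 0" using C by (simp add: B_def)
  have ineq: "c' * (B * t) powr p \<le> 3072 * pi\<^sup>2 * t\<^sup>2" if t: "0 < t" "t \<le> 1 / 350" for t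
  proof -
    define M where "M = dens (\<lambda>x. r * (1 + t * psi x))"
    define \<Lambda> where "\<Lambda> = lambda1 r M"
    note w = perturbed_weight[OF t r0]
    have L: "8 * pi / (1 + 384 * pi * t\<^sup>2) \<le> \<Lambda>" "\<Lambda> \<le> 8 * pi"
      unfolding \<Lambda>_def M_def using perturbed_lambda1[OF t r] by auto
    have "0 < 8 * pi / (1 + 384 * pi * t\<^sup>2)" by (simp add: add_pos_nonneg)
    then have \<Lambda>: "\<Lambda> > 0" using L(1) by linarith
    \<comment> \<open>Scaling by \<open>4 * pi * s\<close> turns the density
      \<open>r * (1 + t * psi x)\<close> into \<open>s * (1 + t * psi x)\<close>. This
      \<open>s\<close> makes the new eigenvalue \<open>\<Lambda> / (4 * pi * s)\<close> equal to 2,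
      and as the mass is \<open>4 * pi * s\<close>, \<open>lambda1_bar\<close> becomes
      \<open>8 * pi * s = \<Lambda>\<close>.\<close>
    define s where "s = \<Lambda> / (8 * pi)"
    have s: "0 < s" "s \<le> 1" using \<Lambda> L(2) by (auto simp: s_def)
    have s_ge: "1 - s \<le> 384 * pi * t\<^sup>2"
    proof -
      define e where "e = 384 * pi * t\<^sup>2"
      have e: "e \<ge> 0" by (simp add: e_def)
      have "1 / (1 + e) \<le> s" using L(1) by (simp add: s_def e_def field_simps)
      moreover have "1 - e \<le> 1 / (1 + e)" using e by (simp add: field_simps)
      ultimately show ?thesis unfolding e_def by linarith
    qed
    note w' = perturbed_weight[OF t s(1)]
    define \<mu> where "\<mu> = dens (\<lambda>x. s * (1 + t * psi x))"
    have adm: "admissible r \<mu>" unfolding \<mu>_def by (rule admissible_dens[OF r0 w'])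
    have "lambda1 r \<mu> = lambda1 r M / (4 * pi * s)"
    proof (rule lambda1_scale[OF _ _ r0])
      show "finite_measure M" unfolding M_def by (rule finite_dens[OF w])
      show "sets M = sets borel_S2" unfolding M_def by (rule sets_dens)
      show "0 < 4 * pi * s" using s by simp
      show "two_dim_subspace M {\<lambda>x. a * 1 + b * (ax 3 \<bullet> x) | a b. True}"
        unfolding M_def by (rule two_dim_dens[OF w])
      show "(AE x in \<mu>. P x) \<longleftrightarrow> (AE x in M. P x)" for P
        unfolding \<mu>_def M_def AE_dens[OF w] AE_dens[OF w'] ..
      show "nsq \<mu> f = 4 * pi * s * nsq M f" if "smooth_S2 f" for f
      proof -
        have c: "continuous_on S2 f" by (rule smooth_S2_continuous[OF that])
        then have c2: "continuous_on S2 (\<lambda>x. (f x)\<^sup>2)" by (intro continuous_intros)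
        show ?thesis
          unfolding \<mu>_def M_def nsq_dens[OF w c] nsq_dens[OF w' c] sint_perturbed[OF c2] by (simp add: r)
      qed
    qed
    then have l2: "lambda1 r \<mu> = 2" using \<Lambda> by (simp add: \<Lambda>_def[symmetric] s_def)
    have "finite_measure \<mu>" unfolding \<mu>_def by (rule finite_dens[OF w'])
    then interpret finite_measure \<mu> .
    have sp: "space \<mu> = S2" unfolding \<mu>_def by (rule space_eq_S2[OF sets_dens])
    have "measure \<mu> S2 = (\<integral>x. 1 \<partial>\<mu>)" by (simp add: sp)
    also have "\<dots> = sint (\<lambda>x. s * (1 + t * psi x) * 1)"
      unfolding \<mu>_def by (rule integral_dens[OF w']) auto
    also have "\<dots> = 4 * pi * s" by (subst sint_perturbed) (auto simp: sint_const sint_psi)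
    finally have bar: "lambda1_bar r \<mu> = 8 * pi * s" by (simp add: lambda1_bar_def l2)
    obtain \<Phi> where \<Phi>: "conformal_automorphism \<Phi>"
      and st: "8 * pi - lambda1_bar r \<mu> \<ge> c' * Wm12_norm_diff 1 (distr \<mu> borel_S2 \<Phi>) \<sigma> powr p"
      using stab adm l2 by blast
    have "B * t \<le> Wm12_norm_diff 1 (distr \<mu> borel_S2 \<Phi>) \<sigma>"
      using dist[OF t s \<Phi>] C unfolding \<mu>_def[symmetric] by (simp add: B_def field_simps)
    then have "(B * t) powr p \<le> Wm12_norm_diff 1 (distr \<mu> borel_S2 \<Phi>) \<sigma> powr p"
      using B t p by (intro powr_mono2) auto
    then have "c' * (B * t) powr p \<le> c' * Wm12_norm_diff 1 (distr \<mu> borel_S2 \<Phi>) \<sigma> powr p"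
      using c' by (intro mult_left_mono) auto
    also have "\<dots> \<le> 8 * pi * (1 - s)" using st by (simp add: bar algebra_simps)
    also have "\<dots> \<le> 8 * pi * (384 * pi * t\<^sup>2)" by (intro mult_left_mono s_ge) simp
    finally show ?thesis by (simp add: power2_eq_square algebra_simps)
  qed
  define q where "q = c' * B powr p / (3072 * pi\<^sup>2)"
  have q: "q > 0" using c' B by (simp add: q_def)
  \<comment> \<open>Chosen such that \<open>t powr (2 - p) \<le> q / 2\<close>, while
    \<open>ineq\<close> at \<open>t\<close> demands \<open>q \<le> t powr (2 - p)\<close>.\<close>
  define t where "t = min (1 / 350) ((q / 2) powr (1 / (2 - p)))"
  have t: "0 < t" "t \<le> 1 / 350" using q by (auto simp: t_def)
  have "c' * B powr p * t powr p \<le> 3072 * pi\<^sup>2 * (t powr (2 - p) * t powr p)"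
    using ineq[OF t] B t by (simp add: powr_mult mult.assoc flip: powr_add)
  then have "c' * B powr p \<le> 3072 * pi\<^sup>2 * t powr (2 - p)"
    using t by (simp add: mult.assoc[symmetric])
  then have "q \<le> t powr (2 - p)" by (simp add: q_def field_simps)
  also have "\<dots> \<le> ((q / 2) powr (1 / (2 - p))) powr (2 - p)"
    using t p by (intro powr_mono2) (auto simp: t_def)
  also have "\<dots> = q / 2" using q p by (simp add: powr_powr)
  finally show False using q by simp
qed

theorem proposition7p2:
  fixes r :: real
  assumes "r > 0" and "measure (area_measure r) S2 = 1"
  shows "(\<exists>\<epsilon>0 > 0. \<exists>c > 0. \<forall>\<mu>.
            balanced \<mu> \<and> admissible r \<mu> \<and>
            (\<forall>u\<in>W12. (\<integral>x. (ext_op r \<mu> u x)\<^sup>2 \<partial>\<mu>) - (\<integral>x. (u x)\<^sup>2 \<partial>area_measure r)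
                        \<le> \<epsilon>0 * (W12_norm r u)\<^sup>2) \<longrightarrow>
            lambda1 r \<mu> \<ge>
              8 * pi / (1 + c * (Wm12_norm_diff r \<mu> (area_measure r)
                                 + (Wm12_norm_diff r \<mu> (area_measure r))\<^sup>2)) \<and>
            ((\<forall>w\<in>eigenspace r (8 * pi).
                (\<integral>x. (w x)\<^sup>2 \<partial>\<mu>) - (\<integral>x. (w x)\<^sup>2 \<partial>area_measure r) = 0) \<longrightarrow>
             lambda1 r \<mu> \<ge> 8 * pi / (1 + c * (Wm12_norm_diff r \<mu> (area_measure r))\<^sup>2))) \<and>
         (\<forall>p c'. 0 < p \<and> p < 2 \<and> 0 < c' \<longrightarrow>
            \<not> (\<forall>\<mu>. admissible r \<mu> \<and> lambda1 r \<mu> = 2 \<longrightarrow>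
                 (\<exists>\<Phi>. conformal_automorphism \<Phi> \<and>
                      8 * pi - lambda1_bar r \<mu> \<ge>
                        c' * Wm12_norm_diff 1 (distr \<mu> borel_S2 \<Phi>) (area_measure 1) powr p)))"
proof -
  \<comment> \<open>Unit area fixes the metric, as the unit sphere has area
    \<open>4 * pi\<close>.\<close>
  have r: "r = 1 / (4 * pi)"
    using assms measure_area_measure[of r] by (simp add: field_simps)
  show ?thesis
  proof (rule conjI)
    show "\<exists>\<epsilon>0 > 0. \<exists>c > 0. \<forall>\<mu>.
            balanced \<mu> \<and> admissible r \<mu> \<and>
            (\<forall>u\<in>W12. (\<integral>x. (ext_op r \<mu> u x)\<^sup>2 \<partial>\<mu>) - (\<integral>x. (u x)\<^sup>2 \<partial>area_measure r)
                        \<le> \<epsilon>0 * (W12_norm r u)\<^sup>2) \<longrightarrow>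
            lambda1 r \<mu> \<ge>
              8 * pi / (1 + c * (Wm12_norm_diff r \<mu> (area_measure r)
                                 + (Wm12_norm_diff r \<mu> (area_measure r))\<^sup>2)) \<and>
            ((\<forall>w\<in>eigenspace r (8 * pi).
                (\<integral>x. (w x)\<^sup>2 \<partial>\<mu>) - (\<integral>x. (w x)\<^sup>2 \<partial>area_measure r) = 0) \<longrightarrow>
             lambda1 r \<mu> \<ge> 8 * pi / (1 + c * (Wm12_norm_diff r \<mu> (area_measure r))\<^sup>2))"
    proof (rule exI[of _ "1 / 100"], intro conjI exI[of _ "384 * pi"] allI impI; (elim conjE)?)
      fix \<mu>
      assume h: "balanced \<mu>" "admissible r \<mu>"
        "\<forall>u\<in>W12. (\<integral>x. (ext_op r \<mu> u x)\<^sup>2 \<partial>\<mu>) - (\<integral>x. (u x)\<^sup>2 \<partial>area_measure r) \<le> 1 / 100 * (W12_norm r u)\<^sup>2"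
      show "lambda1 r \<mu> \<ge> 8 * pi / (1 + 384 * pi * (Wm12_norm_diff r \<mu> (area_measure r)
                                 + (Wm12_norm_diff r \<mu> (area_measure r))\<^sup>2))"
        by (rule admissible_lambda1_lower_bound(1)[OF r h])
      show "lambda1 r \<mu> \<ge> 8 * pi / (1 + 384 * pi * (Wm12_norm_diff r \<mu> (area_measure r))\<^sup>2)"
        if "\<forall>w\<in>eigenspace r (8 * pi). (\<integral>x. (w x)\<^sup>2 \<partial>\<mu>) - (\<integral>x. (w x)\<^sup>2 \<partial>area_measure r) = 0"
        by (rule admissible_lambda1_lower_bound(2)[OF r h that])
    qed simp_all
  qed (use stability_exponent_sharp[OF r] in blast)
qed

end
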